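(* Let $\mu\in\mathbb{R}$ be a constant known to all investors. In the $N$-player mean-variance game with full information and constant expected return $\mu$ described in the context, the tuple $\boldsymbol{\pi}^*=(\pi_1^*,\dots,\pi_N^* )$ given by $$\pi_i^*(t)=e^{-r(T-t)}\,\frac{\mu-r}{\sigma^2}\left(\kappa_i+\frac{\lambda_i^V}{1-\overline\lambda^V}\,\overline\kappa\right),\qquad t\in[0,T],\ i=1,\dots,N,$$ belongs to $\mathcal A_{\mu,S}^N$ and is a Nash equilibrium. Moreover, the value functions $V_i(t,\mathbf{x}):=J_i(t,\mathbf{x},\{\pi_j^*\}_{j\ne i},\pi_i^* )$ under $\boldsymbol{\pi}^*$ are, for $(t,\mathbf{x})\in[0,T]\times\mathbb{R}^N$ and $i=1,\dots,N$, $$V_i(t,\mathbf{x})=e^{r(T-t)}\left(x_i-\lambda_i^M\,\overline x\right)+(T-t)N_i,$$ where $$N_i:=\left(\frac{\mu-r}{\sigma}\right)^2\left\{\left(\kappa_i+\frac{\lambda_i^V-\lambda_i^M}{1-\overline\lambda^V}\,\overline\kappa\right)-\frac{\gamma_i\kappa_i^2}{2}\right\}.$$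
   Context: Parameters: $N\in\mathbb{N}$ investors, horizon $T>0$, riskfree rate $r\ge 0$, volatility $\sigma>0$; for each $i=1,\dots,N$, a risk aversion $\gamma_i>0$ and weights $\lambda_i^M,\lambda_i^V\in[0,1)$. Define $$\kappa_i:=\frac1{\gamma_i}\Big(1-\frac{\lambda_i^V}{N}\Big)^{-1}\Big(1-\frac{\lambda_i^M}{N}\Big),\quad \overline\kappa:=\frac1N\sum_{j=1}^N\kappa_j,\quad \overline\lambda^V:=\frac1N\sum_{j=1}^N\lambda_j^V .$$ Market: on a filtered probability space supporting a standard Brownian motion $W$, the stock satisfies $dS(u)=\mu S(u)du+\sigma S(u)dW(u)$, $S(0)=s>0$, with $\mu\in\mathbb{R}$ constant. $\mathbb{F}^{\mu,S}$ is the natural filtration generated by $\mu$ and $S$ (full information). Wealth: investor $i$ invests the amount $\pi_i(u)$ in the stock at time $u$; for $t\in[0,T)$, $$dX_i(u)=\big(rX_i(u)+\pi_i(u)(\mu-r)\big)du+\pi_i(u)\sigma\,dW(u),\quad u\in[t,T],\quad X_i(t)=x_i\in\mathbb{R}.$$ Write $\mathbf{x}=(x_1,\dots,x_N)$, $\mathbf{X}=(X_1,\dots,X_N)$, $\overline x=\frac1N\sum_j x_j$, $\overline X=\frac1N\sum_j X_j$. The superscript $t,\mathbf{x}$ on $\mathbb{E}$ and $\mathrm{Var}$ denotes conditioning on $\mathbf{X}(t)=\mathbf{x}$. Admissibility: $\mathcal A_{\mu,S}$ is the set of $\mathbb{F}^{\mu,S}$-progressively measurable $\pi:\Omega\times[0,T]\to\mathbb{R}$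 with $\mathbb{E}^{t,\mathbf{x}}\big[\int_t^T|\pi(u)|^2du\big]<\infty$ for all $(t,\mathbf{x})\in[0,T]\times\mathbb{R}^N$. A tuple $\boldsymbol\pi=(\pi_1,\dots,\pi_N)\in\mathcal A_{\mu,S}^N$ is Markov if for each $i$ there is a Borel measurable $\xi_i:[0,T]\times\mathbb{R}^N\to\mathbb{R}$ with $\pi_i(t)=\xi_i(t,\mathbf{X}(t))$ for a.e. $t\in[0,T]$ a.s. (this includes that the resulting coupled SDE system for $\mathbf X$ has a solution on $[t,T]$ from every initial condition $\mathbf{X}(t)=\mathbf{x}$); $\pi_i$ and $\xi_i$ are identified. For Markov strategies and $s\in(0,T)$, the concatenation $\theta_i\otimes_s\pi_i$ equals $\theta_i(t,\mathbf{x})$ for $0\le t<s$ and $\pi_i(t,\mathbf{x})$ for $s\le t\le T$. Objective of investor $i$, given the others' strategies: $$J_i(t,\mathbf{x},\{\pi_j\}_{j\ne i},\pi_i):=\mathbb{E}^{t,\mathbf{x}}\big[X_i(T)-\lambda_i^M\overline X(T)\big]-\frac{\gamma_i}2\mathrm{Var}^{t,\mathbf{x}}\big[X_i(T)-\lambda_i^V\overline X(T)\big].$$ Nash equilibrium: $\boldsymbol\pi^*\in\mathcal A_{\mu,S}^N$ is a Nash equilibrium if it is Markov and, for every $(t,\mathbf{x})\in[0,T)\times\mathbb{R}^N$ and every Markov $\boldsymbol\pi\in\mathcal A_{\mu,S}^N$, $$\liminf_{h\downarrow0}\frac{J_i(t,\mathbf{x},\{\pi_j^*\}_{j\ne i},\pi_i^*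 )-J_i(t,\mathbf{x},\{\pi_j^*\}_{j\ne i},\pi_i\otimes_{t+h}\pi_i^* )}{h}\ge0,\qquad i=1,\dots,N.$$ *)

theory Defs
  imports "HOL-Probability.Probability"
begin

subsection \<open>Brownian motion and the Ito integral\<close>

definition brownian_motion :: "'a measure \<Rightarrow> (real \<Rightarrow> 'a measure) \<Rightarrow> (real \<Rightarrow> 'a \<Rightarrow> real) \<Rightarrow> bool" where
  "brownian_motion M F W \<longleftrightarrow>
     (\<forall>u\<ge>0. W u \<in> borel_measurable (F u)) \<and>
     (\<forall>\<omega>\<in>space M. continuous_on {0..} (\<lambda>u. W u \<omega>)) \<and>
     (AE \<omega> in M. W 0 \<omega> = 0) \<and>
     (\<forall>u v. 0 \<le> u \<longrightarrow> u < v \<longrightarrow>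
        distributed M lborel (\<lambda>\<omega>. W v \<omega> - W u \<omega>) (normal_density 0 (sqrt (v - u))) \<and>
        prob_space.indep_set M (sets (F u))
          (sets (vimage_algebra (space M) (\<lambda>\<omega>. W v \<omega> - W u \<omega>) borel)))"

definition progressively_measurable ::
  "(real \<Rightarrow> 'a measure) \<Rightarrow> real \<Rightarrow> real \<Rightarrow> (real \<Rightarrow> 'a \<Rightarrow> real) \<Rightarrow> bool" where
  "progressively_measurable F a b H \<longleftrightarrow>
     (\<forall>u\<in>{a..b}. (\<lambda>(v, \<omega>). H v \<omega>) \<in> borel_measurable (restrict_space borel {a..u} \<Otimes>\<^sub>M F u))"

definition elementary_integrand ::
  "'a measure \<Rightarrow> (real \<Rightarrow> 'a measure) \<Rightarrow> real \<Rightarrow> real \<Rightarrow>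
   nat \<Rightarrow> (nat \<Rightarrow> real) \<Rightarrow> (nat \<Rightarrow> 'a \<Rightarrow> real) \<Rightarrow> bool" where
  "elementary_integrand M F a b n \<tau> \<zeta> \<longleftrightarrow>
     (\<forall>k\<le>n. \<tau> k \<in> {a..b}) \<and> (\<forall>k<n. \<tau> k \<le> \<tau> (Suc k)) \<and>
     (\<forall>k<n. \<zeta> k \<in> borel_measurable (F (\<tau> k)) \<and> (\<exists>C. \<forall>\<omega>\<in>space M. \<bar>\<zeta> k \<omega>\<bar> \<le> C))"

definition elementary_process ::
  "nat \<Rightarrow> (nat \<Rightarrow> real) \<Rightarrow> (nat \<Rightarrow> 'a \<Rightarrow> real) \<Rightarrow> real \<Rightarrow> 'a \<Rightarrow> real" where
  "elementary_process n \<tau> \<zeta> u \<omega> = (\<Sum>k<n. \<zeta> k \<omega> * indicator {\<tau> k<..\<tau> (Suc k)} u)"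

definition elementary_integral ::
  "(real \<Rightarrow> 'a \<Rightarrow> real) \<Rightarrow> nat \<Rightarrow> (nat \<Rightarrow> real) \<Rightarrow> (nat \<Rightarrow> 'a \<Rightarrow> real) \<Rightarrow> 'a \<Rightarrow> real" where
  "elementary_integral W n \<tau> \<zeta> \<omega> = (\<Sum>k<n. \<zeta> k \<omega> * (W (\<tau> (Suc k)) \<omega> - W (\<tau> k) \<omega>))"

text \<open>
  The relation below says that \<open>Z\<close> is (a version of) the Ito integral of \<open>H\<close> against \<open>W\<close> over
  \<open>{a..b}\<close>, as the mean-square limit of elementary integrals. It covers exactly the square
  integrable integrands: convergence of the elementary processes forces \<open>H\<close> to be square
  integrable on \<open>{a..b} \<times> \<Omega>\<close>. By the Ito isometry \<open>Z\<close> is unique up to null sets.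
\<close>

definition has_ito_integral ::
  "'a measure \<Rightarrow> (real \<Rightarrow> 'a measure) \<Rightarrow> (real \<Rightarrow> 'a \<Rightarrow> real) \<Rightarrow> real \<Rightarrow> real \<Rightarrow>
   (real \<Rightarrow> 'a \<Rightarrow> real) \<Rightarrow> ('a \<Rightarrow> real) \<Rightarrow> bool" where
  "has_ito_integral M F W a b H Z \<longleftrightarrow>
     progressively_measurable F a b H \<and> Z \<in> borel_measurable M \<and>
     (\<exists>n \<tau> \<zeta>. (\<forall>m. elementary_integrand M F a b (n m) (\<tau> m) (\<zeta> m)) \<and>
        (\<lambda>m. \<integral>\<^sup>+\<omega>. (\<integral>\<^sup>+u\<in>{a..b}. ennreal ((H u \<omega> - elementary_process (n m) (\<tau> m) (\<zeta> m) u \<omega>)\<^sup>2)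
           \<partial>lborel) \<partial>M) \<longlonglongrightarrow> 0 \<and>
        (\<lambda>m. \<integral>\<^sup>+\<omega>. ennreal ((Z \<omega> - elementary_integral W (n m) (\<tau> m) (\<zeta> m) \<omega>)\<^sup>2) \<partial>M) \<longlonglongrightarrow> 0)"

subsection \<open>The market\<close>

text \<open>
  \<open>dS = \<mu> S du + \<sigma> S dW\<close>, \<open>S(0) = s\<close> on \<open>{0..T}\<close>. The solution is geometric Brownian motion, which is
  square integrable, so nothing is lost by reading the SDE with the mean-square integral.
\<close>

definition stock_price ::
  "'a measure \<Rightarrow> (real \<Rightarrow> 'a measure) \<Rightarrow> (real \<Rightarrow> 'a \<Rightarrow> real) \<Rightarrow> real \<Rightarrow> real \<Rightarrow> real \<Rightarrow> real \<Rightarrow>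
   (real \<Rightarrow> 'a \<Rightarrow> real) \<Rightarrow> bool" where
  "stock_price M F W \<mu> \<sigma> T s S \<longleftrightarrow>
     (\<forall>u\<in>{0..T}. S u \<in> borel_measurable (F u)) \<and>
     (\<forall>\<omega>\<in>space M. continuous_on {0..T} (\<lambda>u. S u \<omega>)) \<and>
     (AE \<omega> in M. S 0 \<omega> = s) \<and>
     (\<forall>u\<in>{0..T}. \<exists>Z. has_ito_integral M F W 0 u (\<lambda>v \<omega>. \<sigma> * S v \<omega>) Z \<and>
        (AE \<omega> in M. S u \<omega> = s + (LBINT v:{0..u}. \<mu> * S v \<omega>) + Z \<omega>))"

text \<open>The (not augmented) filtration generated by a random variable \<open>m\<close> and a process \<open>S\<close>.\<close>

definition information :: "'a measure \<Rightarrow> ('a \<Rightarrow> real) \<Rightarrow> (real \<Rightarrow> 'a \<Rightarrow> real) \<Rightarrow> real \<Rightarrow> 'a measure" where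
  "information M m S u = sigma (space M)
     ({m -` A \<inter> space M |A. A \<in> sets borel} \<union>
      {S v -` A \<inter> space M |v A. v \<in> {0..u} \<and> A \<in> sets borel})"

subsection \<open>Wealth and strategies\<close>

text \<open>
  The investors are the elements of the finite type \<open>'n\<close>, so \<open>N = CARD('n)\<close>.
  The next predicate says that \<open>X\<close> solves on \<open>{t..T}\<close> the wealth equations
  \<open>dX\<^sub>i = (r X\<^sub>i + \<pi>\<^sub>i (\<mu> - r)) du + \<pi>\<^sub>i \<sigma> dW\<close> with \<open>X(t) = x\<close>.
\<close>

definition wealth_process ::
  "'a measure \<Rightarrow> (real \<Rightarrow> 'a measure) \<Rightarrow> (real \<Rightarrow> 'a \<Rightarrow> real) \<Rightarrow> real \<Rightarrow> real \<Rightarrow> real \<Rightarrow> real \<Rightarrow>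
   real \<Rightarrow> real^'n \<Rightarrow> ('n::finite \<Rightarrow> real \<Rightarrow> 'a \<Rightarrow> real) \<Rightarrow> (real \<Rightarrow> 'a \<Rightarrow> real^'n) \<Rightarrow> bool" where
  "wealth_process M F W r \<mu> \<sigma> T t x \<pi> X \<longleftrightarrow>
     (\<forall>u\<in>{t..T}. X u \<in> borel_measurable (F u)) \<and>
     (\<forall>\<omega>\<in>space M. continuous_on {t..T} (\<lambda>u. X u \<omega>)) \<and>
     (AE \<omega> in M. X t \<omega> = x) \<and>
     (\<forall>i. \<forall>u\<in>{t..T}. \<exists>Z. has_ito_integral M F W t u (\<lambda>v \<omega>. \<pi> i v \<omega> * \<sigma>) Z \<and>
        (AE \<omega> in M. X u \<omega> $ i =
           x $ i + (LBINT v:{t..u}. r * X v \<omega> $ i + \<pi> i v \<omega> * (\<mu> - r)) + Z \<omega>))"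

text \<open>
  Admissible investment processes on \<open>{t..T}\<close> for the information flow \<open>G\<close>. Conditioning on
  \<open>X(t) = x\<close> is realised by starting the wealth equations at time \<open>t\<close> from the constant \<open>x\<close>, so that
  the conditional expectation given this event becomes the expectation under \<open>M\<close>, and \<open>x\<close>
  enters only through the process itself.
\<close>

definition admissible ::
  "'a measure \<Rightarrow> (real \<Rightarrow> 'a measure) \<Rightarrow> real \<Rightarrow> real \<Rightarrow> (real \<Rightarrow> 'a \<Rightarrow> real) set" where
  "admissible M G t T = {\<pi>. progressively_measurable G t T \<pi> \<and>
     (\<integral>\<^sup>+\<omega>. (\<integral>\<^sup>+u\<in>{t..T}. ennreal ((\<pi> u \<omega>)\<^sup>2) \<partial>lborel) \<partial>M) < \<infinity>}"

text \<open>
  \<open>X\<close> is a wealth process started at \<open>X(t) = x\<close> when each investor \<open>i\<close> follows the feedback rule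
  \<open>\<xi> i\<close>, the resulting investment processes being admissible.
\<close>

definition closed_loop_wealth ::
  "'a measure \<Rightarrow> (real \<Rightarrow> 'a measure) \<Rightarrow> (real \<Rightarrow> 'a \<Rightarrow> real) \<Rightarrow> (real \<Rightarrow> 'a measure) \<Rightarrow>
   real \<Rightarrow> real \<Rightarrow> real \<Rightarrow> real \<Rightarrow> ('n::finite \<Rightarrow> real \<Rightarrow> real^'n \<Rightarrow> real) \<Rightarrow>
   real \<Rightarrow> real^'n \<Rightarrow> (real \<Rightarrow> 'a \<Rightarrow> real^'n) \<Rightarrow> bool" where
  "closed_loop_wealth M F W G r \<mu> \<sigma> T \<xi> t x X \<longleftrightarrow>
     (\<exists>\<pi>. (\<forall>i. \<pi> i \<in> admissible M G t T) \<and>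
        wealth_process M F W r \<mu> \<sigma> T t x \<pi> X \<and>
        (\<forall>i. AE \<omega> in M. AE u in lborel. u \<in> {t..T} \<longrightarrow> \<pi> i u \<omega> = \<xi> i u (X u \<omega>)))"

definition markov_strategy ::
  "'a measure \<Rightarrow> (real \<Rightarrow> 'a measure) \<Rightarrow> (real \<Rightarrow> 'a \<Rightarrow> real) \<Rightarrow> (real \<Rightarrow> 'a measure) \<Rightarrow>
   real \<Rightarrow> real \<Rightarrow> real \<Rightarrow> real \<Rightarrow> ('n::finite \<Rightarrow> real \<Rightarrow> real^'n \<Rightarrow> real) \<Rightarrow> bool" where
  "markov_strategy M F W G r \<mu> \<sigma> T \<xi> \<longleftrightarrow>
     (\<forall>i. (\<lambda>(u, x). \<xi> i u x) \<in> borel_measurable (restrict_space borel {0..T} \<Otimes>\<^sub>M borel)) \<and>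
     (\<forall>t\<in>{0..T}. \<forall>x. \<exists>X. closed_loop_wealth M F W G r \<mu> \<sigma> T \<xi> t x X)"

definition concat_strategy ::
  "real \<Rightarrow> (real \<Rightarrow> 'x \<Rightarrow> real) \<Rightarrow> (real \<Rightarrow> 'x \<Rightarrow> real) \<Rightarrow> real \<Rightarrow> 'x \<Rightarrow> real" where
  "concat_strategy s \<theta> \<xi> u x = (if u < s then \<theta> u x else \<xi> u x)"

subsection \<open>Objectives and equilibrium\<close>

definition avg :: "('n::finite \<Rightarrow> real) \<Rightarrow> real" where
  "avg f = (\<Sum>j\<in>UNIV. f j) / real CARD('n)"

text \<open>The objective \<open>J\<^sub>i\<close>, evaluated on the wealth process that a strategy tuple generates.\<close>

definition objective ::
  "'a measure \<Rightarrow> real \<Rightarrow> ('n::finite \<Rightarrow> real) \<Rightarrow> ('n \<Rightarrow> real) \<Rightarrow> ('n \<Rightarrow> real) \<Rightarrow> 'n \<Rightarrow>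
   (real \<Rightarrow> 'a \<Rightarrow> real^'n) \<Rightarrow> real" where
  "objective M T \<gamma> lM lV i X =
     prob_space.expectation M (\<lambda>\<omega>. X T \<omega> $ i - lM i * avg (($) (X T \<omega>)))
     - \<gamma> i / 2 * prob_space.variance M (\<lambda>\<omega>. X T \<omega> $ i - lV i * avg (($) (X T \<omega>)))"

text \<open>
  A feedback tuple need not determine the wealth process uniquely. The equilibrium inequality is
  therefore required for all wealth processes \<open>X\<close> generated by \<open>\<xi>\<close> and all families \<open>Y\<close> such that
  \<open>Y h\<close> is generated by the deviation of investor \<open>i\<close> until time \<open>t + h\<close>; a value
  of the objective depends only on the wealth process.
\<close>

definition nash_equilibrium ::
  "'a measure \<Rightarrow> (real \<Rightarrow> 'a measure) \<Rightarrow> (real \<Rightarrow> 'a \<Rightarrow> real) \<Rightarrow> (real \<Rightarrow> 'a measure) \<Rightarrow>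
   real \<Rightarrow> real \<Rightarrow> real \<Rightarrow> real \<Rightarrow> ('n::finite \<Rightarrow> real) \<Rightarrow> ('n \<Rightarrow> real) \<Rightarrow> ('n \<Rightarrow> real) \<Rightarrow>
   ('n \<Rightarrow> real \<Rightarrow> real^'n \<Rightarrow> real) \<Rightarrow> bool" where
  "nash_equilibrium M F W G r \<mu> \<sigma> T \<gamma> lM lV \<xi> \<longleftrightarrow>
     markov_strategy M F W G r \<mu> \<sigma> T \<xi> \<and>
     (\<forall>t\<in>{0..<T}. \<forall>x. \<forall>\<theta>. markov_strategy M F W G r \<mu> \<sigma> T \<theta> \<longrightarrow>
       (\<forall>i X Y.
          closed_loop_wealth M F W G r \<mu> \<sigma> T \<xi> t x X \<longrightarrow>
          (\<forall>\<^sub>F h in at_right 0. closed_loop_wealth M F W G r \<mu> \<sigma> T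
             (\<xi>(i := concat_strategy (t + h) (\<theta> i) (\<xi> i))) t x (Y h)) \<longrightarrow>
          0 \<le> Liminf (at_right 0) (\<lambda>h. ereal
             ((objective M T \<gamma> lM lV i X - objective M T \<gamma> lM lV i (Y h)) / h))))"

definition kappa :: "('n::finite \<Rightarrow> real) \<Rightarrow> ('n \<Rightarrow> real) \<Rightarrow> ('n \<Rightarrow> real) \<Rightarrow> 'n \<Rightarrow> real" where
  "kappa \<gamma> lM lV i =
     1 / \<gamma> i * inverse (1 - lV i / real CARD('n)) * (1 - lM i / real CARD('n))"

definition equilibrium_amount ::
  "real \<Rightarrow> real \<Rightarrow> real \<Rightarrow> real \<Rightarrow> ('n::finite \<Rightarrow> real) \<Rightarrow> ('n \<Rightarrow> real) \<Rightarrow> ('n \<Rightarrow> real) \<Rightarrow>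
   'n \<Rightarrow> real \<Rightarrow> real" where
  "equilibrium_amount r \<mu> \<sigma> T \<gamma> lM lV i t =
     exp (- r * (T - t)) * ((\<mu> - r) / \<sigma>\<^sup>2) *
       (kappa \<gamma> lM lV i + lV i / (1 - avg lV) * avg (kappa \<gamma> lM lV))"

definition value_rate ::
  "real \<Rightarrow> real \<Rightarrow> real \<Rightarrow> ('n::finite \<Rightarrow> real) \<Rightarrow> ('n \<Rightarrow> real) \<Rightarrow> ('n \<Rightarrow> real) \<Rightarrow> 'n \<Rightarrow> real" where
  "value_rate r \<mu> \<sigma> \<gamma> lM lV i = ((\<mu> - r) / \<sigma>)\<^sup>2 *
     ((kappa \<gamma> lM lV i + (lV i - lM i) / (1 - avg lV) * avg (kappa \<gamma> lM lV))
       - \<gamma> i * (kappa \<gamma> lM lV i)\<^sup>2 / 2)"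

end

theory Submission
  imports Defs
begin

text \<open>
  Under strategies that do not depend on the state the wealth equations are solved explicitly in terms of
  the Brownian motion, which gives the value functions. For a deviation of one investor on \<open>[t, t + h]\<close>
  put \<open>Q = E \<integral> \<epsilon>\<^sup>2\<close>, where \<open>\<epsilon>\<close> is the change of the invested amount. The change \<open>D\<close> of the terminal
  wealth is \<open>e\<^bsup>r(T - t)\<^esup> ((\<mu> - r) \<integral> \<epsilon> du + \<sigma> \<integral> \<epsilon> dW)\<close> up to an error of size \<open>O(h \<surd>Q)\<close> in mean square. By the
  choice of the strategies the terms of the objective that are linear in \<open>E \<integral> \<epsilon>\<close> cancel
  exactly, while the variance of \<open>D\<close> costs at least a multiple of \<open>Q\<close>. Hence the gain of the deviation is at most
  \<open>C h \<surd>Q - c Q \<le> (C h)\<^sup>2 / (4 c)\<close>, which is \<open>o(h)\<close> whatever the size of \<open>\<epsilon>\<close>. The other investors'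
  wealths are unaffected, since a wealth process is determined by its strategy up to null sets.
\<close>

subsection \<open>Square integrable functions\<close>

text \<open>The deviating rule is merely measurable and the amounts it produces merely square
  integrable, so nothing can be said about the deviation itself as \<open>h\<close> tends to 0.
  Every estimate is therefore relative to \<open>\<surd>Q\<close>, with constants that depend on
  \<open>t\<close> and the market only.

  Why the linear terms reduce to one number: the equilibrium amounts are deterministic and
  proportional to \<open>exp (- r * (T - t))\<close>, so the equilibrium terminal wealths are affine
  in \<open>W T - W t\<close>. The covariance of \<open>D\<close> with them is thus a multiple of
  the mean of \<open>(W T - W t) * D\<close>. Up to errors of order \<open>h \<surd>Q\<close>, this
  mean and the mean of \<open>D\<close> are multiples of the same
  \<open>E \<integral> \<epsilon>\<close>, and the first order condition says that the two
  contributions balance.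

  The delicate error is the covariance of \<open>W T - W t\<close> with the drift part of
  \<open>D\<close>: a direct estimate gives only \<open>\<surd>h \<surd>Q\<close>, which would not
  be \<open>o(h)\<close> after completing the square. Adaptedness of the deviation supplies the
  missing factor.

  Stochastic integrals are treated as a closed linear relation between two spaces of square
  integrable functions, with the isometry in bilinear form because covariances are needed.\<close>

definition sq_int :: "'b measure \<Rightarrow> ('b \<Rightarrow> real) \<Rightarrow> bool" where
  "sq_int N f \<longleftrightarrow> f \<in> borel_measurable N \<and> integrable N (\<lambda>x. (f x)\<^sup>2)"

lemma sq_int_measurable: "sq_int N f \<Longrightarrow> f \<in> borel_measurable N"
  by (simp add: sq_int_def)

lemma sq_int_integrable: "sq_int N f \<Longrightarrow> integrable N (\<lambda>x. (f x)\<^sup>2)"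
  by (simp add: sq_int_def)

lemma sq_int_bound:
  assumes "f \<in> borel_measurable N" "integrable N g" "AE x in N. (f x)\<^sup>2 \<le> g x"
  shows "sq_int N f"
  unfolding sq_int_def
proof
  show "f \<in> borel_measurable N" by fact
  show "integrable N (\<lambda>x. (f x)\<^sup>2)"
    using assms by (intro Bochner_Integration.integrable_bound[OF assms(2)]) auto
qed

lemma sq_int_AE_cong:
  assumes "sq_int N f" "g \<in> borel_measurable N" "AE x in N. g x = f x"
  shows "sq_int N g"
  using assms by (intro sq_int_bound[of g N "\<lambda>x. (f x)\<^sup>2"]) (auto simp: sq_int_def)

lemma sq_int_cmult: "sq_int N f \<Longrightarrow> sq_int N (\<lambda>x. c * f x)"
  by (auto simp: sq_int_def power_mult_distrib)

lemma square_add_le: "(x + y)\<^sup>2 \<le> 2 * x\<^sup>2 + 2 * y\<^sup>2" for x y :: real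
  using sum_squares_bound[of x y] by (simp add: power2_sum)

lemma sq_int_add:
  assumes "sq_int N f" "sq_int N g"
  shows "sq_int N (\<lambda>x. f x + g x)"
proof (rule sq_int_bound)
  show "integrable N (\<lambda>x. 2 * (f x)\<^sup>2 + 2 * (g x)\<^sup>2)"
    using assms by (auto simp: sq_int_def)
  show "AE x in N. (f x + g x)\<^sup>2 \<le> 2 * (f x)\<^sup>2 + 2 * (g x)\<^sup>2"
    by (intro AE_I2 square_add_le)
qed (use assms in \<open>auto simp: sq_int_def\<close>)

lemma sq_int_diff: "sq_int N f \<Longrightarrow> sq_int N g \<Longrightarrow> sq_int N (\<lambda>x. f x - g x)"
  using sq_int_add[of N f "\<lambda>x. (-1) * g x"] sq_int_cmult[of N g "-1"] by simp

lemma sq_int_zero: "sq_int N (\<lambda>x. 0)"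
  by (simp add: sq_int_def)

lemma sq_int_sum:
  "(\<And>i. i \<in> I \<Longrightarrow> sq_int N (f i)) \<Longrightarrow> sq_int N (\<lambda>x. \<Sum>i\<in>I. f i x)"
  by (induction I rule: infinite_finite_induct) (auto intro: sq_int_add sq_int_zero)

lemma integrable_mult_sq_int:
  assumes "sq_int N f" "sq_int N g"
  shows "integrable N (\<lambda>x. f x * g x)"
proof (rule Bochner_Integration.integrable_bound)
  show "integrable N (\<lambda>x. (f x)\<^sup>2 + (g x)\<^sup>2)"
    using assms by (auto simp: sq_int_def)
  show "AE x in N. norm (f x * g x) \<le> norm ((f x)\<^sup>2 + (g x)\<^sup>2)"
  proof (intro AE_I2)
    fix x
    have "0 \<le> (\<bar>f x\<bar> - \<bar>g x\<bar>)\<^sup>2" by simp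
    then have "2 * \<bar>f x * g x\<bar> \<le> (f x)\<^sup>2 + (g x)\<^sup>2"
      by (simp add: power2_diff abs_mult)
    then show "norm (f x * g x) \<le> norm ((f x)\<^sup>2 + (g x)\<^sup>2)"
      by simp
  qed
qed (use assms in \<open>auto simp: sq_int_def\<close>)

lemma (in finite_measure) sq_int_const: "sq_int M (\<lambda>x. c)"
  by (simp add: sq_int_def)

lemma (in finite_measure) integrable_sq_int: "sq_int M f \<Longrightarrow> integrable M f"
  using integrable_mult_sq_int[of M f "\<lambda>_. 1"] sq_int_const[of 1] by simp

text \<open>Cauchy-Schwarz from a nonnegative quadratic form in \<open>\<alpha>\<close> and
  \<open>\<beta>\<close>; two parameters permit the choice \<open>\<alpha> = C\<close>,
  \<open>\<beta> = - B\<close> without division.\<close>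

lemma integral_mult_square_le:
  assumes "sq_int N f" "sq_int N g"
  shows "(\<integral>x. f x * g x \<partial>N)\<^sup>2 \<le> (\<integral>x. (f x)\<^sup>2 \<partial>N) * (\<integral>x. (g x)\<^sup>2 \<partial>N)"
proof -
  define A B C where "A = (\<integral>x. (f x)\<^sup>2 \<partial>N)" and "B = (\<integral>x. f x * g x \<partial>N)" and "C = (\<integral>x. (g x)\<^sup>2 \<partial>N)"
  have [simp]: "integrable N (\<lambda>x. (f x)\<^sup>2)" "integrable N (\<lambda>x. (g x)\<^sup>2)" "integrable N (\<lambda>x. f x * g x)"
    using assms integrable_mult_sq_int by (auto simp: sq_int_def)
  have *: "0 \<le> \<alpha>\<^sup>2 * A + 2 * \<alpha> * \<beta> * B + \<beta>\<^sup>2 * C" for \<alpha> \<beta>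
  proof -
    have "0 \<le> (\<integral>x. (\<alpha> * f x + \<beta> * g x)\<^sup>2 \<partial>N)" by (intro integral_nonneg_AE) simp
    also have "\<dots> = (\<integral>x. \<alpha>\<^sup>2 * (f x)\<^sup>2 + (2 * \<alpha> * \<beta>) * (f x * g x) + \<beta>\<^sup>2 * (g x)\<^sup>2 \<partial>N)"
      by (intro Bochner_Integration.integral_cong) (auto simp: power2_eq_square algebra_simps)
    also have "\<dots> = \<alpha>\<^sup>2 * A + 2 * \<alpha> * \<beta> * B + \<beta>\<^sup>2 * C"
      unfolding A_def B_def C_def
      by (subst Bochner_Integration.integral_add
        Bochner_Integration.integral_mult_right_zero;
          (intro Bochner_Integration.integrable_add Bochner_Integration.integrable_mult_right)?; simp)+
    finally show ?thesis .
  qed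
  have C0: "C \<ge> 0" and A0: "A \<ge> 0" unfolding A_def C_def by (auto intro!: integral_nonneg_AE)
  have "B\<^sup>2 \<le> A * C"
  proof (cases "C = 0")
    case True
    have "B = 0"
    proof (rule ccontr)
      assume "B \<noteq> 0"
      \<comment> \<open>With \<open>C = 0\<close> the form is affine in \<open>\<beta>\<close>, and
        this \<open>\<beta>\<close> brings it down to \<open>- A - 2\<close>.\<close>
      have "0 \<le> A + 2 * (- (A + 1) / B) * B"
        using *[of 1 "- (A + 1) / B"] True by simp
      moreover have "- (A + 1) / B * B = - (A + 1)" using \<open>B \<noteq> 0\<close> by simp
      ultimately show False using A0 by linarith
    qed
    then show ?thesis using A0 C0 by simp
  next
    case False
    then have Cp: "C > 0" using C0 by simp
    have "0 \<le> C\<^sup>2 * A - 2 * C * B * B + B\<^sup>2 * C"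
      using *[of C "-B"] by (simp add: power2_eq_square algebra_simps)
    also have "\<dots> = C * (A * C - B\<^sup>2)" by (simp add: power2_eq_square algebra_simps)
    finally show ?thesis using Cp by (simp add: zero_le_mult_iff)
  qed
  then show ?thesis unfolding A_def B_def C_def .
qed

lemma abs_integral_mult_le:
  assumes "sq_int N f" "sq_int N g"
    and "(\<integral>x. (f x)\<^sup>2 \<partial>N) \<le> a\<^sup>2" "(\<integral>x. (g x)\<^sup>2 \<partial>N) \<le> b\<^sup>2" "a \<ge> 0" "b \<ge> 0"
  shows "\<bar>\<integral>x. f x * g x \<partial>N\<bar> \<le> a * b"
proof -
  have "(\<integral>x. f x * g x \<partial>N)\<^sup>2 \<le> a\<^sup>2 * b\<^sup>2"
    by (rule order_trans[OF integral_mult_square_le[OF assms(1,2)]])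
       (intro mult_mono assms, auto)
  then have "(\<integral>x. f x * g x \<partial>N)\<^sup>2 \<le> (a * b)\<^sup>2" by (simp add: power_mult_distrib)
  then show ?thesis using assms(5,6) abs_le_square_iff[of "\<integral>x. f x * g x \<partial>N" "a * b"] by simp
qed

lemma integral_square_add_le:
  assumes "sq_int N f" "sq_int N g"
  shows "(\<integral>x. (f x + g x)\<^sup>2 \<partial>N) \<le> 2 * (\<integral>x. (f x)\<^sup>2 \<partial>N) + 2 * (\<integral>x. (g x)\<^sup>2 \<partial>N)"
proof -
  have "(\<integral>x. (f x + g x)\<^sup>2 \<partial>N) \<le> (\<integral>x. 2 * (f x)\<^sup>2 + 2 * (g x)\<^sup>2 \<partial>N)"
    using sq_int_add[OF assms] assms
    by (intro integral_mono) (auto simp: sq_int_def square_add_le)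
  then show ?thesis using assms by (simp add: sq_int_def)
qed

lemma integral_mult_tendsto_zero:
  assumes "\<And>n. sq_int N (d n)" "sq_int N g" "(\<lambda>n. \<integral>x. (d n x)\<^sup>2 \<partial>N) \<longlonglongrightarrow> 0"
  shows "(\<lambda>n. \<integral>x. d n x * g x \<partial>N) \<longlonglongrightarrow> (0::real)"
proof -
  have "(\<lambda>n. (\<integral>x. (d n x)\<^sup>2 \<partial>N) * (\<integral>x. (g x)\<^sup>2 \<partial>N)) \<longlonglongrightarrow> 0 * (\<integral>x. (g x)\<^sup>2 \<partial>N)"
    by (intro tendsto_intros assms)
  then have "(\<lambda>n. (\<integral>x. (d n x)\<^sup>2 \<partial>N) * (\<integral>x. (g x)\<^sup>2 \<partial>N)) \<longlonglongrightarrow> 0" by simp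
  then have "(\<lambda>n. (\<integral>x. d n x * g x \<partial>N)\<^sup>2) \<longlonglongrightarrow> 0"
    by (rule tendsto_sandwich[OF _ _ tendsto_const, rotated -1])
       (auto intro!: always_eventually integral_mult_square_le assms)
  then show ?thesis by (simp add: power_tendsto_0_iff)
qed

text \<open>With \<open>a = f - f'\<close> and \<open>b = g - g'\<close> one has
  \<open>f' g' = a b - a g - b f + f g\<close>, and Cauchy-Schwarz sends the first three integrals
  to 0. This is how the isometry passes to limits.\<close>

lemma integral_mult_tendsto:
  assumes f: "\<And>n. sq_int N (f' n)" "sq_int N f" "(\<lambda>n. \<integral>x. (f x - f' n x)\<^sup>2 \<partial>N) \<longlonglongrightarrow> 0"
    and g: "\<And>n. sq_int N (g' n)" "sq_int N g" "(\<lambda>n. \<integral>x. (g x - g' n x)\<^sup>2 \<partial>N) \<longlonglongrightarrow> 0"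
  shows "(\<lambda>n. \<integral>x. f' n x * g' n x \<partial>N) \<longlonglongrightarrow> (\<integral>x. f x * g x \<partial>N)"
proof -
  let ?a = "\<lambda>n x. f x - f' n x" and ?b = "\<lambda>n x. g x - g' n x"
  have a: "sq_int N (?a n)" and b: "sq_int N (?b n)" for n using f g by (auto intro: sq_int_diff)
  have "(\<lambda>n. (\<integral>x. (?a n x)\<^sup>2 \<partial>N) * (\<integral>x. (?b n x)\<^sup>2 \<partial>N)) \<longlonglongrightarrow> 0 * 0"
    by (intro tendsto_intros f g)
  then have "(\<lambda>n. (\<integral>x. (?a n x)\<^sup>2 \<partial>N) * (\<integral>x. (?b n x)\<^sup>2 \<partial>N)) \<longlonglongrightarrow> 0" by simp
  then have "(\<lambda>n. (\<integral>x. ?a n x * ?b n x \<partial>N)\<^sup>2) \<longlonglongrightarrow> 0"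
    by (rule tendsto_sandwich[OF _ _ tendsto_const, rotated -1])
       (auto intro!: always_eventually integral_mult_square_le a b)
  then have 1: "(\<lambda>n. \<integral>x. ?a n x * ?b n x \<partial>N) \<longlonglongrightarrow> 0" by (simp add: power_tendsto_0_iff)
  have 2: "(\<lambda>n. \<integral>x. ?a n x * g x \<partial>N) \<longlonglongrightarrow> 0" by (rule integral_mult_tendsto_zero[OF a g(2) f(3)])
  have 3: "(\<lambda>n. \<integral>x. ?b n x * f x \<partial>N) \<longlonglongrightarrow> 0" by (rule integral_mult_tendsto_zero[OF b f(2) g(3)])
  have "(\<lambda>n. (\<integral>x. ?a n x * ?b n x \<partial>N) - (\<integral>x. ?a n x * g x \<partial>N) - (\<integral>x. ?b n x * f x \<partial>N)
      + (\<integral>x. f x * g x \<partial>N)) \<longlonglongrightarrow> 0 - 0 - 0 + (\<integral>x. f x * g x \<partial>N)"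
    by (intro tendsto_intros 1 2 3)
  moreover have "(\<integral>x. f' n x * g' n x \<partial>N) = (\<integral>x. ?a n x * ?b n x \<partial>N) - (\<integral>x. ?a n x * g x \<partial>N)
      - (\<integral>x. ?b n x * f x \<partial>N) + (\<integral>x. f x * g x \<partial>N)" for n
  proof -
    have i: "integrable N (\<lambda>x. ?a n x * ?b n x)" "integrable N (\<lambda>x. ?a n x * g x)"
      "integrable N (\<lambda>x. ?b n x * f x)" "integrable N (\<lambda>x. f x * g x)"
      using a[of n] b[of n] f(2) g(2) by (auto intro: integrable_mult_sq_int)
    have "(\<integral>x. f' n x * g' n x \<partial>N) =
        (\<integral>x. ?a n x * ?b n x - ?a n x * g x - ?b n x * f x + f x * g x \<partial>N)"
      by (intro Bochner_Integration.integral_cong) (auto simp: algebra_simps)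
    also have "\<dots> = (\<integral>x. ?a n x * ?b n x - ?a n x * g x - ?b n x * f x \<partial>N) + (\<integral>x. f x * g x \<partial>N)"
      by (rule Bochner_Integration.integral_add[OF Bochner_Integration.integrable_diff[OF
            Bochner_Integration.integrable_diff[OF i(1,2)] i(3)] i(4)])
    also have "(\<integral>x. ?a n x * ?b n x - ?a n x * g x - ?b n x * f x \<partial>N) =
       (\<integral>x. ?a n x * ?b n x - ?a n x * g x \<partial>N) - (\<integral>x. ?b n x * f x \<partial>N)"
      by (rule Bochner_Integration.integral_diff[OF Bochner_Integration.integrable_diff[OF i(1,2)] i(3)])
    also have "(\<integral>x. ?a n x * ?b n x - ?a n x * g x \<partial>N) = (\<integral>x. ?a n x * ?b n x \<partial>N) - (\<integral>x. ?a n x * g x \<partial>N)"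
      by (rule Bochner_Integration.integral_diff[OF i(1,2)])
    finally show ?thesis .
  qed
  ultimately show ?thesis by simp
qed

lemma sq_int_nn_integral:
  assumes "f \<in> borel_measurable N" "(\<integral>\<^sup>+x. ennreal ((f x)\<^sup>2) \<partial>N) \<le> ennreal c" "c \<ge> 0"
  shows "sq_int N f" "(\<integral>x. (f x)\<^sup>2 \<partial>N) \<le> c"
proof -
  have "(\<integral>\<^sup>+x. ennreal ((f x)\<^sup>2) \<partial>N) < \<infinity>" using assms(2) by (simp add: order_le_less_trans)
  then show 1: "sq_int N f"
    unfolding sq_int_def using assms(1) by (intro conjI integrableI_bounded) auto
  have "(\<integral>\<^sup>+x. ennreal ((f x)\<^sup>2) \<partial>N) = ennreal (\<integral>x. (f x)\<^sup>2 \<partial>N)"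
    using 1 by (intro nn_integral_eq_integral) (auto simp: sq_int_def)
  then show "(\<integral>x. (f x)\<^sup>2 \<partial>N) \<le> c" using assms(2,3) by (simp add: ennreal_le_iff)
qed

text \<open>The convergence is stated with extended nonnegative integrals, which presuppose no
  integrability of \<open>f\<close>. Once the distance to some \<open>g m\<close> is below 1,
  \<open>f\<close> is a sum of two square integrable functions, and Bochner integrals can take
  over.\<close>

lemma sq_int_nn_integral_tendsto:
  assumes f: "f \<in> borel_measurable N" and g: "\<And>m. sq_int N (g m)"
    and lim: "(\<lambda>m. \<integral>\<^sup>+x. ennreal ((f x - g m x)\<^sup>2) \<partial>N) \<longlonglongrightarrow> 0"
  shows "sq_int N f" "(\<lambda>m. \<integral>x. (f x - g m x)\<^sup>2 \<partial>N) \<longlonglongrightarrow> 0"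
proof -
  have gm: "g m \<in> borel_measurable N" for m using g sq_int_measurable by auto
  have "\<forall>\<^sub>F m in sequentially. (\<integral>\<^sup>+x. ennreal ((f x - g m x)\<^sup>2) \<partial>N) < 1"
    using order_tendstoD(2)[OF lim, of 1] by simp
  then obtain m where "(\<integral>\<^sup>+x. ennreal ((f x - g m x)\<^sup>2) \<partial>N) < 1"
    by (auto simp: eventually_sequentially)
  then have "sq_int N (\<lambda>x. f x - g m x)"
    using f gm by (intro sq_int_nn_integral(1)[where c = 1]) auto
  from sq_int_add[OF this g[of m]] show 1: "sq_int N f" by simp
  have "(\<integral>\<^sup>+x. ennreal ((f x - g m x)\<^sup>2) \<partial>N) = ennreal (\<integral>x. (f x - g m x)\<^sup>2 \<partial>N)" for m
    using sq_int_diff[OF 1 g[of m]] by (intro nn_integral_eq_integral) (auto simp: sq_int_def)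
  then have "(\<lambda>m. ennreal (\<integral>x. (f x - g m x)\<^sup>2 \<partial>N)) \<longlonglongrightarrow> ennreal 0" using lim by simp
  then show "(\<lambda>m. \<integral>x. (f x - g m x)\<^sup>2 \<partial>N) \<longlonglongrightarrow> 0"
    by (rule tendsto_ennrealD) (auto intro!: always_eventually integral_nonneg_AE)
qed

lemma sq_int_bounded_mult:
  assumes "f \<in> borel_measurable N" "sq_int N g" "\<And>x. x \<in> space N \<Longrightarrow> \<bar>f x\<bar> \<le> C"
  shows "sq_int N (\<lambda>x. f x * g x)"
proof (rule sq_int_bound)
  show "integrable N (\<lambda>x. C\<^sup>2 * (g x)\<^sup>2)" using assms by (auto simp: sq_int_def)
  have "(f x)\<^sup>2 \<le> C\<^sup>2" if "x \<in> space N" for x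
    using power_mono[OF assms(3)[OF that] abs_ge_zero, of 2] by simp
  then show "AE x in N. (f x * g x)\<^sup>2 \<le> C\<^sup>2 * (g x)\<^sup>2"
    by (auto intro!: AE_I2 mult_right_mono simp: power_mult_distrib)
qed (use assms in \<open>auto simp: sq_int_def\<close>)

subsection \<open>The Ito isometry\<close>

locale brownian_basis = prob_space M for M :: "'a measure" +
  fixes F :: "real \<Rightarrow> 'a measure" and W :: "real \<Rightarrow> 'a \<Rightarrow> real"
  assumes filtration_F: "filtration (space M) F"
    and sets_F: "sets (F u) \<subseteq> sets M"
    and brownian: "brownian_motion M F W"
begin

sublocale prod: pair_sigma_finite M lborel
  by (simp add: pair_sigma_finite.intro sigma_finite_measure_axioms lborel.sigma_finite_measure_axioms)

text \<open>One measure space carries the whole time line. Restriction to an interval is done by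
  indicators, so that integrals over different intervals can be added and compared.\<close>

abbreviation "P \<equiv> M \<Otimes>\<^sub>M lborel"

lemma space_F: "space (F u) = space M"
  using filtration.space_F[OF filtration_F] .

lemma measurable_F_mono:
  assumes "f \<in> measurable (F u) N" "u \<le> v"
  shows "f \<in> measurable (F v) N"
  using filtration.sets_F_mono[OF filtration_F assms(2)] space_F
  by (intro measurable_from_subalg[OF _ assms(1)]) (auto simp: subalgebra_def)

lemma measurable_F_M:
  assumes "f \<in> measurable (F u) N" shows "f \<in> measurable M N"
  using sets_F space_F
  by (intro measurable_from_subalg[OF _ assms(1)]) (auto simp: subalgebra_def)

lemma W_measurable_F: "0 \<le> u \<Longrightarrow> u \<le> v \<Longrightarrow> W u \<in> borel_measurable (F v)"
  using brownian measurable_F_mono[of "W u" u borel v] by (simp add: brownian_motion_def)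

lemma W_measurable: "0 \<le> u \<Longrightarrow> W u \<in> borel_measurable M"
  using W_measurable_F measurable_F_M by blast

lemma W_continuous: "\<omega> \<in> space M \<Longrightarrow> continuous_on {0..} (\<lambda>u. W u \<omega>)"
  using brownian by (auto simp: brownian_motion_def)

section \<open>Moments and independence of Brownian increments\<close>

lemma increment_moments:
  assumes "0 \<le> u" "u \<le> v"
  shows sq_int_increment: "sq_int M (\<lambda>\<omega>. W v \<omega> - W u \<omega>)"
    and expectation_increment: "expectation (\<lambda>\<omega>. W v \<omega> - W u \<omega>) = 0"
    and expectation_increment_square: "expectation (\<lambda>\<omega>. (W v \<omega> - W u \<omega>)\<^sup>2) = v - u"
proof -
  have "sq_int M (\<lambda>\<omega>. W v \<omega> - W u \<omega>) \<and> expectation (\<lambda>\<omega>. W v \<omega> - W u \<omega>) = 0 \<and>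
    expectation (\<lambda>\<omega>. (W v \<omega> - W u \<omega>)\<^sup>2) = v - u"
  proof (cases "u = v")
    case True then show ?thesis by (simp add: sq_int_zero)
  next
    case False
    then have uv: "u < v" using assms by simp
    then have d: "distributed M lborel (\<lambda>\<omega>. W v \<omega> - W u \<omega>) (normal_density 0 (sqrt (v - u)))"
      using brownian assms by (auto simp: brownian_motion_def)
    have s: "0 < sqrt (v - u)" using uv by simp
    have 1: "integrable M (\<lambda>\<omega>. (W v \<omega> - W u \<omega>)\<^sup>2)"
      using distributed_integrable[OF d, of "\<lambda>x. x\<^sup>2"] integrable_normal_moment[OF s, of 0 2] by simp
    have 2: "expectation (\<lambda>\<omega>. (W v \<omega> - W u \<omega>)\<^sup>2) = v - u"
      using distributed_integral[OF d, of "\<lambda>x. x\<^sup>2"] integral_normal_moment_even[OF s, of 0 1] uv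
      by (simp add: fact_numeral)
    have 3: "expectation (\<lambda>\<omega>. W v \<omega> - W u \<omega>) = 0"
      using distributed_integral[OF d, of "\<lambda>x. x"] integral_normal_moment_odd[OF s, of 0 0] by simp
    show ?thesis using 1 2 3 W_measurable assms by (auto simp: sq_int_def)
  qed
  then show "sq_int M (\<lambda>\<omega>. W v \<omega> - W u \<omega>)" "expectation (\<lambda>\<omega>. W v \<omega> - W u \<omega>) = 0"
    "expectation (\<lambda>\<omega>. (W v \<omega> - W u \<omega>)\<^sup>2) = v - u" by auto
qed

text \<open>Independence of \<open>F u\<close> and the increment passes to smaller sigma-algebras,
  such as those generated by \<open>U\<close> and by a function of the increment. Taking
  \<open>g\<close> as the identity gives the martingale property, taking it as the square gives the
  conditional variance.\<close>

lemma indep_increment: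
  assumes "0 \<le> u" "u < v" "U \<in> borel_measurable (F u)" "g \<in> borel_measurable borel"
  shows "indep_var borel U borel (\<lambda>\<omega>. g (W v \<omega> - W u \<omega>) :: real)"
proof -
  let ?D = "\<lambda>\<omega>. W v \<omega> - W u \<omega>"
  have i: "indep_set (sets (F u)) (sets (vimage_algebra (space M) ?D borel))"
    using brownian assms(1,2) by (auto simp: brownian_motion_def)
  have D: "?D \<in> borel_measurable M" using W_measurable assms by auto
  have "indep_set (sigma_sets (space M) {U -` A \<inter> space M |A. A \<in> sets borel})
      (sigma_sets (space M) {(\<lambda>\<omega>. g (?D \<omega>)) -` A \<inter> space M |A. A \<in> sets borel})"
    unfolding indep_sets2_eq
  proof (intro conjI ballI)
    have 1: "sigma_sets (space M) {U -` A \<inter> space M |A. A \<in> sets borel} \<subseteq> sets (F u)"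
      unfolding space_F[of u, symmetric] using measurable_sets[OF assms(3)]
      by (intro sets.sigma_sets_subset) auto
    have "(\<lambda>\<omega>. g (?D \<omega>)) \<in> borel_measurable (vimage_algebra (space M) ?D borel)"
      by (rule measurable_compose[OF measurable_vimage_algebra1 assms(4)]) auto
    from measurable_sets[OF this]
    have 2: "sigma_sets (space M) {(\<lambda>\<omega>. g (?D \<omega>)) -` A \<inter> space M |A. A \<in> sets borel}
        \<subseteq> sets (vimage_algebra (space M) ?D borel)"
      using sets.sigma_sets_subset[of "{(\<lambda>\<omega>. g (?D \<omega>)) -` A \<inter> space M |A. A \<in> sets borel}"
          "vimage_algebra (space M) ?D borel"] by auto
    from 1 show "sigma_sets (space M) {U -` A \<inter> space M |A. A \<in> sets borel} \<subseteq> events"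
      using sets_F by blast
    from 2 show "sigma_sets (space M) {(\<lambda>\<omega>. g (?D \<omega>)) -` A \<inter> space M |A. A \<in> sets borel} \<subseteq> events"
      using indep_setD_ev2[OF i] by blast
    fix a b assume "a \<in> sigma_sets (space M) {U -` A \<inter> space M |A. A \<in> sets borel}"
      "b \<in> sigma_sets (space M) {(\<lambda>\<omega>. g (?D \<omega>)) -` A \<inter> space M |A. A \<in> sets borel}"
    with 1 2 show "prob (a \<inter> b) = prob a * prob b" by (intro indep_setD[OF i]) auto
  qed
  then show ?thesis
    unfolding indep_var_eq using measurable_F_M[OF assms(3)] D assms(4) by auto
qed

lemma integral_mult_increment:
  assumes "0 \<le> u" "u \<le> v" "U \<in> borel_measurable (F u)" "integrable M U"
  shows "integrable M (\<lambda>\<omega>. U \<omega> * (W v \<omega> - W u \<omega>))"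
    and "expectation (\<lambda>\<omega>. U \<omega> * (W v \<omega> - W u \<omega>)) = 0"
proof -
  have "integrable M (\<lambda>\<omega>. U \<omega> * (W v \<omega> - W u \<omega>)) \<and> expectation (\<lambda>\<omega>. U \<omega> * (W v \<omega> - W u \<omega>)) = 0"
  proof (cases "u = v")
    case False
    then have uv: "u < v" using assms by simp
    note i = indep_increment[OF assms(1) uv assms(3), of "\<lambda>x. x"]
    show ?thesis
      using indep_var_integrable[OF i assms(4)] indep_var_lebesgue_integral[OF i assms(4)]
        integrable_sq_int[OF sq_int_increment] expectation_increment assms by simp
  qed simp
  then show "integrable M (\<lambda>\<omega>. U \<omega> * (W v \<omega> - W u \<omega>))"
    "expectation (\<lambda>\<omega>. U \<omega> * (W v \<omega> - W u \<omega>)) = 0" by auto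
qed

lemma integral_mult_increment_square:
  assumes "0 \<le> u" "u \<le> v" "U \<in> borel_measurable (F u)" "integrable M U"
  shows "integrable M (\<lambda>\<omega>. U \<omega> * (W v \<omega> - W u \<omega>)\<^sup>2)"
    and "expectation (\<lambda>\<omega>. U \<omega> * (W v \<omega> - W u \<omega>)\<^sup>2) = expectation U * (v - u)"
proof -
  have "integrable M (\<lambda>\<omega>. U \<omega> * (W v \<omega> - W u \<omega>)\<^sup>2) \<and>
    expectation (\<lambda>\<omega>. U \<omega> * (W v \<omega> - W u \<omega>)\<^sup>2) = expectation U * (v - u)"
  proof (cases "u = v")
    case False
    then have uv: "u < v" using assms by simp
    have i: "indep_var borel U borel (\<lambda>\<omega>. (W v \<omega> - W u \<omega>)\<^sup>2)"
      using indep_increment[OF assms(1) uv assms(3), of "\<lambda>x. x\<^sup>2"] by simp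
    show ?thesis
      using indep_var_integrable[OF i assms(4)] indep_var_lebesgue_integral[OF i assms(4)]
        sq_int_integrable[OF sq_int_increment] expectation_increment_square assms by simp
  qed simp
  then show "integrable M (\<lambda>\<omega>. U \<omega> * (W v \<omega> - W u \<omega>)\<^sup>2)"
    "expectation (\<lambda>\<omega>. U \<omega> * (W v \<omega> - W u \<omega>)\<^sup>2) = expectation U * (v - u)" by auto
qed

section \<open>The isometry for simple integrands\<close>

lemma sq_int_bounded:
  assumes "f \<in> borel_measurable M" "\<And>x. x \<in> space M \<Longrightarrow> \<bar>f x\<bar> \<le> C"
  shows "sq_int M f"
  using sq_int_bounded_mult[OF assms(1) sq_int_const[of 1] assms(2)] by simp

definition overlap :: "real \<Rightarrow> real \<Rightarrow> real \<Rightarrow> real \<Rightarrow> real" where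
  "overlap a b c d = measure lborel ({a<..b} \<inter> {c<..d})"

lemma overlap_commute: "overlap a b c d = overlap c d a b"
  by (simp add: overlap_def Int_commute)

text \<open>The product of the increments is split at \<open>c\<close> and at the smaller of
  \<open>b\<close> and \<open>d\<close>. Disjoint increments contribute nothing, the later one being
  independent of all factors before it; what remains is the squared increment over the common
  interval, whose mean is its length.\<close>

lemma block_inner_aux:
  assumes ab: "0 \<le> a" "a \<le> b" and cd: "c \<le> d" and ac: "a \<le> c"
    and z: "\<zeta> \<in> borel_measurable (F a)" "\<And>\<omega>. \<omega> \<in> space M \<Longrightarrow> \<bar>\<zeta> \<omega>\<bar> \<le> C"
    and e: "\<eta> \<in> borel_measurable (F c)" "\<And>\<omega>. \<omega> \<in> space M \<Longrightarrow> \<bar>\<eta> \<omega>\<bar> \<le> C'"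
  shows "expectation (\<lambda>\<omega>. (\<zeta> \<omega> * (W b \<omega> - W a \<omega>)) * (\<eta> \<omega> * (W d \<omega> - W c \<omega>)))
    = expectation (\<lambda>\<omega>. \<zeta> \<omega> * \<eta> \<omega>) * overlap a b c d"
proof -
  have c0: "0 \<le> c" using ab ac by simp
  have zc: "\<zeta> \<in> borel_measurable (F c)" by (rule measurable_F_mono[OF z(1) ac])
  have Wc: "W u \<in> borel_measurable (F c)" if "0 \<le> u" "u \<le> c" for u using W_measurable_F that by auto
  have zs: "sq_int M \<zeta>" and es: "sq_int M \<eta>"
    using sq_int_bounded[OF measurable_F_M[OF z(1)] z(2)] sq_int_bounded[OF measurable_F_M[OF e(1)] e(2)] by auto
  have zei: "integrable M (\<lambda>\<omega>. \<zeta> \<omega> * \<eta> \<omega>)" by (rule integrable_mult_sq_int[OF zs es])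
  have pre: "integrable M (\<lambda>\<omega>. (\<zeta> \<omega> * \<eta> \<omega> * (W v \<omega> - W u \<omega>)))"
    if "0 \<le> u" "u \<le> v" for u v
    using integrable_mult_sq_int[OF sq_int_bounded_mult[OF measurable_F_M[OF z(1)] es z(2)] sq_int_increment[OF that]]
    by simp
  \<comment> \<open>Everything except the increment over \<open>{c..d}\<close> is known at time
    \<open>c\<close>.\<close>
  have past: "integrable M (\<lambda>\<omega>. (\<zeta> \<omega> * \<eta> \<omega> * (W v \<omega> - W u \<omega>)) * (W d \<omega> - W c \<omega>)) \<and>
    expectation (\<lambda>\<omega>. (\<zeta> \<omega> * \<eta> \<omega> * (W v \<omega> - W u \<omega>)) * (W d \<omega> - W c \<omega>)) = 0"
    if "0 \<le> u" "u \<le> v" "v \<le> c" for u v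
  proof -
    have m: "(\<lambda>\<omega>. \<zeta> \<omega> * \<eta> \<omega> * (W v \<omega> - W u \<omega>)) \<in> borel_measurable (F c)"
      using zc e(1) Wc that by (auto intro!: borel_measurable_times borel_measurable_diff)
    show ?thesis using integral_mult_increment[OF c0 cd m pre[OF that(1,2)]] by auto
  qed
  \<comment> \<open>Both increments lie after \<open>c\<close>; independence is used at their common
    endpoint \<open>v\<close>.\<close>
  have fut: "integrable M (\<lambda>\<omega>. (\<zeta> \<omega> * \<eta> \<omega> * (W v \<omega> - W c \<omega>)) * (W w \<omega> - W v \<omega>)) \<and>
    expectation (\<lambda>\<omega>. (\<zeta> \<omega> * \<eta> \<omega> * (W v \<omega> - W c \<omega>)) * (W w \<omega> - W v \<omega>)) = 0"
    if "c \<le> v" "v \<le> w" for v w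
  proof -
    have m: "(\<lambda>\<omega>. \<zeta> \<omega> * \<eta> \<omega> * (W v \<omega> - W c \<omega>)) \<in> borel_measurable (F v)"
      using measurable_F_mono[OF zc that(1)] measurable_F_mono[OF e(1) that(1)] W_measurable_F that c0
      by (auto intro!: borel_measurable_times borel_measurable_diff)
    show ?thesis using integral_mult_increment[OF _ that(2) m pre[OF c0 that(1)]] c0 that(1) by auto
  qed
  have zem: "(\<lambda>\<omega>. \<zeta> \<omega> * \<eta> \<omega>) \<in> borel_measurable (F c)" using zc e(1) by auto
  have sq: "integrable M (\<lambda>\<omega>. (\<zeta> \<omega> * \<eta> \<omega>) * (W v \<omega> - W c \<omega>)\<^sup>2) \<and>
    expectation (\<lambda>\<omega>. (\<zeta> \<omega> * \<eta> \<omega>) * (W v \<omega> - W c \<omega>)\<^sup>2) = expectation (\<lambda>\<omega>. \<zeta> \<omega> * \<eta> \<omega>) * (v - c)"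
    if "c \<le> v" for v
    using integral_mult_increment_square[OF c0 that zem zei] by auto
  consider "b \<le> c" | "c < b" "b \<le> d" | "c < b" "d < b" by linarith
  then show ?thesis
  proof cases
    case 1
    then have "overlap a b c d = 0" using ac by (auto simp: overlap_def Int_greaterThanAtMost)
    then show ?thesis using past[OF ab 1] by (simp add: algebra_simps)
  next
    case 2
    have o: "overlap a b c d = b - c" using 2 ac by (auto simp: overlap_def Int_greaterThanAtMost max_def min_def)
    have "expectation (\<lambda>\<omega>. (\<zeta> \<omega> * (W b \<omega> - W a \<omega>)) * (\<eta> \<omega> * (W d \<omega> - W c \<omega>))) =
      expectation (\<lambda>\<omega>. (\<zeta> \<omega> * \<eta> \<omega> * (W c \<omega> - W a \<omega>)) * (W d \<omega> - W c \<omega>)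
       + ((\<zeta> \<omega> * \<eta> \<omega> * (W b \<omega> - W c \<omega>)) * (W d \<omega> - W b \<omega>) + (\<zeta> \<omega> * \<eta> \<omega>) * (W b \<omega> - W c \<omega>)\<^sup>2))"
      by (intro Bochner_Integration.integral_cong) (auto simp: power2_eq_square algebra_simps)
    also have "\<dots> = 0 + (0 + expectation (\<lambda>\<omega>. \<zeta> \<omega> * \<eta> \<omega>) * (b - c))"
      using past[OF ab(1) ac order_refl] fut[of b d] sq[of b] 2 by simp
    finally show ?thesis using o by simp
  next
    case 3
    have o: "overlap a b c d = d - c" using 3 ac cd by (auto simp: overlap_def Int_greaterThanAtMost max_def min_def)
    have "expectation (\<lambda>\<omega>. (\<zeta> \<omega> * (W b \<omega> - W a \<omega>)) * (\<eta> \<omega> * (W d \<omega> - W c \<omega>))) =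
      expectation (\<lambda>\<omega>. (\<zeta> \<omega> * \<eta> \<omega> * (W c \<omega> - W a \<omega>)) * (W d \<omega> - W c \<omega>)
       + ((\<zeta> \<omega> * \<eta> \<omega> * (W d \<omega> - W c \<omega>)) * (W b \<omega> - W d \<omega>) + (\<zeta> \<omega> * \<eta> \<omega>) * (W d \<omega> - W c \<omega>)\<^sup>2))"
      by (intro Bochner_Integration.integral_cong) (auto simp: power2_eq_square algebra_simps)
    also have "\<dots> = 0 + (0 + expectation (\<lambda>\<omega>. \<zeta> \<omega> * \<eta> \<omega>) * (d - c))"
      using past[OF ab(1) ac order_refl] fut[of d b] sq[of d] 3 cd by simp
    finally show ?thesis using o by simp
  qed
qed

lemma block_inner:
  assumes ab: "0 \<le> a" "a \<le> b" and cd: "0 \<le> c" "c \<le> d"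
    and z: "\<zeta> \<in> borel_measurable (F a)" "\<And>\<omega>. \<omega> \<in> space M \<Longrightarrow> \<bar>\<zeta> \<omega>\<bar> \<le> C"
    and e: "\<eta> \<in> borel_measurable (F c)" "\<And>\<omega>. \<omega> \<in> space M \<Longrightarrow> \<bar>\<eta> \<omega>\<bar> \<le> C'"
  shows "expectation (\<lambda>\<omega>. (\<zeta> \<omega> * (W b \<omega> - W a \<omega>)) * (\<eta> \<omega> * (W d \<omega> - W c \<omega>)))
    = expectation (\<lambda>\<omega>. \<zeta> \<omega> * \<eta> \<omega>) * overlap a b c d"
proof (cases "a \<le> c")
  case True then show ?thesis using block_inner_aux[OF ab cd(2) True z e] by simp
next
  case False
  then have "c \<le> a" by simp
  from block_inner_aux[OF cd ab(2) this e z] show ?thesis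
    by (simp add: mult.commute overlap_commute)
qed

lemma integrable_P_block:
  assumes "\<zeta> \<in> borel_measurable M" "\<And>\<omega>. \<omega> \<in> space M \<Longrightarrow> \<bar>\<zeta> \<omega>\<bar> \<le> C" "A \<in> sets borel" "emeasure lborel A < \<infinity>"
  shows "integrable P (\<lambda>z. \<zeta> (fst z) * indicator A (snd z))"
    and "(\<integral>z. \<zeta> (fst z) * indicator A (snd z) \<partial>P) = expectation \<zeta> * measure lborel A"
proof -
  show i: "integrable P (\<lambda>z. \<zeta> (fst z) * indicator A (snd z))"
  proof (rule Bochner_Integration.integrable_bound)
    have "emeasure P (space M \<times> A) < \<infinity>"
      using assms(3,4) by (simp add: lborel.emeasure_pair_measure_Times emeasure_space_1)
    then have "integrable P (indicat_real (space M \<times> A))"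
      using assms(3) by (intro integrable_real_indicator) auto
    then show "integrable P (\<lambda>z. C * indicat_real (space M \<times> A) z)" by (rule integrable_mult_right)
    show "AE z in P. norm (\<zeta> (fst z) * indicat_real A (snd z)) \<le> norm (C * indicat_real (space M \<times> A) z)"
      using assms(2) by (intro AE_I2) (force simp: space_pair_measure indicator_def)
    show "(\<lambda>z. \<zeta> (fst z) * indicat_real A (snd z)) \<in> borel_measurable P"
      using assms(1,3) by measurable
  qed
  have "(\<integral>z. \<zeta> (fst z) * indicator A (snd z) \<partial>P) = (\<integral>\<omega>. (\<integral>u. \<zeta> \<omega> * indicator A u \<partial>lborel) \<partial>M)"
    using prod.integral_fst'[OF i] by simp
  then show "(\<integral>z. \<zeta> (fst z) * indicator A (snd z) \<partial>P) = expectation \<zeta> * measure lborel A"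
    by simp
qed

text \<open>
  The blocks may overlap, so that sums need no refinement of partitions.
\<close>

inductive simple_ito :: "('a \<times> real \<Rightarrow> real) \<Rightarrow> ('a \<Rightarrow> real) \<Rightarrow> bool" where
  zero: "simple_ito (\<lambda>z. 0) (\<lambda>\<omega>. 0)"
| add_block: "simple_ito H I \<Longrightarrow> 0 \<le> a \<Longrightarrow> a \<le> b \<Longrightarrow> \<zeta> \<in> borel_measurable (F a) \<Longrightarrow>
    (\<And>\<omega>. \<omega> \<in> space M \<Longrightarrow> \<bar>\<zeta> \<omega>\<bar> \<le> C) \<Longrightarrow>
    simple_ito (\<lambda>z. H z + \<zeta> (fst z) * indicator {a<..b} (snd z)) (\<lambda>\<omega>. I \<omega> + \<zeta> \<omega> * (W b \<omega> - W a \<omega>))"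

lemma sq_int_block:
  assumes "0 \<le> a" "a \<le> b" "\<zeta> \<in> borel_measurable (F a)" "\<And>\<omega>. \<omega> \<in> space M \<Longrightarrow> \<bar>\<zeta> \<omega>\<bar> \<le> C"
  shows "sq_int P (\<lambda>z. \<zeta> (fst z) * indicator {a<..b} (snd z))"
    and "sq_int M (\<lambda>\<omega>. \<zeta> \<omega> * (W b \<omega> - W a \<omega>))"
proof -
  have m: "\<zeta> \<in> borel_measurable M" by (rule measurable_F_M[OF assms(3)])
  show "sq_int M (\<lambda>\<omega>. \<zeta> \<omega> * (W b \<omega> - W a \<omega>))"
    by (rule sq_int_bounded_mult[OF m sq_int_increment[OF assms(1,2)] assms(4)])
  have "\<bar>(\<zeta> \<omega>)\<^sup>2\<bar> \<le> C\<^sup>2" if "\<omega> \<in> space M" for \<omega>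
    using power_mono[OF assms(4)[OF that] abs_ge_zero, of 2] by simp
  then have "integrable P (\<lambda>z. (\<zeta> (fst z))\<^sup>2 * indicator {a<..b} (snd z))"
    using m assms(2) by (intro integrable_P_block[where C="C\<^sup>2"]) auto
  moreover have "(\<lambda>z. (\<zeta> (fst z) * indicator {a<..b} (snd z))\<^sup>2) =
     (\<lambda>z. (\<zeta> (fst z))\<^sup>2 * indicat_real {a<..b} (snd z))"
    by (auto simp: indicator_def)
  ultimately show "sq_int P (\<lambda>z. \<zeta> (fst z) * indicator {a<..b} (snd z))"
    using m by (simp add: sq_int_def)
qed

text \<open>On the product space the blocks multiply to \<open>\<zeta> * \<eta>\<close> on the
  intersection of the intervals, and Fubini yields the same weighted overlap as
  \<open>block_inner\<close>.\<close>

lemma block_isometry: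
  assumes ab: "0 \<le> a" "a \<le> b" and cd: "0 \<le> c" "c \<le> d"
    and z: "\<zeta> \<in> borel_measurable (F a)" "\<And>\<omega>. \<omega> \<in> space M \<Longrightarrow> \<bar>\<zeta> \<omega>\<bar> \<le> C"
    and e: "\<eta> \<in> borel_measurable (F c)" "\<And>\<omega>. \<omega> \<in> space M \<Longrightarrow> \<bar>\<eta> \<omega>\<bar> \<le> C'"
  shows "expectation (\<lambda>\<omega>. (\<zeta> \<omega> * (W b \<omega> - W a \<omega>)) * (\<eta> \<omega> * (W d \<omega> - W c \<omega>)))
    = (\<integral>z. (\<zeta> (fst z) * indicator {a<..b} (snd z)) * (\<eta> (fst z) * indicator {c<..d} (snd z)) \<partial>P)"
proof -
  have m: "(\<lambda>\<omega>. \<zeta> \<omega> * \<eta> \<omega>) \<in> borel_measurable M"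
    using measurable_F_M[OF z(1)] measurable_F_M[OF e(1)] by simp
  have b: "\<bar>\<zeta> \<omega> * \<eta> \<omega>\<bar> \<le> \<bar>C\<bar> * \<bar>C'\<bar>" if "\<omega> \<in> space M" for \<omega>
    unfolding abs_mult using z(2)[OF that] e(2)[OF that] by (intro mult_mono) auto
  have "(\<integral>z. (\<zeta> (fst z) * \<eta> (fst z)) * indicator ({a<..b} \<inter> {c<..d}) (snd z) \<partial>P) =
      expectation (\<lambda>\<omega>. \<zeta> \<omega> * \<eta> \<omega>) * overlap a b c d"
    unfolding overlap_def
  proof (rule integrable_P_block(2)[OF m b])
    show "emeasure lborel ({a<..b} \<inter> {c<..d}) < \<infinity>"
      unfolding Int_greaterThanAtMost by (cases "max a c \<le> min b d") auto
  qed auto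
  moreover have "(\<lambda>z. (\<zeta> (fst z) * \<eta> (fst z)) * indicator ({a<..b} \<inter> {c<..d}) (snd z)) =
     (\<lambda>z. (\<zeta> (fst z) * indicator {a<..b} (snd z)) * (\<eta> (fst z) * indicat_real {c<..d} (snd z)))"
    by (auto simp: indicator_def fun_eq_iff)
  ultimately show ?thesis using block_inner[OF ab cd z e] by simp
qed

lemma simple_ito_sq_int:
  assumes "simple_ito H I"
  shows "sq_int P H" "sq_int M I" "expectation I = 0"
proof -
  have "sq_int P H \<and> sq_int M I \<and> expectation I = 0"
    using assms
  proof induction
    case zero
    show ?case by (simp add: sq_int_zero)
  next
    case (add_block H I a b \<zeta> C)
    note s = sq_int_block[OF add_block.hyps(2-5)]
    have "sq_int M \<zeta>" using measurable_F_M[OF add_block.hyps(4)] add_block.hyps(5) by (rule sq_int_bounded)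
    then have "expectation (\<lambda>\<omega>. \<zeta> \<omega> * (W b \<omega> - W a \<omega>)) = 0"
      using add_block.hyps by (intro integral_mult_increment(2) integrable_sq_int)
    then show ?case
      using add_block.IH s by (auto intro!: sq_int_add simp: integrable_sq_int)
  qed
  then show "sq_int P H" "sq_int M I" "expectation I = 0" by auto
qed

lemma simple_ito_isometry_block:
  assumes "simple_ito H I"
    and b: "0 \<le> a" "a \<le> b" "\<zeta> \<in> borel_measurable (F a)" "\<And>\<omega>. \<omega> \<in> space M \<Longrightarrow> \<bar>\<zeta> \<omega>\<bar> \<le> C"
  shows "expectation (\<lambda>\<omega>. I \<omega> * (\<zeta> \<omega> * (W b \<omega> - W a \<omega>)))
    = (\<integral>z. H z * (\<zeta> (fst z) * indicator {a<..b} (snd z)) \<partial>P)"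
  using assms(1)
proof induction
  case zero show ?case by simp
next
  case (add_block H I a' b' \<zeta>' C')
  note s = sq_int_block[OF b] and s' = sq_int_block[OF add_block.hyps(2-5)]
  note i = simple_ito_sq_int[OF add_block.hyps(1)]
  have "expectation (\<lambda>\<omega>. (I \<omega> + \<zeta>' \<omega> * (W b' \<omega> - W a' \<omega>)) * (\<zeta> \<omega> * (W b \<omega> - W a \<omega>))) =
    expectation (\<lambda>\<omega>. I \<omega> * (\<zeta> \<omega> * (W b \<omega> - W a \<omega>))) +
    expectation (\<lambda>\<omega>. (\<zeta>' \<omega> * (W b' \<omega> - W a' \<omega>)) * (\<zeta> \<omega> * (W b \<omega> - W a \<omega>)))"
    unfolding distrib_right
    by (intro Bochner_Integration.integral_add integrable_mult_sq_int i s s')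
  also have "\<dots> = (\<integral>z. H z * (\<zeta> (fst z) * indicator {a<..b} (snd z)) \<partial>P) +
     (\<integral>z. (\<zeta>' (fst z) * indicator {a'<..b'} (snd z)) * (\<zeta> (fst z) * indicator {a<..b} (snd z)) \<partial>P)"
    using block_isometry[OF add_block.hyps(2,3) b(1,2) add_block.hyps(4,5) b(3,4)] add_block.IH by simp
  also have "\<dots> = (\<integral>z. (H z + \<zeta>' (fst z) * indicator {a'<..b'} (snd z)) * (\<zeta> (fst z) * indicator {a<..b} (snd z)) \<partial>P)"
    unfolding distrib_right
    by (intro Bochner_Integration.integral_add[symmetric] integrable_mult_sq_int i s s')
  finally show ?case .
qed

text \<open>The polarised form is proved directly, by one induction in each argument. The mixed case
  is what later computes the covariance of a deviation with \<open>W T - W t\<close>.\<close>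

lemma simple_ito_isometry:
  assumes "simple_ito H I" and "simple_ito H' I'"
  shows "expectation (\<lambda>\<omega>. I \<omega> * I' \<omega>) = (\<integral>z. H z * H' z \<partial>P)"
  using assms(2)
proof induction
  case zero show ?case by simp
next
  case (add_block H' I' a b \<zeta> C)
  note s = sq_int_block[OF add_block.hyps(2-5)]
  note i = simple_ito_sq_int[OF add_block.hyps(1)] simple_ito_sq_int[OF assms(1)]
  have "expectation (\<lambda>\<omega>. I \<omega> * (I' \<omega> + \<zeta> \<omega> * (W b \<omega> - W a \<omega>))) =
    expectation (\<lambda>\<omega>. I \<omega> * I' \<omega>) + expectation (\<lambda>\<omega>. I \<omega> * (\<zeta> \<omega> * (W b \<omega> - W a \<omega>)))"
    unfolding distrib_left
    by (intro Bochner_Integration.integral_add integrable_mult_sq_int i s)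
  also have "\<dots> = (\<integral>z. H z * H' z \<partial>P) + (\<integral>z. H z * (\<zeta> (fst z) * indicator {a<..b} (snd z)) \<partial>P)"
    using add_block.IH simple_ito_isometry_block[OF assms(1) add_block.hyps(2-5)] by simp
  also have "\<dots> = (\<integral>z. H z * (H' z + \<zeta> (fst z) * indicator {a<..b} (snd z)) \<partial>P)"
    unfolding distrib_left
    by (intro Bochner_Integration.integral_add[symmetric] integrable_mult_sq_int i s)
  finally show ?case .
qed

lemma simple_ito_cmult:
  assumes "simple_ito H I"
  shows "simple_ito (\<lambda>z. c * H z) (\<lambda>\<omega>. c * I \<omega>)"
  using assms
proof induction
  case zero show ?case using simple_ito.zero by simp
next
  case (add_block H I a b \<zeta> C)
  have "simple_ito (\<lambda>z. c * H z + (c * \<zeta> (fst z)) * indicator {a<..b} (snd z))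
     (\<lambda>\<omega>. c * I \<omega> + (c * \<zeta> \<omega>) * (W b \<omega> - W a \<omega>))"
    using add_block by (intro simple_ito.add_block[where C="\<bar>c\<bar> * C"]) (auto simp: abs_mult mult_left_mono)
  then show ?case by (simp add: algebra_simps)
qed

lemma simple_ito_add:
  assumes "simple_ito H I" "simple_ito H' I'"
  shows "simple_ito (\<lambda>z. H z + H' z) (\<lambda>\<omega>. I \<omega> + I' \<omega>)"
  using assms(2)
proof induction
  case zero show ?case using assms(1) by simp
next
  case (add_block H' I' a b \<zeta> C)
  then show ?case
    using simple_ito.add_block[OF add_block.IH add_block.hyps(2-5)] by (simp add: algebra_simps)
qed

text \<open>The mean-square closure of the graph of the simple integral. As a relation it inherits
  linearity and the isometry, without density of the simple integrands and without a choice of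
  versions.\<close>

definition ito_pair :: "('a \<times> real \<Rightarrow> real) \<Rightarrow> ('a \<Rightarrow> real) \<Rightarrow> bool" where
  "ito_pair H Z \<longleftrightarrow> sq_int P H \<and> sq_int M Z \<and>
    (\<exists>h z. (\<forall>n. simple_ito (h n) (z n)) \<and>
      (\<lambda>n. \<integral>x. (H x - h n x)\<^sup>2 \<partial>P) \<longlonglongrightarrow> 0 \<and> (\<lambda>n. \<integral>\<omega>. (Z \<omega> - z n \<omega>)\<^sup>2 \<partial>M) \<longlonglongrightarrow> 0)"

lemma ito_pair_sq_int: "ito_pair H Z \<Longrightarrow> sq_int P H" "ito_pair H Z \<Longrightarrow> sq_int M Z"
  by (auto simp: ito_pair_def)

lemma ito_pair_simple: "simple_ito H Z \<Longrightarrow> ito_pair H Z"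
  unfolding ito_pair_def using simple_ito_sq_int by (auto intro!: exI[of _ "\<lambda>_. H"] exI[of _ "\<lambda>_. Z"])

lemma ito_pair_isometry:
  assumes "ito_pair H Z" "ito_pair H' Z'"
  shows "expectation (\<lambda>\<omega>. Z \<omega> * Z' \<omega>) = (\<integral>x. H x * H' x \<partial>P)"
proof -
  obtain h z where h: "\<And>n. simple_ito (h n) (z n)" "(\<lambda>n. \<integral>x. (H x - h n x)\<^sup>2 \<partial>P) \<longlonglongrightarrow> 0"
      "(\<lambda>n. \<integral>\<omega>. (Z \<omega> - z n \<omega>)\<^sup>2 \<partial>M) \<longlonglongrightarrow> 0"
    using assms(1) by (auto simp: ito_pair_def)
  obtain h' z' where h': "\<And>n. simple_ito (h' n) (z' n)" "(\<lambda>n. \<integral>x. (H' x - h' n x)\<^sup>2 \<partial>P) \<longlonglongrightarrow> 0"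
      "(\<lambda>n. \<integral>\<omega>. (Z' \<omega> - z' n \<omega>)\<^sup>2 \<partial>M) \<longlonglongrightarrow> 0"
    using assms(2) by (auto simp: ito_pair_def)
  note s = simple_ito_sq_int[OF h(1)] simple_ito_sq_int[OF h'(1)] ito_pair_sq_int[OF assms(1)] ito_pair_sq_int[OF assms(2)]
  have 1: "(\<lambda>n. expectation (\<lambda>\<omega>. z n \<omega> * z' n \<omega>)) \<longlonglongrightarrow> expectation (\<lambda>\<omega>. Z \<omega> * Z' \<omega>)"
    by (rule integral_mult_tendsto) (fact s h(3) h'(3))+
  have 2: "(\<lambda>n. \<integral>x. h n x * h' n x \<partial>P) \<longlonglongrightarrow> (\<integral>x. H x * H' x \<partial>P)"
    by (rule integral_mult_tendsto) (fact s h(2) h'(2))+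
  from 2 have "(\<lambda>n. expectation (\<lambda>\<omega>. z n \<omega> * z' n \<omega>)) \<longlonglongrightarrow> (\<integral>x. H x * H' x \<partial>P)"
    using simple_ito_isometry[OF h(1) h'(1)] by simp
  with 1 show ?thesis by (rule LIMSEQ_unique)
qed

lemma ito_pair_expectation:
  assumes "ito_pair H Z"
  shows "expectation Z = 0"
proof -
  obtain h z where h: "\<And>n. simple_ito (h n) (z n)" 
      "(\<lambda>n. \<integral>\<omega>. (Z \<omega> - z n \<omega>)\<^sup>2 \<partial>M) \<longlonglongrightarrow> 0"
    using assms(1) by (auto simp: ito_pair_def)
  have "(\<lambda>n. expectation (\<lambda>\<omega>. z n \<omega> * 1)) \<longlonglongrightarrow> expectation (\<lambda>\<omega>. Z \<omega> * 1)"
    by (rule integral_mult_tendsto)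
       (auto intro: sq_int_const simple_ito_sq_int[OF h(1)] ito_pair_sq_int[OF assms] h(2))
  then have "(\<lambda>n. 0) \<longlonglongrightarrow> expectation Z" using simple_ito_sq_int(3)[OF h(1)] by simp
  then show ?thesis by (simp add: LIMSEQ_const_iff)
qed

lemma ito_pair_add:
  assumes "ito_pair H Z" "ito_pair H' Z'"
  shows "ito_pair (\<lambda>x. H x + H' x) (\<lambda>\<omega>. Z \<omega> + Z' \<omega>)"
proof -
  obtain h z where h: "\<And>n. simple_ito (h n) (z n)" "(\<lambda>n. \<integral>x. (H x - h n x)\<^sup>2 \<partial>P) \<longlonglongrightarrow> 0"
      "(\<lambda>n. \<integral>\<omega>. (Z \<omega> - z n \<omega>)\<^sup>2 \<partial>M) \<longlonglongrightarrow> 0"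
    using assms(1) by (auto simp: ito_pair_def)
  obtain h' z' where h': "\<And>n. simple_ito (h' n) (z' n)" "(\<lambda>n. \<integral>x. (H' x - h' n x)\<^sup>2 \<partial>P) \<longlonglongrightarrow> 0"
      "(\<lambda>n. \<integral>\<omega>. (Z' \<omega> - z' n \<omega>)\<^sup>2 \<partial>M) \<longlonglongrightarrow> 0"
    using assms(2) by (auto simp: ito_pair_def)
  note s = simple_ito_sq_int[OF h(1)] simple_ito_sq_int[OF h'(1)] ito_pair_sq_int[OF assms(1)] ito_pair_sq_int[OF assms(2)]
  have lim: "(\<lambda>n. \<integral>x. (f x + f' x - (g n x + g' n x))\<^sup>2 \<partial>N) \<longlonglongrightarrow> 0"
    if "sq_int N f" "sq_int N f'" "\<And>n. sq_int N (g n)" "\<And>n. sq_int N (g' n)"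
      "(\<lambda>n. \<integral>x. (f x - g n x)\<^sup>2 \<partial>N) \<longlonglongrightarrow> 0" "(\<lambda>n. \<integral>x. (f' x - g' n x)\<^sup>2 \<partial>N) \<longlonglongrightarrow> 0"
    for N :: "'z measure" and f f' g g'
  proof (rule tendsto_sandwich[OF _ _ tendsto_const])
    have "(\<lambda>n. 2 * (\<integral>x. (f x - g n x)\<^sup>2 \<partial>N) + 2 * (\<integral>x. (f' x - g' n x)\<^sup>2 \<partial>N)) \<longlonglongrightarrow> 2 * 0 + 2 * 0"
      by (intro tendsto_intros that)
    then show "(\<lambda>n. 2 * (\<integral>x. (f x - g n x)\<^sup>2 \<partial>N) + 2 * (\<integral>x. (f' x - g' n x)\<^sup>2 \<partial>N)) \<longlonglongrightarrow> 0" by simp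
    show "\<forall>\<^sub>F n in sequentially. (\<integral>x. (f x + f' x - (g n x + g' n x))\<^sup>2 \<partial>N)
        \<le> 2 * (\<integral>x. (f x - g n x)\<^sup>2 \<partial>N) + 2 * (\<integral>x. (f' x - g' n x)\<^sup>2 \<partial>N)"
    proof (intro always_eventually allI)
      fix n
      show "(\<integral>x. (f x + f' x - (g n x + g' n x))\<^sup>2 \<partial>N)
        \<le> 2 * (\<integral>x. (f x - g n x)\<^sup>2 \<partial>N) + 2 * (\<integral>x. (f' x - g' n x)\<^sup>2 \<partial>N)"
        using integral_square_add_le[OF sq_int_diff[OF that(1,3)] sq_int_diff[OF that(2,4)], of n n]
        by (simp add: algebra_simps)
    qed
  qed (auto intro!: always_eventually integral_nonneg_AE)
  show ?thesis
    unfolding ito_pair_def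
    by (intro conjI exI[of _ "\<lambda>n x. h n x + h' n x"] exI[of _ "\<lambda>n x. z n x + z' n x"] sq_int_add allI
        simple_ito_add lim s h h')
qed

lemma ito_pair_cmult:
  assumes "ito_pair H Z"
  shows "ito_pair (\<lambda>x. c * H x) (\<lambda>\<omega>. c * Z \<omega>)"
proof -
  obtain h z where h: "\<And>n. simple_ito (h n) (z n)" "(\<lambda>n. \<integral>x. (H x - h n x)\<^sup>2 \<partial>P) \<longlonglongrightarrow> 0"
      "(\<lambda>n. \<integral>\<omega>. (Z \<omega> - z n \<omega>)\<^sup>2 \<partial>M) \<longlonglongrightarrow> 0"
    using assms(1) by (auto simp: ito_pair_def)
  have lim: "(\<lambda>n. \<integral>x. (c * f x - c * g n x)\<^sup>2 \<partial>N) \<longlonglongrightarrow> 0"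
    if "(\<lambda>n. \<integral>x. (f x - g n x)\<^sup>2 \<partial>N) \<longlonglongrightarrow> 0" for N :: "'z measure" and f g
    using tendsto_mult_left[OF that, of "c\<^sup>2"]
    by (simp add: right_diff_distrib[symmetric] power_mult_distrib)
  show ?thesis
    unfolding ito_pair_def
    by (intro conjI exI[of _ "\<lambda>n x. c * h n x"] exI[of _ "\<lambda>n x. c * z n x"] sq_int_cmult allI
        simple_ito_cmult lim ito_pair_sq_int[OF assms] h)
qed

lemma ito_pair_diff:
  assumes "ito_pair H Z" "ito_pair H' Z'"
  shows "ito_pair (\<lambda>x. H x - H' x) (\<lambda>\<omega>. Z \<omega> - Z' \<omega>)"
  using ito_pair_add[OF assms(1) ito_pair_cmult[OF assms(2), of "-1"]] by simp

lemma ito_pair_increment: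
  assumes "0 \<le> a" "a \<le> b"
  shows "ito_pair (\<lambda>z. indicator {a<..b} (snd z)) (\<lambda>\<omega>. W b \<omega> - W a \<omega>)"
proof -
  have "simple_ito (\<lambda>z. 0 + 1 * indicator {a<..b} (snd z)) (\<lambda>\<omega>. 0 + 1 * (W b \<omega> - W a \<omega>))"
    by (intro simple_ito.intros(2)[where \<zeta> = "\<lambda>_. 1" and C=1] simple_ito.zero assms) auto
  then show ?thesis using ito_pair_simple by simp
qed

end

text \<open>Clamping the time to \<open>{a..b}\<close> moves every point into the space of which
  progressive measurability speaks. The measure space \<open>N\<close> is left open since the result
  is applied to \<open>M\<close> and, where adaptedness matters, to \<open>F c\<close>.\<close>

lemma progressively_measurable_joint:
  assumes "progressively_measurable F a b H" "a \<le> b"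
    and id: "(\<lambda>x. x) \<in> measurable N (F b)"
  shows "(\<lambda>z. indicator {a..b} (snd z) * H (snd z) (fst z)) \<in> borel_measurable (N \<Otimes>\<^sub>M lborel)"
proof -
  have H: "(\<lambda>(v, \<omega>). H v \<omega>) \<in> borel_measurable (restrict_space borel {a..b} \<Otimes>\<^sub>M F b)"
    using assms(1,2) by (auto simp: progressively_measurable_def)
  have "(\<lambda>z. max a (min b (snd z))) \<in> measurable (N \<Otimes>\<^sub>M lborel) (restrict_space borel {a..b})"
    using assms(2) by (intro measurable_restrict_space2) auto
  moreover have "fst \<in> measurable (N \<Otimes>\<^sub>M lborel) (F b)"
    by (rule measurable_compose[OF measurable_fst id])
  ultimately have "(\<lambda>z. (max a (min b (snd z)), fst z)) \<in> measurable (N \<Otimes>\<^sub>M lborel) (restrict_space borel {a..b} \<Otimes>\<^sub>M F b)"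
    by (rule measurable_Pair)
  from measurable_compose[OF this H]
  have "(\<lambda>z. H (max a (min b (snd z))) (fst z)) \<in> borel_measurable (N \<Otimes>\<^sub>M lborel)" by simp
  moreover have "(\<lambda>z. indicat_real {a..b} (snd z)) \<in> borel_measurable (N \<Otimes>\<^sub>M lborel)"
    by measurable
  ultimately have "(\<lambda>z. indicator {a..b} (snd z) * H (max a (min b (snd z))) (fst z)) \<in> borel_measurable (N \<Otimes>\<^sub>M lborel)"
    by (intro borel_measurable_times)
  moreover have "(\<lambda>z. indicator {a..b} (snd z) * H (max a (min b (snd z))) (fst z)) =
     (\<lambda>z. indicator {a..b} (snd z) * H (snd z) (fst z))"
    by (auto simp: indicator_def max_def min_def fun_eq_iff)
  ultimately show ?thesis by simp
qed

text \<open>Time is rounded down to a multiple of \<open>1 / n\<close> and clamped to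
  \<open>{a..b}\<close>. For each of the countably many rounded values the map is measurable in the
  sample point, and continuity of the paths gives the limit.\<close>

lemma continuous_process_joint_measurable:
  fixes Y :: "real \<Rightarrow> 'a \<Rightarrow> real"
  assumes Y: "\<And>u. u \<in> {a..b} \<Longrightarrow> Y u \<in> borel_measurable N"
    and cont: "\<And>\<omega>. \<omega> \<in> space N \<Longrightarrow> continuous_on {a..b} (\<lambda>u. Y u \<omega>)" and ab: "a \<le> b"
  shows "(\<lambda>z. indicator {a..b} (snd z) * Y (snd z) (fst z)) \<in> borel_measurable (N \<Otimes>\<^sub>M lborel)"
proof -
  let ?c = "\<lambda>u. max a (min b u)"
  have c: "?c u \<in> {a..b}" for u using ab by auto
  have "(\<lambda>z. Y (?c (snd z)) (fst z)) \<in> borel_measurable (N \<Otimes>\<^sub>M lborel)"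
  proof (rule borel_measurable_LIMSEQ_real)
    \<comment> \<open>For \<open>n = 0\<close> the quotient is 0 by convention, which does not
      affect the limit.\<close>
    fix n
    show "(\<lambda>z. Y (?c (real_of_int \<lfloor>real n * snd z\<rfloor> / real n)) (fst z)) \<in> borel_measurable (N \<Otimes>\<^sub>M lborel)"
    proof (rule measurable_compose_countable[where
          f = "\<lambda>i z. Y (?c (real_of_int i / real n)) (fst z)" and g = "\<lambda>z::'a \<times> real. \<lfloor>real n * snd z\<rfloor>"])
      show "(\<lambda>z. Y (?c (real_of_int i / real n)) (fst z)) \<in> borel_measurable (N \<Otimes>\<^sub>M lborel)" for i
        using Y[OF c] by measurable
      show "(\<lambda>z. \<lfloor>real n * snd z\<rfloor>) \<in> measurable (N \<Otimes>\<^sub>M lborel) (count_space UNIV)"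
        by measurable
    qed
  next
    fix z :: "'a \<times> real" assume z: "z \<in> space (N \<Otimes>\<^sub>M lborel)"
    have "(\<lambda>n. real_of_int \<lfloor>real n * snd z\<rfloor> / real n) \<longlonglongrightarrow> snd z"
    proof (rule tendsto_sandwich)
      show "\<forall>\<^sub>F n in sequentially. snd z - 1 / real n \<le> real_of_int \<lfloor>real n * snd z\<rfloor> / real n"
        using eventually_gt_at_top[of 0]
      proof eventually_elim
        case (elim n)
        then have "snd z - 1 / real n = (real n * snd z - 1) / real n" by (simp add: field_simps)
        also have "\<dots> \<le> real_of_int \<lfloor>real n * snd z\<rfloor> / real n" by (intro divide_right_mono) linarith+
        finally show ?case .
      qed
      show "\<forall>\<^sub>F n in sequentially. real_of_int \<lfloor>real n * snd z\<rfloor> / real n \<le> snd z"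
        using eventually_gt_at_top[of 0]
      proof eventually_elim
        case (elim n)
        have "real_of_int \<lfloor>real n * snd z\<rfloor> / real n \<le> real n * snd z / real n"
          by (intro divide_right_mono) linarith+
        then show ?case using elim by simp
      qed
      have "(\<lambda>n. snd z - 1 / real n) \<longlonglongrightarrow> snd z - 0" by (intro tendsto_intros lim_1_over_n)
      then show "(\<lambda>n. snd z - 1 / real n) \<longlonglongrightarrow> snd z" by simp
    qed simp
    then have "(\<lambda>n. ?c (real_of_int \<lfloor>real n * snd z\<rfloor> / real n)) \<longlonglongrightarrow> ?c (snd z)"
      by (intro tendsto_max tendsto_min tendsto_const)
    moreover have "fst z \<in> space N" using z by (auto simp: space_pair_measure)
    ultimately show "(\<lambda>n. Y (?c (real_of_int \<lfloor>real n * snd z\<rfloor> / real n)) (fst z)) \<longlonglongrightarrow> Y (?c (snd z)) (fst z)"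
      using c by (intro continuous_on_tendsto_compose[OF cont]) (auto intro!: always_eventually)
  qed
  moreover have "(\<lambda>z. indicat_real {a..b} (snd z)) \<in> borel_measurable (N \<Otimes>\<^sub>M lborel)"
    by measurable
  ultimately have "(\<lambda>z. indicator {a..b} (snd z) * Y (?c (snd z)) (fst z)) \<in> borel_measurable (N \<Otimes>\<^sub>M lborel)"
    by (intro borel_measurable_times)
  moreover have "(\<lambda>z. indicator {a..b} (snd z) * Y (?c (snd z)) (fst z)) =
     (\<lambda>z. indicator {a..b} (snd z) * Y (snd z) (fst z))"
    by (auto simp: indicator_def max_def min_def fun_eq_iff)
  ultimately show ?thesis by simp
qed

section \<open>Ito integrals as mean-square limits, and time integrals\<close>

context brownian_basis
begin

lemma elementary_simple_ito:
  assumes "elementary_integrand M F a b n \<tau> \<zeta>" "0 \<le> a"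
  shows "simple_ito (\<lambda>z. elementary_process n \<tau> \<zeta> (snd z) (fst z)) (elementary_integral W n \<tau> \<zeta>)"
  using assms(1)
proof (induction n)
  case 0
  then show ?case using simple_ito.zero by (simp add: elementary_process_def elementary_integral_def[abs_def])
next
  case (Suc n)
  then have "elementary_integrand M F a b n \<tau> \<zeta>" by (auto simp: elementary_integrand_def)
  note IH = Suc.IH[OF this]
  obtain C where C: "\<And>\<omega>. \<omega> \<in> space M \<Longrightarrow> \<bar>\<zeta> n \<omega>\<bar> \<le> C"
    using Suc.prems unfolding elementary_integrand_def by blast
  have "0 \<le> \<tau> n" "\<tau> n \<le> \<tau> (Suc n)" "\<zeta> n \<in> borel_measurable (F (\<tau> n))"
    using Suc.prems assms(2) by (auto simp: elementary_integrand_def intro: order_trans)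
  from simple_ito.add_block[OF IH this C] show ?case
    by (simp add: elementary_process_def elementary_integral_def[abs_def])
qed

text \<open>The elementary processes vanish outside \<open>{a..b}\<close> because their nodes lie in
  it, so the iterated integral over \<open>{a..b}\<close> is a squared distance in the product
  space. Square integrability of the integrand is a consequence of the convergence.\<close>

lemma has_ito_integral_imp_ito_pair:
  assumes "has_ito_integral M F W a b H Z" "0 \<le> a" "a \<le> b"
  shows "ito_pair (\<lambda>z. indicator {a..b} (snd z) * H (snd z) (fst z)) Z"
proof -
  let ?H = "\<lambda>z. indicator {a..b} (snd z) * H (snd z) (fst z)"
  from assms(1) obtain n \<tau> \<zeta> where H: "progressively_measurable F a b H" and Z: "Z \<in> borel_measurable M"
    and el: "\<And>m. elementary_integrand M F a b (n m) (\<tau> m) (\<zeta> m)"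
    and l1: "(\<lambda>m. \<integral>\<^sup>+\<omega>. (\<integral>\<^sup>+u\<in>{a..b}. ennreal ((H u \<omega> - elementary_process (n m) (\<tau> m) (\<zeta> m) u \<omega>)\<^sup>2)
           \<partial>lborel) \<partial>M) \<longlonglongrightarrow> 0"
    and l2: "(\<lambda>m. \<integral>\<^sup>+\<omega>. ennreal ((Z \<omega> - elementary_integral W (n m) (\<tau> m) (\<zeta> m) \<omega>)\<^sup>2) \<partial>M) \<longlonglongrightarrow> 0"
    unfolding has_ito_integral_def by blast
  let ?e = "\<lambda>m z. elementary_process (n m) (\<tau> m) (\<zeta> m) (snd z) (fst z)"
  note s = elementary_simple_ito[OF el assms(2)]
  note q = simple_ito_sq_int[OF s]
  have "(\<lambda>x. x) \<in> measurable M (F b)" using measurable_F_M[OF measurable_ident] by (simp add: id_def)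
  note m = progressively_measurable_joint[OF H assms(3) this]
  have em: "?e m \<in> borel_measurable P" for m using sq_int_measurable[OF q(1)] .
  have e0: "elementary_process (n m) (\<tau> m) (\<zeta> m) u \<omega> = 0" if "u \<notin> {a..b}" for m u \<omega>
    unfolding elementary_process_def
  proof (rule sum.neutral, intro ballI)
    fix k assume "k \<in> {..<n m}"
    then have "\<tau> m k \<in> {a..b}" "\<tau> m (Suc k) \<in> {a..b}"
      using el[of m] by (auto simp: elementary_integrand_def)
    then show "\<zeta> m k \<omega> * indicator {\<tau> m k<..\<tau> m (Suc k)} u = 0" using that by (auto simp: indicator_def)
  qed
  have "(\<integral>\<^sup>+\<omega>. (\<integral>\<^sup>+u\<in>{a..b}. ennreal ((H u \<omega> - elementary_process (n m) (\<tau> m) (\<zeta> m) u \<omega>)\<^sup>2)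
           \<partial>lborel) \<partial>M) = (\<integral>\<^sup>+z. ennreal ((?H z - ?e m z)\<^sup>2) \<partial>P)" for m
  proof -
    have "(\<integral>\<^sup>+z. ennreal ((?H z - ?e m z)\<^sup>2) \<partial>P) = (\<integral>\<^sup>+\<omega>. (\<integral>\<^sup>+u. ennreal ((?H (\<omega>, u) - ?e m (\<omega>, u))\<^sup>2) \<partial>lborel) \<partial>M)"
      using m em by (subst lborel.nn_integral_fst[symmetric]) auto
    also have "\<dots> = (\<integral>\<^sup>+\<omega>. (\<integral>\<^sup>+u\<in>{a..b}. ennreal ((H u \<omega> - elementary_process (n m) (\<tau> m) (\<zeta> m) u \<omega>)\<^sup>2)
           \<partial>lborel) \<partial>M)"
    proof (intro nn_integral_cong)
      fix u \<omega>
      show "ennreal ((?H (\<omega>, u) - ?e m (\<omega>, u))\<^sup>2) =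
        ennreal ((H u \<omega> - elementary_process (n m) (\<tau> m) (\<zeta> m) u \<omega>)\<^sup>2) * indicator {a..b} u"
        using e0[of u m \<omega>] by (cases "u \<in> {a..b}") (simp_all add: indicator_def)
    qed
    finally show ?thesis by simp
  qed
  with l1 have l1': "(\<lambda>m. \<integral>\<^sup>+z. ennreal ((?H z - ?e m z)\<^sup>2) \<partial>P) \<longlonglongrightarrow> 0" by simp
  note 1 = sq_int_nn_integral_tendsto[OF m q(1) l1'] and 2 = sq_int_nn_integral_tendsto[OF Z q(2) l2]
  show ?thesis
    unfolding ito_pair_def
    using 1 2 s by (intro conjI exI[of _ ?e] exI[of _ "\<lambda>m. elementary_integral W (n m) (\<tau> m) (\<zeta> m)"]) auto
qed

text \<open>The last bound is Cauchy-Schwarz against the indicator of \<open>{a..b}\<close> on each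
  path. Its factor \<open>b - a\<close> makes the drift part of a short deviation small compared
  with the stochastic integral.\<close>

lemma sq_int_time_integral:
  assumes g: "sq_int P g" and supp: "\<And>\<omega> u. u \<notin> {a..b} \<Longrightarrow> g (\<omega>, u) = 0" and ab: "a \<le> b"
  shows "integrable P g"
    and "AE \<omega> in M. integrable lborel (\<lambda>u. g (\<omega>, u))"
    and "sq_int M (\<lambda>\<omega>. \<integral>u. g (\<omega>, u) \<partial>lborel)"
    and "expectation (\<lambda>\<omega>. \<integral>u. g (\<omega>, u) \<partial>lborel) = (\<integral>z. g z \<partial>P)"
    and "expectation (\<lambda>\<omega>. (\<integral>u. g (\<omega>, u) \<partial>lborel)\<^sup>2) \<le> (b - a) * (\<integral>z. (g z)\<^sup>2 \<partial>P)"
proof -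
  have [measurable]: "g \<in> borel_measurable P" by (rule sq_int_measurable[OF g])
  have sq1: "(indicator A x)\<^sup>2 = (indicator A x :: real)" for A and x :: real by (simp add: indicator_def)
  have "integrable P (\<lambda>z. 1 * indicat_real {a..b} (snd z))"
    using ab by (intro integrable_P_block[where C=1]) auto
  then have i1: "sq_int P (\<lambda>z. indicat_real {a..b} (snd z))" by (simp add: sq_int_def sq1)
  have "g = (\<lambda>z. g z * indicat_real {a..b} (snd z))" using supp by (auto simp: fun_eq_iff indicator_def)
  then show i: "integrable P g" using integrable_mult_sq_int[OF g i1] by simp
  show "expectation (\<lambda>\<omega>. \<integral>u. g (\<omega>, u) \<partial>lborel) = (\<integral>z. g z \<partial>P)" by (rule prod.integral_fst'[OF i])
  show ae: "AE \<omega> in M. integrable lborel (\<lambda>u. g (\<omega>, u))" by (rule prod.AE_integrable_fst'[OF i])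
  note g2 = sq_int_integrable[OF g]
  have "AE \<omega> in M. integrable lborel (\<lambda>u. (g (\<omega>, u))\<^sup>2)" using prod.AE_integrable_fst'[OF g2] by simp
  then have *: "AE \<omega> in M. (\<integral>u. g (\<omega>, u) \<partial>lborel)\<^sup>2 \<le> (b - a) * (\<integral>u. (g (\<omega>, u))\<^sup>2 \<partial>lborel)"
    using AE_space
  proof eventually_elim
    case (elim \<omega>)
    have "sq_int lborel (\<lambda>u. g (\<omega>, u))" using elim by (auto simp: sq_int_def)
    moreover have "sq_int lborel (indicat_real {a..b})" using ab by (auto simp: sq_int_def sq1)
    ultimately have "(\<integral>u. g (\<omega>, u) * indicator {a..b} u \<partial>lborel)\<^sup>2 \<le>
        (\<integral>u. (g (\<omega>, u))\<^sup>2 \<partial>lborel) * (\<integral>u. (indicator {a..b} u)\<^sup>2 \<partial>lborel)"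
      by (rule integral_mult_square_le)
    moreover have "(\<lambda>u. g (\<omega>, u) * indicator {a..b} u) = (\<lambda>u. g (\<omega>, u))"
      using supp by (auto simp: fun_eq_iff indicator_def)
    ultimately show ?case using ab by (simp add: sq1 mult.commute)
  qed
  have i2: "integrable M (\<lambda>\<omega>. \<integral>u. (g (\<omega>, u))\<^sup>2 \<partial>lborel)" using prod.integrable_fst'[OF g2] by simp
  show s: "sq_int M (\<lambda>\<omega>. \<integral>u. g (\<omega>, u) \<partial>lborel)"
    by (rule sq_int_bound[OF _ integrable_mult_right[OF i2] *]) measurable
  have "expectation (\<lambda>\<omega>. (\<integral>u. g (\<omega>, u) \<partial>lborel)\<^sup>2) \<le> expectation (\<lambda>\<omega>. (b - a) * (\<integral>u. (g (\<omega>, u))\<^sup>2 \<partial>lborel))"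
    by (rule integral_mono_AE[OF sq_int_integrable[OF s] integrable_mult_right[OF i2] *])
  also have "\<dots> = (b - a) * (\<integral>z. (g z)\<^sup>2 \<partial>P)" using prod.integral_fst'[OF g2] by simp
  finally show "expectation (\<lambda>\<omega>. (\<integral>u. g (\<omega>, u) \<partial>lborel)\<^sup>2) \<le> (b - a) * (\<integral>z. (g z)\<^sup>2 \<partial>P)" .
qed

text \<open>Tonelli in the other order: second moments bounded uniformly in time control the norm on
  the product space.\<close>

lemma sq_int_P_of_sections:
  assumes g: "g \<in> borel_measurable P" and supp: "\<And>\<omega> u. u \<notin> {a..b} \<Longrightarrow> g (\<omega>, u) = 0" and ab: "a \<le> b"
    and sec: "\<And>u. u \<in> {a..b} \<Longrightarrow> sq_int M (\<lambda>\<omega>. g (\<omega>, u))"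
      "\<And>u. u \<in> {a..b} \<Longrightarrow> expectation (\<lambda>\<omega>. (g (\<omega>, u))\<^sup>2) \<le> C"
  shows "sq_int P g" "(\<integral>z. (g z)\<^sup>2 \<partial>P) \<le> (b - a) * C"
proof -
  have "0 \<le> expectation (\<lambda>\<omega>. (g (\<omega>, a))\<^sup>2)" by (intro integral_nonneg_AE) auto
  also have "\<dots> \<le> C" using sec(2)[of a] ab by simp
  finally have C0: "0 \<le> C" .
  have "(\<integral>\<^sup>+z. ennreal ((g z)\<^sup>2) \<partial>P) = (\<integral>\<^sup>+u. (\<integral>\<^sup>+\<omega>. ennreal ((g (\<omega>, u))\<^sup>2) \<partial>M) \<partial>lborel)"
    using g by (subst prod.nn_integral_snd[symmetric]) auto
  also have "\<dots> \<le> (\<integral>\<^sup>+u. ennreal C * indicator {a..b} u \<partial>lborel)"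
  proof (rule nn_integral_mono)
    fix u :: real
    show "(\<integral>\<^sup>+\<omega>. ennreal ((g (\<omega>, u))\<^sup>2) \<partial>M) \<le> ennreal C * indicator {a..b} u"
    proof (cases "u \<in> {a..b}")
      case True
      have "(\<integral>\<^sup>+\<omega>. ennreal ((g (\<omega>, u))\<^sup>2) \<partial>M) = ennreal (expectation (\<lambda>\<omega>. (g (\<omega>, u))\<^sup>2))"
        using sq_int_integrable[OF sec(1)[OF True]] by (intro nn_integral_eq_integral) auto
      then show ?thesis using True sec(2)[OF True] by (simp add: ennreal_leI)
    next
      case False then show ?thesis using supp by simp
    qed
  qed
  also have "\<dots> = ennreal ((b - a) * C)"
    using ab C0 by (simp add: nn_integral_cmult ennreal_mult'[symmetric] mult.commute)
  finally show "sq_int P g" "(\<integral>z. (g z)\<^sup>2 \<partial>P) \<le> (b - a) * C"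
    using sq_int_nn_integral[OF g, of "(b - a) * C"] ab C0 by auto
qed

end

subsection \<open>Stochastic integrals of deterministic functions\<close>

text \<open>Passes to the gauge integral, for which the fundamental theorem of calculus and the
  splitting of intervals are used below.\<close>

lemma LBINT_Icc_eq_integral:
  fixes f :: "real \<Rightarrow> real"
  assumes "continuous_on {a..b} f"
  shows "(LBINT v:{a..b}. f v) = integral {a..b} f"
  by (rule set_borel_integral_eq_integral(2)[OF borel_integrable_atLeastAtMost'[OF assms]])

text \<open>The half-open blocks tile \<open>{\<tau> 0<..\<tau> n}\<close>, so a single term of the
  sum survives.\<close>

lemma elementary_process_eq:
  assumes "\<And>k. k < n \<Longrightarrow> \<tau> k \<le> \<tau> (Suc k)" "\<tau> 0 < u" "u \<le> \<tau> n"
  shows "\<exists>k<n. \<tau> k < u \<and> u \<le> \<tau> (Suc k) \<and> elementary_process n \<tau> \<zeta> u \<omega> = \<zeta> k \<omega>"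
  using assms
proof (induction n)
  case 0 then show ?case by simp
next
  case (Suc n)
  show ?case
  proof (cases "u \<le> \<tau> n")
    case True
    then obtain k where "k < n" "\<tau> k < u" "u \<le> \<tau> (Suc k)" "elementary_process n \<tau> \<zeta> u \<omega> = \<zeta> k \<omega>"
      using Suc by auto
    then show ?thesis using True by (intro exI[of _ k]) (auto simp: elementary_process_def)
  next
    case False
    \<comment> \<open>The nodes are known to increase only up to index \<open>n\<close>; freezing
      the sequence there makes it monotone everywhere.\<close>
    have "\<tau> (Suc k) \<le> \<tau> n" if "k < n" for k
      using that by (intro lift_Suc_mono_le[of "\<lambda>i. \<tau> (min i n)" "Suc k" n, simplified] )
        (use Suc.prems(1) in \<open>auto simp: min_def not_less_eq_eq le_Suc_eq\<close>)
    then have "(\<Sum>k<n. \<zeta> k \<omega> * indicator {\<tau> k<..\<tau> (Suc k)} u) = 0"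
      using False by (intro sum.neutral) (force simp: indicator_def)
    then show ?thesis using False Suc.prems(3) by (intro exI[of _ n]) (auto simp: elementary_process_def)
  qed
qed

context brownian_basis
begin

lemma sq_int_LBINT_process:
  fixes Y :: "real \<Rightarrow> 'a \<Rightarrow> real"
  assumes cd: "c \<le> d" and cont: "\<And>\<omega>. \<omega> \<in> space M \<Longrightarrow> continuous_on {c..d} (\<lambda>v. Y v \<omega>)"
    and sec: "\<And>u. u \<in> {c..d} \<Longrightarrow> sq_int M (Y u)" "\<And>u. u \<in> {c..d} \<Longrightarrow> expectation (\<lambda>\<omega>. (Y u \<omega>)\<^sup>2) \<le> C"
  shows "sq_int M (\<lambda>\<omega>. LBINT v:{c..d}. Y v \<omega>)"
    and "expectation (\<lambda>\<omega>. (LBINT v:{c..d}. Y v \<omega>)\<^sup>2) \<le> (d - c)\<^sup>2 * C"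
proof -
  let ?g = "\<lambda>z. indicator {c..d} (snd z) * Y (snd z) (fst z)"
  have m: "?g \<in> borel_measurable P"
    by (intro continuous_process_joint_measurable sq_int_measurable[OF sec(1)] cont cd)
  have supp: "?g (\<omega>, u) = 0" if "u \<notin> {c..d}" for \<omega> u using that by simp
  have sec': "sq_int M (\<lambda>\<omega>. ?g (\<omega>, u))" "expectation (\<lambda>\<omega>. (?g (\<omega>, u))\<^sup>2) \<le> C" if "u \<in> {c..d}" for u
    using sec[OF that] that by simp_all
  note s = sq_int_P_of_sections[OF m supp cd sec']
  note t = sq_int_time_integral[OF s(1) supp cd]
  have eq: "(LBINT v:{c..d}. Y v \<omega>) = (\<integral>u. ?g (\<omega>, u) \<partial>lborel)" for \<omega>
    by (simp add: set_lebesgue_integral_def)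
  show "sq_int M (\<lambda>\<omega>. LBINT v:{c..d}. Y v \<omega>)" using t(3) unfolding eq .
  have "expectation (\<lambda>\<omega>. (LBINT v:{c..d}. Y v \<omega>)\<^sup>2) \<le> (d - c) * (\<integral>z. (?g z)\<^sup>2 \<partial>P)"
    using t(5) unfolding eq .
  also have "\<dots> \<le> (d - c) * ((d - c) * C)"
    using cd s(2) by (intro mult_left_mono) auto
  finally show "expectation (\<lambda>\<omega>. (LBINT v:{c..d}. Y v \<omega>)\<^sup>2) \<le> (d - c)\<^sup>2 * C"
    by (simp add: power2_eq_square algebra_simps)
qed

lemma W_continuous_increment:
  "\<omega> \<in> space M \<Longrightarrow> 0 \<le> a \<Longrightarrow> continuous_on {a..b} (\<lambda>v. W v \<omega>)"
  by (rule continuous_on_subset[OF W_continuous]) auto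

text \<open>Over one cell, the integration by parts expression is compared with the left-point term
  of an elementary integral. Since \<open>g d - g c\<close> is the integral of \<open>g'\<close>,
  its factor can be moved under that integral, where only \<open>W d - W v\<close> survives.\<close>

lemma ito_by_parts_remainder:
  fixes g g' :: "real \<Rightarrow> real"
  assumes a: "0 \<le> a" and cd: "a \<le> c" "c \<le> d" and \<omega>: "\<omega> \<in> space M"
    and g: "\<And>x. (g has_real_derivative g' x) (at x)" and g': "continuous_on UNIV g'"
  shows "(g d * (W d \<omega> - W a \<omega>) - (LBINT v:{a..d}. g' v * (W v \<omega> - W a \<omega>)))
    - (g c * (W c \<omega> - W a \<omega>) - (LBINT v:{a..c}. g' v * (W v \<omega> - W a \<omega>)))
    = g c * (W d \<omega> - W c \<omega>) + (LBINT v:{c..d}. g' v * (W d \<omega> - W v \<omega>))"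
proof -
  let ?B = "\<lambda>v. W v \<omega> - W a \<omega>"
  note cont = W_continuous_increment[OF \<omega> a] W_continuous_increment[OF \<omega> order_trans[OF a cd(1)]]
    continuous_on_subset[OF g' subset_UNIV]
  have 1: "integral {a..d} (\<lambda>v. g' v * ?B v) = integral {a..c} (\<lambda>v. g' v * ?B v) + integral {c..d} (\<lambda>v. g' v * ?B v)"
    by (intro Henstock_Kurzweil_Integration.integral_combine[symmetric] cd
        integrable_continuous_interval continuous_intros cont)
  have 2: "(g' has_integral (g d - g c)) {c..d}"
    by (intro fundamental_theorem_of_calculus cd)
      (auto intro!: DERIV_subset[OF g] simp: has_real_derivative_iff_has_vector_derivative[symmetric])
  have "((\<lambda>v. g' v * ?B d - g' v * ?B v) has_integral ((g d - g c) * ?B d - integral {c..d} (\<lambda>v. g' v * ?B v))) {c..d}"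
    by (intro has_integral_diff has_integral_mult_left 2 integrable_integral
        integrable_continuous_interval continuous_intros cont)
  then have 3: "integral {c..d} (\<lambda>v. g' v * (W d \<omega> - W v \<omega>)) = (g d - g c) * ?B d - integral {c..d} (\<lambda>v. g' v * ?B v)"
    by (intro integral_unique) (simp add: algebra_simps)
  have "(LBINT v:{a..d}. g' v * ?B v) = integral {a..d} (\<lambda>v. g' v * ?B v)"
    "(LBINT v:{a..c}. g' v * ?B v) = integral {a..c} (\<lambda>v. g' v * ?B v)"
    "(LBINT v:{c..d}. g' v * (W d \<omega> - W v \<omega>)) = integral {c..d} (\<lambda>v. g' v * (W d \<omega> - W v \<omega>))"
    by (intro LBINT_Icc_eq_integral continuous_intros cont)+
  then show ?thesis using 1 3 by (simp add: algebra_simps)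
qed

text \<open>The cube is \<open>(d - c)\<^sup>2\<close> from the time integral times
  \<open>d - c\<close> from the variance of the increment. It leaves room to sum the remainders by a
  crude estimate that does not use their orthogonality.\<close>

lemma by_parts_remainder_bound:
  fixes g' :: "real \<Rightarrow> real"
  assumes cd: "0 \<le> c" "c \<le> d" and g': "continuous_on UNIV g'" and G: "\<And>v. v \<in> {c..d} \<Longrightarrow> \<bar>g' v\<bar> \<le> G"
  shows "sq_int M (\<lambda>\<omega>. LBINT v:{c..d}. g' v * (W d \<omega> - W v \<omega>))"
    and "expectation (\<lambda>\<omega>. (LBINT v:{c..d}. g' v * (W d \<omega> - W v \<omega>))\<^sup>2) \<le> G\<^sup>2 * (d - c) ^ 3"
proof -
  let ?Y = "\<lambda>v \<omega>. g' v * (W d \<omega> - W v \<omega>)"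
  have cont: "continuous_on {c..d} (\<lambda>v. ?Y v \<omega>)" if "\<omega> \<in> space M" for \<omega>
    using that cd by (intro continuous_intros W_continuous_increment continuous_on_subset[OF g']) auto
  have sec: "sq_int M (?Y u)" "expectation (\<lambda>\<omega>. (?Y u \<omega>)\<^sup>2) \<le> G\<^sup>2 * (d - c)" if u: "u \<in> {c..d}" for u
  proof -
    have u': "0 \<le> u" "u \<le> d" using u cd by auto
    show "sq_int M (?Y u)" by (rule sq_int_cmult[OF sq_int_increment[OF u']])
    have "expectation (\<lambda>\<omega>. (?Y u \<omega>)\<^sup>2) = (g' u)\<^sup>2 * (d - u)"
      using expectation_increment_square[OF u'] by (simp add: power_mult_distrib)
    also have "\<dots> \<le> G\<^sup>2 * (d - c)"
      using u power_mono[OF G[OF u] abs_ge_zero, of 2] by (intro mult_mono) auto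
    finally show "expectation (\<lambda>\<omega>. (?Y u \<omega>)\<^sup>2) \<le> G\<^sup>2 * (d - c)" .
  qed
  show "sq_int M (\<lambda>\<omega>. LBINT v:{c..d}. ?Y v \<omega>)"
    by (rule sq_int_LBINT_process(1)[OF cd(2) cont sec])
  show "expectation (\<lambda>\<omega>. (LBINT v:{c..d}. ?Y v \<omega>)\<^sup>2) \<le> G\<^sup>2 * (d - c) ^ 3"
    using sq_int_LBINT_process(2)[OF cd(2) cont sec] by (simp add: power2_eq_square power3_eq_cube algebra_simps)
qed

text \<open>Integration by parts names a version of the integral as a function of the path of
  \<open>W\<close>, so that a wealth equation can afterwards be verified path by path.\<close>

theorem has_ito_integral_deterministic:
  fixes g g' :: "real \<Rightarrow> real"
  assumes ab: "0 \<le> a" "a \<le> b"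
    and g: "\<And>x. (g has_real_derivative g' x) (at x)" and g': "continuous_on UNIV g'"
  shows "has_ito_integral M F W a b (\<lambda>v \<omega>. g v)
    (\<lambda>\<omega>. g b * (W b \<omega> - W a \<omega>) - (LBINT v:{a..b}. g' v * (W v \<omega> - W a \<omega>)))"
proof -
  let ?Z = "\<lambda>\<omega>. g b * (W b \<omega> - W a \<omega>) - (LBINT v:{a..b}. g' v * (W v \<omega> - W a \<omega>))"
  obtain G where G: "\<And>v. v \<in> {a..b} \<Longrightarrow> \<bar>g' v\<bar> \<le> G"
  proof -
    have "bounded (g' ` {a..b})"
      by (intro compact_imp_bounded compact_continuous_image continuous_on_subset[OF g']) auto
    then show ?thesis using that by (force simp: bounded_iff)
  qed
  have G0: "0 \<le> G" using G[of a] ab by auto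
  have Lip: "\<bar>g u - g v\<bar> \<le> G * (u - v)" if "a \<le> v" "v \<le> u" "u \<le> b" for u v
  proof (cases "v = u")
    case False
    then have "v < u" using that by simp
    from MVT2[OF this, of g g'] g obtain z where z: "v < z" "z < u" "g u - g v = (u - v) * g' z" by blast
    then show ?thesis using G[of z] that by (auto simp: abs_mult mult.commute intro!: mult_left_mono)
  qed (use that in simp)
  \<comment> \<open>A uniform partition into \<open>Suc m\<close> cells, which avoids division by
    zero.\<close>
  define \<delta> where "\<delta> m = (b - a) / real (Suc m)" for m
  define \<tau> where "\<tau> m k = a + real k * \<delta> m" for m k :: nat
  define \<zeta> where "\<zeta> m k \<omega> = g (\<tau> m k)" for m k and \<omega> :: 'a
  have \<delta>0: "0 \<le> \<delta> m" for m using ab by (simp add: \<delta>_def)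
  have \<delta>n: "real (Suc m) * \<delta> m = b - a" for m by (simp add: \<delta>_def)
  have \<delta>lim: "\<delta> \<longlonglongrightarrow> 0"
  proof -
    have "(\<lambda>m. (b - a) * inverse (real (Suc m))) \<longlonglongrightarrow> (b - a) * 0"
      by (intro tendsto_intros LIMSEQ_inverse_real_of_nat)
    then show ?thesis by (simp add: \<delta>_def[abs_def] divide_inverse)
  qed
  have \<tau>0: "\<tau> m 0 = a" and \<tau>n: "\<tau> m (Suc m) = b" and \<tau>s: "\<tau> m (Suc k) - \<tau> m k = \<delta> m" for m k
    using \<delta>n[of m] by (auto simp: \<tau>_def algebra_simps)
  have \<tau>a: "a \<le> \<tau> m k" for m k using \<delta>0 by (simp add: \<tau>_def)
  have \<tau>b: "\<tau> m k \<le> b" if "k \<le> Suc m" for m k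
    using mult_right_mono[OF _ \<delta>0[of m], of "real k" "real (Suc m)"] that \<delta>n[of m] by (simp add: \<tau>_def)
  have \<tau>m: "\<tau> m k \<le> \<tau> m (Suc k)" for m k using \<tau>s[of m k] \<delta>0[of m] by simp
  have el: "elementary_integrand M F a b (Suc m) (\<tau> m) (\<zeta> m)" for m
    unfolding elementary_integrand_def using \<tau>a \<tau>b \<tau>m by (auto simp: \<zeta>_def[abs_def])
  have gm: "g \<in> borel_measurable borel"
    using g by (intro borel_measurable_continuous_onI DERIV_continuous_on[where D = g'])
      (auto intro: DERIV_subset)
  have prog: "progressively_measurable F a b (\<lambda>v \<omega>. g v)"
    unfolding progressively_measurable_def
  proof
    fix u assume "u \<in> {a..b}"
    have "g \<in> borel_measurable (restrict_space borel {a..u})" using gm by (rule measurable_restrict_space1)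
    from measurable_compose[OF measurable_fst this]
    show "(\<lambda>(v, \<omega>). g v) \<in> borel_measurable (restrict_space borel {a..u} \<Otimes>\<^sub>M F u)"
      by (simp add: case_prod_beta')
  qed
  define R where "R m k \<omega> = (LBINT v:{\<tau> m k..\<tau> m (Suc k)}. g' v * (W (\<tau> m (Suc k)) \<omega> - W v \<omega>))" for m k \<omega>
  have Zeq: "?Z \<omega> - elementary_integral W (Suc m) (\<tau> m) (\<zeta> m) \<omega> = (\<Sum>k<Suc m. R m k \<omega>)" if \<omega>: "\<omega> \<in> space M" for m \<omega>
  proof -
    \<comment> \<open>The candidate integral up to the node \<open>\<tau> m k\<close>; over one cell
      it grows by the elementary term plus \<open>R m k\<close>.\<close>
    define S where "S k = g (\<tau> m k) * (W (\<tau> m k) \<omega> - W a \<omega>) - (LBINT v:{a..\<tau> m k}. g' v * (W v \<omega> - W a \<omega>))" for k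
    have "(LBINT v:{a..a}. g' v * (W v \<omega> - W a \<omega>)) = integral {a..a} (\<lambda>v. g' v * (W v \<omega> - W a \<omega>))"
      by (intro LBINT_Icc_eq_integral continuous_intros) auto
    then have S0: "S 0 = 0" by (simp add: S_def \<tau>0)
    have "?Z \<omega> = S (Suc m) - S 0" unfolding S0 unfolding S_def \<tau>n by simp
    also have "\<dots> = (\<Sum>k<Suc m. S (Suc k) - S k)" by (rule sum_lessThan_telescope[symmetric])
    also have "\<dots> = (\<Sum>k<Suc m. \<zeta> m k \<omega> * (W (\<tau> m (Suc k)) \<omega> - W (\<tau> m k) \<omega>) + R m k \<omega>)"
      unfolding S_def R_def \<zeta>_def by (intro sum.cong refl ito_by_parts_remainder \<tau>a \<tau>m \<omega> ab g g')
    also have "\<dots> = elementary_integral W (Suc m) (\<tau> m) (\<zeta> m) \<omega> + (\<Sum>k<Suc m. R m k \<omega>)"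
      by (simp only: sum.distrib elementary_integral_def)
    finally show ?thesis by simp
  qed
  have R: "sq_int M (R m k) \<and> expectation (\<lambda>\<omega>. (R m k \<omega>)\<^sup>2) \<le> G\<^sup>2 * (\<delta> m) ^ 3" if "k < Suc m" for m k
  proof -
    have G': "\<bar>g' v\<bar> \<le> G" if "v \<in> {\<tau> m k..\<tau> m (Suc k)}" for v
      using that \<tau>a[of m k] \<tau>b[of "Suc k" m] \<open>k < Suc m\<close> by (intro G) auto
    show ?thesis
      using by_parts_remainder_bound[OF order_trans[OF ab(1) \<tau>a] \<tau>m g' G', of m k] \<tau>s[of m k]
      by (simp add: R_def[abs_def])
  qed
  have SR: "sq_int M (\<lambda>\<omega>. \<Sum>k<Suc m. R m k \<omega>)" for m using R by (intro sq_int_sum) auto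
  \<comment> \<open>\<open>Suc m\<close> terms of size \<open>G\<^sup>2 * \<delta> m ^ 3\<close>,
    and another factor \<open>Suc m\<close> from squaring the sum: as
    \<open>Suc m * \<delta> m = b - a\<close>, one factor \<open>\<delta> m\<close> is left.\<close>
  have bound: "expectation (\<lambda>\<omega>. (\<Sum>k<Suc m. R m k \<omega>)\<^sup>2) \<le> (b - a)\<^sup>2 * G\<^sup>2 * \<delta> m" for m
  proof -
    have i: "integrable M (\<lambda>\<omega>. (R m k \<omega>)\<^sup>2)" if "k < Suc m" for k using R[OF that] by (auto simp: sq_int_def)
    have "expectation (\<lambda>\<omega>. (\<Sum>k<Suc m. R m k \<omega>)\<^sup>2) \<le> expectation (\<lambda>\<omega>. (\<Sum>k<Suc m. (R m k \<omega>)\<^sup>2) * real (card {..<Suc m}))"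
      using i by (intro integral_mono sq_int_integrable[OF SR] integrable_mult_left Bochner_Integration.integrable_sum
          sum_squared_le_sum_of_squares) auto
    also have "\<dots> = (\<Sum>k<Suc m. expectation (\<lambda>\<omega>. (R m k \<omega>)\<^sup>2)) * real (Suc m)"
      using i by (subst integral_mult_left_zero, subst Bochner_Integration.integral_sum) (auto simp del: sum.lessThan_Suc)
    also have "\<dots> \<le> (\<Sum>k<Suc m. G\<^sup>2 * (\<delta> m) ^ 3) * real (Suc m)"
      using R by (intro mult_right_mono sum_mono) auto
    also have "\<dots> = (real (Suc m) * \<delta> m)\<^sup>2 * G\<^sup>2 * \<delta> m"
      by (simp add: power2_eq_square power3_eq_cube algebra_simps del: of_nat_Suc)
    finally show ?thesis by (simp only: \<delta>n)
  qed
  \<comment> \<open>The identity for a partition with a single cell exhibits \<open>?Z\<close> as a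
    sum of two measurable functions.\<close>
  have Zm: "?Z \<in> borel_measurable M"
  proof (subst measurable_cong)
    show "?Z \<omega> = elementary_integral W (Suc 0) (\<tau> 0) (\<zeta> 0) \<omega> + (\<Sum>k<Suc 0. R 0 k \<omega>)" if "\<omega> \<in> space M" for \<omega>
      using Zeq[OF that, of 0] by linarith
    show "(\<lambda>\<omega>. elementary_integral W (Suc 0) (\<tau> 0) (\<zeta> 0) \<omega> + (\<Sum>k<Suc 0. R 0 k \<omega>)) \<in> borel_measurable M"
      by (intro borel_measurable_add sq_int_measurable[OF SR] sq_int_measurable
          simple_ito_sq_int(2)[OF elementary_simple_ito[OF el ab(1)]])
  qed
  have l1: "(\<lambda>m. \<integral>\<^sup>+\<omega>. (\<integral>\<^sup>+u\<in>{a..b}. ennreal ((g u - elementary_process (Suc m) (\<tau> m) (\<zeta> m) u \<omega>)\<^sup>2)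
           \<partial>lborel) \<partial>M) \<longlonglongrightarrow> 0"
  proof (rule tendsto_sandwich[OF _ _ tendsto_const])
    have "(\<lambda>m. ennreal ((G * \<delta> m)\<^sup>2 * (b - a))) \<longlonglongrightarrow> ennreal ((G * 0)\<^sup>2 * (b - a))"
      by (intro tendsto_ennrealI tendsto_intros \<delta>lim)
    then show "(\<lambda>m. ennreal ((G * \<delta> m)\<^sup>2 * (b - a))) \<longlonglongrightarrow> 0" by simp
    show "\<forall>\<^sub>F m in sequentially. (\<integral>\<^sup>+\<omega>. (\<integral>\<^sup>+u\<in>{a..b}. ennreal ((g u - elementary_process (Suc m) (\<tau> m) (\<zeta> m) u \<omega>)\<^sup>2)
           \<partial>lborel) \<partial>M) \<le> ennreal ((G * \<delta> m)\<^sup>2 * (b - a))"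
    proof (intro always_eventually allI)
      fix m
      have "(\<integral>\<^sup>+u\<in>{a..b}. ennreal ((g u - elementary_process (Suc m) (\<tau> m) (\<zeta> m) u \<omega>)\<^sup>2) \<partial>lborel)
          \<le> ennreal ((G * \<delta> m)\<^sup>2 * (b - a))" for \<omega>
      proof -
        have "(\<integral>\<^sup>+u\<in>{a..b}. ennreal ((g u - elementary_process (Suc m) (\<tau> m) (\<zeta> m) u \<omega>)\<^sup>2) \<partial>lborel)
          \<le> (\<integral>\<^sup>+u. ennreal ((G * \<delta> m)\<^sup>2) * indicator {a..b} u \<partial>lborel)"
        proof (rule nn_integral_mono_AE)
          \<comment> \<open>At \<open>u = a\<close> every half-open block vanishes, so the
            elementary process does not approximate \<open>g\<close> there.\<close>
          have "AE u in lborel. u \<noteq> a" by (rule AE_lborel_singleton)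
          then show "AE u in lborel. ennreal ((g u - elementary_process (Suc m) (\<tau> m) (\<zeta> m) u \<omega>)\<^sup>2) * indicator {a..b} u
             \<le> ennreal ((G * \<delta> m)\<^sup>2) * indicator {a..b} u"
          proof eventually_elim
            case (elim u)
            show ?case
            proof (cases "u \<in> {a..b}")
              case True
              then have "\<tau> m 0 < u" "u \<le> \<tau> m (Suc m)" using elim \<tau>0 \<tau>n by auto
              from elementary_process_eq[OF \<tau>m this, of "\<zeta> m" \<omega>] obtain k where k: "k < Suc m" "\<tau> m k < u" "u \<le> \<tau> m (Suc k)"
                "elementary_process (Suc m) (\<tau> m) (\<zeta> m) u \<omega> = g (\<tau> m k)" by (auto simp: \<zeta>_def)
              have "\<bar>g u - g (\<tau> m k)\<bar> \<le> G * (u - \<tau> m k)" using k \<tau>a True by (intro Lip) auto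
              also have "\<dots> \<le> G * \<delta> m" using k \<tau>s[of m k] G0 by (intro mult_left_mono) auto
              finally have "(g u - g (\<tau> m k))\<^sup>2 \<le> (G * \<delta> m)\<^sup>2"
                using power_mono[OF _ abs_ge_zero, of "g u - g (\<tau> m k)" "G * \<delta> m" 2] by simp
              then show ?thesis using k(4) by (simp add: ennreal_leI mult_right_mono)
            qed simp
          qed
        qed
        also have "\<dots> = ennreal ((G * \<delta> m)\<^sup>2 * (b - a))"
          using ab by (simp add: nn_integral_cmult ennreal_mult'')
        finally show ?thesis .
      qed
      then have "(\<integral>\<^sup>+\<omega>. (\<integral>\<^sup>+u\<in>{a..b}. ennreal ((g u - elementary_process (Suc m) (\<tau> m) (\<zeta> m) u \<omega>)\<^sup>2)
           \<partial>lborel) \<partial>M) \<le> (\<integral>\<^sup>+\<omega>. ennreal ((G * \<delta> m)\<^sup>2 * (b - a)) \<partial>M)" by (intro nn_integral_mono)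
      then show "(\<integral>\<^sup>+\<omega>. (\<integral>\<^sup>+u\<in>{a..b}. ennreal ((g u - elementary_process (Suc m) (\<tau> m) (\<zeta> m) u \<omega>)\<^sup>2)
           \<partial>lborel) \<partial>M) \<le> ennreal ((G * \<delta> m)\<^sup>2 * (b - a))"
        by (simp add: emeasure_space_1)
    qed
  qed auto
  have l2: "(\<lambda>m. \<integral>\<^sup>+\<omega>. ennreal ((?Z \<omega> - elementary_integral W (Suc m) (\<tau> m) (\<zeta> m) \<omega>)\<^sup>2) \<partial>M) \<longlonglongrightarrow> 0"
  proof (rule tendsto_sandwich[OF _ _ tendsto_const])
    have "(\<lambda>m. ennreal ((b - a)\<^sup>2 * G\<^sup>2 * \<delta> m)) \<longlonglongrightarrow> ennreal ((b - a)\<^sup>2 * G\<^sup>2 * 0)"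
      by (intro tendsto_ennrealI tendsto_intros \<delta>lim)
    then show "(\<lambda>m. ennreal ((b - a)\<^sup>2 * G\<^sup>2 * \<delta> m)) \<longlonglongrightarrow> 0" by simp
    show "\<forall>\<^sub>F m in sequentially. (\<integral>\<^sup>+\<omega>. ennreal ((?Z \<omega> - elementary_integral W (Suc m) (\<tau> m) (\<zeta> m) \<omega>)\<^sup>2) \<partial>M)
       \<le> ennreal ((b - a)\<^sup>2 * G\<^sup>2 * \<delta> m)"
    proof (intro always_eventually allI)
      fix m
      have "(\<integral>\<^sup>+\<omega>. ennreal ((?Z \<omega> - elementary_integral W (Suc m) (\<tau> m) (\<zeta> m) \<omega>)\<^sup>2) \<partial>M) =
        (\<integral>\<^sup>+\<omega>. ennreal ((\<Sum>k<Suc m. R m k \<omega>)\<^sup>2) \<partial>M)"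
        using Zeq by (intro nn_integral_cong) (simp del: sum.lessThan_Suc)
      also have "\<dots> = ennreal (expectation (\<lambda>\<omega>. (\<Sum>k<Suc m. R m k \<omega>)\<^sup>2))"
        by (intro nn_integral_eq_integral sq_int_integrable[OF SR]) auto
      also have "\<dots> \<le> ennreal ((b - a)\<^sup>2 * G\<^sup>2 * \<delta> m)" using bound by (rule ennreal_leI)
      finally show "(\<integral>\<^sup>+\<omega>. ennreal ((?Z \<omega> - elementary_integral W (Suc m) (\<tau> m) (\<zeta> m) \<omega>)\<^sup>2) \<partial>M)
       \<le> ennreal ((b - a)\<^sup>2 * G\<^sup>2 * \<delta> m)" .
    qed
  qed auto
  show ?thesis
    unfolding has_ito_integral_def
    using prog Zm el l1 l2 by (intro conjI exI[of _ "\<lambda>m. Suc m"] exI[of _ \<tau>] exI[of _ \<zeta>]) auto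
qed

end

subsection \<open>Deviations from a linear stochastic differential equation\<close>

text \<open>In the variable \<open>v\<close>, the integrand on the right is the derivative of
  \<open>exp (r * (T - v)) * (r * integral {t..v} f + K T)\<close>, and
  \<open>f T = K T + r * integral {t..T} f\<close>. Subtracting \<open>K T\<close> under the
  integral is deliberate: only the change of \<open>K\<close> after \<open>v\<close> enters, and
  this disappears once the deviation is over.\<close>

lemma volterra_resolvent:
  fixes f :: "real \<Rightarrow> real" and r :: real
  assumes "t \<le> T" and f: "continuous_on {t..T} f"
    and K: "\<And>v. K v = f v - r * integral {t..v} f"
  shows "f T = exp (r * (T - t)) * K T + (LBINT v:{t..T}. r * exp (r * (T - v)) * (K v - K T))"
proof -
  let ?I = "\<lambda>v. integral {t..v} f"
  have I: "(?I has_real_derivative f v) (at v within {t..T})" if "v \<in> {t..T}" for v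
    by (rule integral_has_real_derivative[OF f that])
  have contI: "continuous_on {t..T} ?I"
    by (rule indefinite_integral_continuous_1[OF integrable_continuous_interval[OF f]])
  have "((\<lambda>v. exp (r * (T - v)) * (r * ?I v + K T)) has_real_derivative
      r * exp (r * (T - v)) * (K v - K T)) (at v within {t..T})" if "v \<in> {t..T}" for v
    by (rule derivative_eq_intros refl I[OF that])+ (simp add: K[of v] algebra_simps)
  then have "((\<lambda>v. r * exp (r * (T - v)) * (K v - K T)) has_integral
      exp (r * (T - T)) * (r * ?I T + K T) - exp (r * (T - t)) * (r * ?I t + K T)) {t..T}"
    using assms(1) by (intro fundamental_theorem_of_calculus)
      (auto simp: has_real_derivative_iff_has_vector_derivative[symmetric])
  then have "integral {t..T} (\<lambda>v. r * exp (r * (T - v)) * (K v - K T)) = r * ?I T + K T - exp (r * (T - t)) * K T"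
    by (intro integral_unique) simp
  moreover have "(LBINT v:{t..T}. r * exp (r * (T - v)) * (K v - K T)) =
      integral {t..T} (\<lambda>v. r * exp (r * (T - v)) * (K v - K T))"
    unfolding K[of T] by (intro LBINT_Icc_eq_integral) (unfold K, intro continuous_intros f contI)
  ultimately show ?thesis by (simp add: K[of T])
qed

text \<open>\<open>D\<close> stands for the difference of two wealths of one investor,
  \<open>\<epsilon>\<close> for the difference of the amounts, \<open>m\<close> for
  \<open>\<mu> - r\<close>, and \<open>c\<close> for the time at which the deviation ends. After
  \<open>c\<close> the deviation vanishes only up to null sets, since feedback rules are followed
  only almost everywhere. Its part up to \<open>c\<close> is known at time \<open>c\<close>, which
  makes it independent of later increments of \<open>W\<close>.\<close>

locale linear_deviation = brownian_basis M F W
  for M :: "'a measure" and F W +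
  fixes t c T r m \<sigma> :: real and D Z :: "real \<Rightarrow> 'a \<Rightarrow> real" and \<epsilon> :: "'a \<times> real \<Rightarrow> real"
  assumes times: "0 \<le> t" "t \<le> c" "c \<le> T" and r0: "0 \<le> r"
    and D_measurable: "\<And>u. u \<in> {t..T} \<Longrightarrow> D u \<in> borel_measurable M"
    and D_continuous: "\<And>\<omega>. \<omega> \<in> space M \<Longrightarrow> continuous_on {t..T} (\<lambda>u. D u \<omega>)"
    and eps_sq_int: "sq_int P \<epsilon>"
    and eps_support: "\<And>\<omega> u. u \<notin> {t..T} \<Longrightarrow> \<epsilon> (\<omega>, u) = 0"
    and eps_zero: "AE z in P. snd z > c \<longrightarrow> \<epsilon> z = 0"
    and eps_adapted: "(\<lambda>z. indicator {t..c} (snd z) * \<epsilon> z) \<in> borel_measurable (F c \<Otimes>\<^sub>M lborel)"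
    and Z: "\<And>u. u \<in> {t..T} \<Longrightarrow> ito_pair (\<lambda>z. indicator {t..u} (snd z) * (\<sigma> * \<epsilon> z)) (Z u)"
    and D_eq: "\<And>u. u \<in> {t..T} \<Longrightarrow>
      AE \<omega> in M. D u \<omega> = (LBINT v:{t..u}. r * D v \<omega> + m * \<epsilon> (\<omega>, v)) + Z u \<omega>"
begin

definition "Q = (\<integral>z. (\<epsilon> z)\<^sup>2 \<partial>P)"

definition "mean_eps = (\<integral>z. \<epsilon> z \<partial>P)"

definition "A = exp (r * (T - t))"

text \<open>
  The integrals \<open>Z u\<close> are only given up to null sets, separately for each \<open>u\<close>, whereas \<open>K\<close> is a version of
  \<open>m \<integral> \<epsilon> du + Z\<close> with continuous paths. Recovering \<open>D\<close> from \<open>K\<close> pathwise replaces Ito's formula.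
\<close>

definition K :: "real \<Rightarrow> 'a \<Rightarrow> real" where
  "K u \<omega> = D u \<omega> - r * integral {t..u} (\<lambda>v. D v \<omega>)"

definition U :: "real \<Rightarrow> 'a \<Rightarrow> real" where
  "U u \<omega> = (\<integral>v. indicator {t..u} v * \<epsilon> (\<omega>, v) \<partial>lborel)"

definition "Rem \<omega> = (LBINT v:{t..T}. r * exp (r * (T - v)) * (K v \<omega> - K T \<omega>))"

section \<open>Drift and noise generated by the deviation\<close>

lemma tT: "t \<in> {t..T}" "T \<in> {t..T}" "c \<in> {t..T}" "t \<le> T" "0 \<le> T" "0 \<le> c"
  using times by auto

lemma Q_nonneg: "0 \<le> Q" unfolding Q_def by (intro integral_nonneg_AE) auto

lemma A_ge1: "1 \<le> A" using r0 tT by (simp add: A_def)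

lemma eps_measurable [measurable]: "\<epsilon> \<in> borel_measurable P"
  by (rule sq_int_measurable[OF eps_sq_int])

lemma sq_int_eps_part:
  assumes "A' \<in> sets borel"
  shows "sq_int P (\<lambda>z. indicator A' (snd z) * \<epsilon> z)" "(\<integral>z. (indicator A' (snd z) * \<epsilon> z)\<^sup>2 \<partial>P) \<le> Q"
proof -
  have *: "(indicator A' (snd z) * \<epsilon> z)\<^sup>2 \<le> (\<epsilon> z)\<^sup>2" for z by (simp add: indicator_def)
  show 1: "sq_int P (\<lambda>z. indicator A' (snd z) * \<epsilon> z)"
    by (rule sq_int_bound[OF _ sq_int_integrable[OF eps_sq_int]]) (use assms * in \<open>measurable, auto\<close>)
  show "(\<integral>z. (indicator A' (snd z) * \<epsilon> z)\<^sup>2 \<partial>P) \<le> Q"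
    unfolding Q_def by (rule integral_mono[OF sq_int_integrable[OF 1] sq_int_integrable[OF eps_sq_int] *])
qed

lemma eps_part_zero:
  assumes "A' \<in> sets borel" "\<And>u. u \<in> A' \<Longrightarrow> c < u"
  shows "(\<integral>z. (indicator A' (snd z) * \<epsilon> z)\<^sup>2 \<partial>P) = 0"
proof -
  have "AE z in P. (indicator A' (snd z) * \<epsilon> z)\<^sup>2 = 0"
    using eps_zero by eventually_elim (use assms(2) in \<open>auto simp: indicator_def\<close>)
  then show ?thesis by (rule integral_eq_zero_AE)
qed

lemma U_part:
  assumes "A' \<in> sets borel" "A' \<subseteq> {a..b}" "a \<le> b"
  shows "AE \<omega> in M. integrable lborel (\<lambda>v. indicator A' v * \<epsilon> (\<omega>, v))"
    and "sq_int M (\<lambda>\<omega>. \<integral>v. indicator A' v * \<epsilon> (\<omega>, v) \<partial>lborel)"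
    and "expectation (\<lambda>\<omega>. \<integral>v. indicator A' v * \<epsilon> (\<omega>, v) \<partial>lborel) = (\<integral>z. indicator A' (snd z) * \<epsilon> z \<partial>P)"
    and "expectation (\<lambda>\<omega>. (\<integral>v. indicator A' v * \<epsilon> (\<omega>, v) \<partial>lborel)\<^sup>2)
      \<le> (b - a) * (\<integral>z. (indicator A' (snd z) * \<epsilon> z)\<^sup>2 \<partial>P)"
proof -
  have "indicator A' (snd (\<omega>, u)) * \<epsilon> (\<omega>, u) = 0" if "u \<notin> {a..b}" for \<omega> u
    using that assms(2) by (auto simp: indicator_def)
  note * = sq_int_time_integral[OF sq_int_eps_part(1)[OF assms(1)] this assms(3)]
  show "AE \<omega> in M. integrable lborel (\<lambda>v. indicator A' v * \<epsilon> (\<omega>, v))"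
    "sq_int M (\<lambda>\<omega>. \<integral>v. indicator A' v * \<epsilon> (\<omega>, v) \<partial>lborel)"
    "expectation (\<lambda>\<omega>. \<integral>v. indicator A' v * \<epsilon> (\<omega>, v) \<partial>lborel) = (\<integral>z. indicator A' (snd z) * \<epsilon> z \<partial>P)"
    "expectation (\<lambda>\<omega>. (\<integral>v. indicator A' v * \<epsilon> (\<omega>, v) \<partial>lborel)\<^sup>2)
      \<le> (b - a) * (\<integral>z. (indicator A' (snd z) * \<epsilon> z)\<^sup>2 \<partial>P)"
    using *(2-5) by simp_all
qed

lemma sq_int_U: "u \<in> {t..T} \<Longrightarrow> sq_int M (U u)"
  unfolding U_def[abs_def] by (rule U_part(2)[of _ t u]) auto

lemma expectation_U: "expectation (U T) = mean_eps"
proof -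
  have "expectation (U T) = (\<integral>z. indicator {t..T} (snd z) * \<epsilon> z \<partial>P)"
    unfolding U_def[abs_def] using tT by (intro U_part(3)[of _ t T]) auto
  also have "(\<lambda>z. indicator {t..T} (snd z) * \<epsilon> z) = \<epsilon>"
    using eps_support by (auto simp: indicator_def fun_eq_iff)
  finally show ?thesis by (simp add: mean_eps_def)
qed

lemma U_diff:
  assumes u: "u \<in> {t..T}"
  shows "AE \<omega> in M. U T \<omega> - U u \<omega> = (\<integral>v. indicator {u<..T} v * \<epsilon> (\<omega>, v) \<partial>lborel)"
proof -
  have "AE \<omega> in M. integrable lborel (\<lambda>v. indicator {t..u} v * \<epsilon> (\<omega>, v))"
    using u by (intro U_part(1)[of _ t u]) auto
  moreover have "AE \<omega> in M. integrable lborel (\<lambda>v. indicator {u<..T} v * \<epsilon> (\<omega>, v))"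
    using u by (intro U_part(1)[of _ u T]) auto
  ultimately show ?thesis
  proof eventually_elim
    case (elim \<omega>)
    have "U T \<omega> = (\<integral>v. indicator {t..u} v * \<epsilon> (\<omega>, v) + indicator {u<..T} v * \<epsilon> (\<omega>, v) \<partial>lborel)"
      unfolding U_def using u by (intro Bochner_Integration.integral_cong) (auto simp: indicator_def)
    also have "\<dots> = U u \<omega> + (\<integral>v. indicator {u<..T} v * \<epsilon> (\<omega>, v) \<partial>lborel)"
      unfolding U_def by (rule Bochner_Integration.integral_add[OF elim])
    finally show ?case by simp
  qed
qed

lemma U_T_eq_U_c: "AE \<omega> in M. U T \<omega> = U c \<omega>"
proof -
  let ?V = "\<lambda>\<omega>. \<integral>v. indicator {c<..T} v * \<epsilon> (\<omega>, v) \<partial>lborel"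
  have s: "sq_int M ?V" and le: "expectation (\<lambda>\<omega>. (?V \<omega>)\<^sup>2) \<le> 0"
    using U_part(2,4)[of "{c<..T}" c T] times eps_part_zero[of "{c<..T}"]
    by (auto simp: greaterThanAtMost_subseteq_atLeastAtMost_iff)
  then have "AE \<omega> in M. (?V \<omega>)\<^sup>2 = 0"
    by (subst integral_nonneg_eq_0_iff_AE[symmetric])
       (auto simp: sq_int_def intro!: antisym integral_nonneg_AE)
  with U_diff[OF tT(3)] show ?thesis by eventually_elim simp
qed

lemma U_square: "expectation (\<lambda>\<omega>. (U c \<omega>)\<^sup>2) \<le> (c - t) * Q"
proof -
  have "expectation (\<lambda>\<omega>. (U c \<omega>)\<^sup>2) \<le> (c - t) * (\<integral>z. (indicator {t..c} (snd z) * \<epsilon> z)\<^sup>2 \<partial>P)"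
    unfolding U_def[abs_def] using times by (intro U_part(4)) auto
  also have "\<dots> \<le> (c - t) * Q"
    using times by (intro mult_left_mono sq_int_eps_part(2)) auto
  finally show ?thesis .
qed

lemma sq_int_Z: "u \<in> {t..T} \<Longrightarrow> sq_int M (Z u)"
  using ito_pair_sq_int(2)[OF Z] .

lemma Z_diff_square:
  assumes u: "u \<in> {t..T}"
  shows "expectation (\<lambda>\<omega>. (Z T \<omega> - Z u \<omega>)\<^sup>2) = \<sigma>\<^sup>2 * (\<integral>z. (indicator {u<..T} (snd z) * \<epsilon> z)\<^sup>2 \<partial>P)"
proof -
  have i: "ito_pair (\<lambda>z. indicator {t..T} (snd z) * (\<sigma> * \<epsilon> z) - indicator {t..u} (snd z) * (\<sigma> * \<epsilon> z))
     (\<lambda>\<omega>. Z T \<omega> - Z u \<omega>)"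
    by (rule ito_pair_diff[OF Z[OF tT(2)] Z[OF u]])
  have eq: "indicator {t..T} (snd z) * (\<sigma> * \<epsilon> z) - indicator {t..u} (snd z) * (\<sigma> * \<epsilon> z) =
     \<sigma> * (indicator {u<..T} (snd z) * \<epsilon> z)" for z
    using u by (auto simp: indicator_def)
  from ito_pair_isometry[OF i i] show ?thesis
    unfolding eq by (simp add: power2_eq_square[symmetric] power_mult_distrib)
qed

lemma Z_square: "expectation (\<lambda>\<omega>. (Z T \<omega>)\<^sup>2) = \<sigma>\<^sup>2 * Q"
proof -
  have eq: "indicator {t..T} (snd z) * (\<sigma> * \<epsilon> z) = \<sigma> * \<epsilon> z" for z
    using eps_support[of "snd z" "fst z"] by (auto simp: indicator_def)
  from ito_pair_isometry[OF Z[OF tT(2)] Z[OF tT(2)]] show ?thesis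
    unfolding eq by (simp add: power2_eq_square[symmetric] power_mult_distrib Q_def)
qed

lemma AE_time_neq_start: "AE z in P. snd z \<noteq> t"
  by (rule prod.AE_pair_measure) (measurable, auto intro!: AE_lborel_singleton)

text \<open>Only the slice at time \<open>t\<close> could carry mass, and a single time is
  null.\<close>

lemma Q_eq_zero:
  assumes "c = t"
  shows "Q = 0"
proof -
  have "AE z in P. (\<epsilon> z)\<^sup>2 = 0"
    using AE_time_neq_start eps_zero
  proof eventually_elim
    case (elim z)
    then show ?case using eps_support[of "snd z" "fst z"] assms by (cases "snd z < t") auto
  qed
  then show ?thesis unfolding Q_def by (rule integral_eq_zero_AE)
qed

text \<open>\<open>W T - W t\<close> is the integral of the constant 1 over \<open>{t<..T}\<close>,
  so the bilinear isometry turns the covariance into the integral of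
  \<open>\<sigma> * \<epsilon>\<close>.\<close>

lemma Z_mult_increment: "expectation (\<lambda>\<omega>. (W T \<omega> - W t \<omega>) * Z T \<omega>) = \<sigma> * mean_eps"
proof -
  have ae: "AE z in P. indicator {t<..T} (snd z) * (indicator {t..T} (snd z) * (\<sigma> * \<epsilon> z)) = \<sigma> * \<epsilon> z"
    using AE_time_neq_start
  proof eventually_elim
    case (elim z)
    then show ?case using eps_support[of "snd z" "fst z"] by (auto simp: indicator_def)
  qed
  have "expectation (\<lambda>\<omega>. (W T \<omega> - W t \<omega>) * Z T \<omega>) =
      (\<integral>z. indicator {t<..T} (snd z) * (indicator {t..T} (snd z) * (\<sigma> * \<epsilon> z)) \<partial>P)"
    by (rule ito_pair_isometry[OF ito_pair_increment[OF times(1) tT(4)] Z[OF tT(2)]])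
  also have "\<dots> = (\<integral>z. \<sigma> * \<epsilon> z \<partial>P)" by (rule integral_cong_AE[OF _ _ ae]) measurable
  finally show ?thesis by (simp add: mean_eps_def)
qed

text \<open>Cauchy-Schwarz over \<open>{t..T}\<close> would give only the order
  \<open>sqrt (c - t) * sqrt Q\<close>. But \<open>U T\<close> agrees almost surely with
  \<open>U c\<close>, which is known at time \<open>c\<close>, so the increment after
  \<open>c\<close> contributes nothing, and the one over \<open>{t..c}\<close> brings a second
  factor \<open>sqrt (c - t)\<close>.\<close>

lemma increment_mult_U: "\<bar>expectation (\<lambda>\<omega>. (W T \<omega> - W t \<omega>) * U T \<omega>)\<bar> \<le> (c - t) * sqrt Q"
proof -
  note sU = sq_int_U[OF tT(3)]
  note mU = sq_int_measurable[OF sU] sq_int_measurable[OF sq_int_U[OF tT(2)]]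
  have adapted: "U c \<in> borel_measurable (F c)"
  proof -
    interpret lborel: sigma_finite_measure lborel by (rule lborel.sigma_finite_measure_axioms)
    have "(\<lambda>\<omega>. \<integral>v. (\<lambda>z. indicator {t..c} (snd z) * \<epsilon> z) (\<omega>, v) \<partial>lborel) \<in> borel_measurable (F c)"
      by (rule lborel.borel_measurable_lebesgue_integral) (use eps_adapted in \<open>simp add: case_prod_beta'\<close>)
    then show ?thesis by (simp add: U_def[abs_def])
  qed
  have Wm: "W T \<in> borel_measurable M" "W t \<in> borel_measurable M" using W_measurable times tT by auto
  have "expectation (\<lambda>\<omega>. (W T \<omega> - W t \<omega>) * U T \<omega>) = expectation (\<lambda>\<omega>. (W T \<omega> - W t \<omega>) * U c \<omega>)"
    using U_T_eq_U_c mU Wm by (intro integral_cong_AE) auto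
  also have "\<dots> = expectation (\<lambda>\<omega>. U c \<omega> * (W T \<omega> - W c \<omega>) + (W c \<omega> - W t \<omega>) * U c \<omega>)"
    by (intro Bochner_Integration.integral_cong) (auto simp: algebra_simps)
  also have "\<dots> = expectation (\<lambda>\<omega>. U c \<omega> * (W T \<omega> - W c \<omega>)) + expectation (\<lambda>\<omega>. (W c \<omega> - W t \<omega>) * U c \<omega>)"
    by (intro Bochner_Integration.integral_add integrable_mult_sq_int sU sq_int_increment tT times)
  also have "expectation (\<lambda>\<omega>. U c \<omega> * (W T \<omega> - W c \<omega>)) = 0"
    by (rule integral_mult_increment(2)[OF tT(6) times(3) adapted integrable_sq_int[OF sU]])
  finally have eq: "expectation (\<lambda>\<omega>. (W T \<omega> - W t \<omega>) * U T \<omega>) = expectation (\<lambda>\<omega>. (W c \<omega> - W t \<omega>) * U c \<omega>)"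
    by simp
  have "\<bar>expectation (\<lambda>\<omega>. (W c \<omega> - W t \<omega>) * U c \<omega>)\<bar> \<le> sqrt (c - t) * sqrt ((c - t) * Q)"
    using U_square expectation_increment_square[OF times(1,2)] times Q_nonneg
    by (intro abs_integral_mult_le sU sq_int_increment) auto
  then show ?thesis unfolding eq using times by (simp add: real_sqrt_mult mult.assoc[symmetric])
qed

lemma K_eq:
  assumes u: "u \<in> {t..T}"
  shows "AE \<omega> in M. K u \<omega> = m * U u \<omega> + Z u \<omega>"
proof -
  have "AE \<omega> in M. integrable lborel (\<lambda>v. indicator {t..u} v * \<epsilon> (\<omega>, v))"
    using u by (intro U_part(1)[of _ t u]) auto
  then show ?thesis using D_eq[OF u] AE_space
  proof eventually_elim
    case (elim \<omega>)
    have cont: "continuous_on {t..u} (\<lambda>v. D v \<omega>)"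
      using u by (intro continuous_on_subset[OF D_continuous[OF elim(3)]]) auto
    have si: "set_integrable lborel {t..u} (\<lambda>v. r * D v \<omega>)"
      by (intro borel_integrable_atLeastAtMost' continuous_intros cont)
    have si2: "set_integrable lborel {t..u} (\<lambda>v. m * \<epsilon> (\<omega>, v))"
      using elim(1) by (intro set_integrable_mult_right) (simp add: set_integrable_def)
    have "(LBINT v:{t..u}. r * D v \<omega> + m * \<epsilon> (\<omega>, v)) = (LBINT v:{t..u}. r * D v \<omega>) + (LBINT v:{t..u}. m * \<epsilon> (\<omega>, v))"
      by (rule set_integral_add(2)[OF si si2])
    also have "(LBINT v:{t..u}. r * D v \<omega>) = r * integral {t..u} (\<lambda>v. D v \<omega>)"
      using LBINT_Icc_eq_integral[OF cont] by simp
    also have "(LBINT v:{t..u}. m * \<epsilon> (\<omega>, v)) = m * U u \<omega>"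
      by (simp add: U_def set_lebesgue_integral_def)
    finally show ?case using elim(2) by (simp add: K_def)
  qed
qed

lemma K_continuous: "\<omega> \<in> space M \<Longrightarrow> continuous_on {t..T} (\<lambda>u. K u \<omega>)"
  unfolding K_def
  by (intro continuous_intros D_continuous indefinite_integral_continuous_1 integrable_continuous_interval)

lemma K_measurable:
  assumes u: "u \<in> {t..T}" shows "K u \<in> borel_measurable M"
proof -
  let ?g = "\<lambda>z. indicator {t..u} (snd z) * D (snd z) (fst z)"
  have "?g \<in> borel_measurable P"
    using u by (intro continuous_process_joint_measurable D_measurable continuous_on_subset[OF D_continuous]) auto
  then have m: "(\<lambda>\<omega>. \<integral>v. ?g (\<omega>, v) \<partial>lborel) \<in> borel_measurable M"
    by (intro lborel.borel_measurable_lebesgue_integral) simp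
  have "(\<lambda>\<omega>. integral {t..u} (\<lambda>v. D v \<omega>)) \<in> borel_measurable M"
  proof (subst measurable_cong[where g = "\<lambda>\<omega>. \<integral>v. ?g (\<omega>, v) \<partial>lborel"])
    show "(\<lambda>\<omega>. \<integral>v. ?g (\<omega>, v) \<partial>lborel) \<in> borel_measurable M" by (rule m)
    show "integral {t..u} (\<lambda>v. D v \<omega>) = (\<integral>v. ?g (\<omega>, v) \<partial>lborel)" if "\<omega> \<in> space M" for \<omega>
      using LBINT_Icc_eq_integral[OF continuous_on_subset[OF D_continuous[OF that], of "{t..u}"]] u
      by (simp add: set_lebesgue_integral_def)
  qed
  then show ?thesis unfolding K_def[abs_def] using D_measurable[OF u] by simp
qed

text \<open>The bound sees only the part of \<open>\<epsilon>\<close> after \<open>u\<close>, which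
  is null for \<open>u \<ge> c\<close>.\<close>

lemma K_diff:
  assumes u: "u \<in> {t..T}"
  shows "sq_int M (\<lambda>\<omega>. K u \<omega> - K T \<omega>)"
    and "expectation (\<lambda>\<omega>. (K u \<omega> - K T \<omega>)\<^sup>2) \<le>
      2 * (m\<^sup>2 * (T - t) + \<sigma>\<^sup>2) * (\<integral>z. (indicator {u<..T} (snd z) * \<epsilon> z)\<^sup>2 \<partial>P)"
proof -
  let ?q = "\<integral>z. (indicator {u<..T} (snd z) * \<epsilon> z)\<^sup>2 \<partial>P"
  let ?V = "\<lambda>\<omega>. \<integral>v. indicator {u<..T} v * \<epsilon> (\<omega>, v) \<partial>lborel"
  let ?R = "\<lambda>\<omega>. m * ?V \<omega> + (Z T \<omega> - Z u \<omega>)"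
  have sV: "sq_int M (\<lambda>\<omega>. m * ?V \<omega>)" using u by (intro sq_int_cmult U_part(2)[of _ u T]) auto
  have sZ: "sq_int M (\<lambda>\<omega>. Z T \<omega> - Z u \<omega>)" by (intro sq_int_diff sq_int_Z u tT)
  have sR: "sq_int M ?R" by (intro sq_int_add sV sZ)
  have ae: "AE \<omega> in M. K u \<omega> - K T \<omega> = - 1 * ?R \<omega>"
    using K_eq[OF u] K_eq[OF tT(2)] U_diff[OF u]
  proof eventually_elim
    case (elim \<omega>)
    show ?case unfolding elim(1,2) elim(3)[symmetric] by (simp add: algebra_simps)
  qed
  show "sq_int M (\<lambda>\<omega>. K u \<omega> - K T \<omega>)"
    by (rule sq_int_AE_cong[OF sq_int_cmult[OF sR] _ ae]) (use K_measurable u tT in auto)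
  have ae2: "AE \<omega> in M. (K u \<omega> - K T \<omega>)\<^sup>2 = (?R \<omega>)\<^sup>2"
    using ae by eventually_elim (simp only: power_mult_distrib, simp)
  have q0: "0 \<le> ?q" by (intro integral_nonneg_AE) auto
  have "expectation (\<lambda>\<omega>. (K u \<omega> - K T \<omega>)\<^sup>2) = expectation (\<lambda>\<omega>. (?R \<omega>)\<^sup>2)"
    using sq_int_measurable[OF sR] K_measurable[OF u] K_measurable[OF tT(2)] by (intro integral_cong_AE ae2) auto
  also have "\<dots> \<le> 2 * expectation (\<lambda>\<omega>. (m * ?V \<omega>)\<^sup>2) + 2 * expectation (\<lambda>\<omega>. (Z T \<omega> - Z u \<omega>)\<^sup>2)"
    by (rule integral_square_add_le[OF sV sZ])
  also have "expectation (\<lambda>\<omega>. (m * ?V \<omega>)\<^sup>2) = m\<^sup>2 * expectation (\<lambda>\<omega>. (?V \<omega>)\<^sup>2)"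
    by (simp add: power_mult_distrib)
  also have "\<dots> \<le> m\<^sup>2 * ((T - t) * ?q)"
  proof (rule mult_left_mono)
    have "expectation (\<lambda>\<omega>. (?V \<omega>)\<^sup>2) \<le> (T - u) * ?q" using u by (intro U_part(4)) auto
    also have "\<dots> \<le> (T - t) * ?q" using u q0 by (intro mult_right_mono) auto
    finally show "expectation (\<lambda>\<omega>. (?V \<omega>)\<^sup>2) \<le> (T - t) * ?q" .
  qed simp
  finally show "expectation (\<lambda>\<omega>. (K u \<omega> - K T \<omega>)\<^sup>2) \<le> 2 * (m\<^sup>2 * (T - t) + \<sigma>\<^sup>2) * ?q"
    using Z_diff_square[OF u] by (simp add: algebra_simps)
qed

lemma D_decomp:
  assumes "\<omega> \<in> space M"
  shows "D T \<omega> = A * K T \<omega> + Rem \<omega>"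
  unfolding A_def Rem_def
  by (rule volterra_resolvent[OF tT(4) D_continuous[OF assms]]) (simp add: K_def)

text \<open>The square of \<open>C1\<close> is a factor 2 from cutting the remainder at
  \<open>c\<close>, times \<open>2 * (m\<^sup>2 * (T - t) + \<sigma>\<^sup>2)\<close> from
  \<open>K_diff\<close>, times the bound \<open>(r * A)\<^sup>2\<close> on the squared
  kernel.\<close>

definition "C1 = sqrt (4 * (r * A)\<^sup>2 * (m\<^sup>2 * (T - t) + \<sigma>\<^sup>2))"

lemma C1_nonneg: "0 \<le> C1" unfolding C1_def using tT by (intro real_sqrt_ge_zero) auto

text \<open>On \<open>{c..T}\<close> the integrand vanishes in mean square, so only an interval of
  length \<open>c - t\<close> counts; this is what makes the remainder of first order in
  \<open>c - t\<close>.\<close>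

lemma Rem_bound: "sq_int M Rem" "expectation (\<lambda>\<omega>. (Rem \<omega>)\<^sup>2) \<le> (C1 * (c - t) * sqrt Q)\<^sup>2"
proof -
  let ?Y = "\<lambda>v \<omega>. r * exp (r * (T - v)) * (K v \<omega> - K T \<omega>)"
  let ?B = "2 * (m\<^sup>2 * (T - t) + \<sigma>\<^sup>2)"
  have B0: "0 \<le> ?B" using tT by simp
  have cont: "continuous_on {t..T} (\<lambda>v. ?Y v \<omega>)" if "\<omega> \<in> space M" for \<omega>
    by (intro continuous_intros K_continuous that)
  have cont1: "continuous_on {t..c} (\<lambda>v. ?Y v \<omega>)" and cont2: "continuous_on {c..T} (\<lambda>v. ?Y v \<omega>)"
    if "\<omega> \<in> space M" for \<omega>
    using times by (auto intro!: continuous_on_subset[OF cont[OF that]])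
  have sY: "sq_int M (?Y v)" if "v \<in> {t..T}" for v by (rule sq_int_cmult[OF K_diff(1)[OF that]])
  have Y2: "expectation (\<lambda>\<omega>. (?Y v \<omega>)\<^sup>2) \<le> (r * A)\<^sup>2 * (?B * (\<integral>z. (indicator {v<..T} (snd z) * \<epsilon> z)\<^sup>2 \<partial>P))"
    if v: "v \<in> {t..T}" for v
  proof -
    have "exp (r * (T - v)) \<le> A" using v r0 by (simp add: A_def mult_left_mono)
    then have "r * exp (r * (T - v)) \<le> r * A" using r0 by (intro mult_left_mono)
    then have "(r * exp (r * (T - v)))\<^sup>2 \<le> (r * A)\<^sup>2" using r0 by (intro power_mono) auto
    moreover have "expectation (\<lambda>\<omega>. (?Y v \<omega>)\<^sup>2) = (r * exp (r * (T - v)))\<^sup>2 * expectation (\<lambda>\<omega>. (K v \<omega> - K T \<omega>)\<^sup>2)"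
      by (simp add: power_mult_distrib[of "r * exp (r * (T - v))"])
    ultimately show ?thesis using K_diff(2)[OF v] by (auto intro!: mult_mono integral_nonneg_AE)
  qed
  have 1: "expectation (\<lambda>\<omega>. (?Y v \<omega>)\<^sup>2) \<le> (r * A)\<^sup>2 * (?B * Q)" if v: "v \<in> {t..c}" for v
    using v times B0 by (intro order_trans[OF Y2] mult_left_mono sq_int_eps_part(2)) auto
  have 2: "expectation (\<lambda>\<omega>. (?Y v \<omega>)\<^sup>2) \<le> 0" if v: "v \<in> {c..T}" for v
    using v times Y2[of v] eps_part_zero[of "{v<..T}"] by auto
  have s1: "sq_int M (?Y v)" if "v \<in> {t..c}" for v using that times by (intro sY) auto
  have s2: "sq_int M (?Y v)" if "v \<in> {c..T}" for v using that times by (intro sY) auto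
  note p1 = sq_int_LBINT_process[OF times(2) cont1 s1 1]
  note p2 = sq_int_LBINT_process[OF times(3) cont2 s2 2]
  have split: "Rem \<omega> = (LBINT v:{t..c}. ?Y v \<omega>) + (LBINT v:{c..T}. ?Y v \<omega>)" if "\<omega> \<in> space M" for \<omega>
    unfolding Rem_def LBINT_Icc_eq_integral[OF cont[OF that]] LBINT_Icc_eq_integral[OF cont1[OF that]]
      LBINT_Icc_eq_integral[OF cont2[OF that]]
    by (intro Henstock_Kurzweil_Integration.integral_combine[symmetric] times integrable_continuous_interval cont that)
  have sR: "sq_int M (\<lambda>\<omega>. (LBINT v:{t..c}. ?Y v \<omega>) + (LBINT v:{c..T}. ?Y v \<omega>))"
    by (intro sq_int_add p1 p2)
  have mR: "Rem \<in> borel_measurable M"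
    by (subst measurable_cong[OF split]) (auto intro: sq_int_measurable[OF sR])
  show "sq_int M Rem" by (rule sq_int_AE_cong[OF sR mR]) (use split in auto)
  have "expectation (\<lambda>\<omega>. (Rem \<omega>)\<^sup>2) = expectation (\<lambda>\<omega>. ((LBINT v:{t..c}. ?Y v \<omega>) + (LBINT v:{c..T}. ?Y v \<omega>))\<^sup>2)"
    by (intro Bochner_Integration.integral_cong) (auto simp: split)
  also have "\<dots> \<le> 2 * expectation (\<lambda>\<omega>. (LBINT v:{t..c}. ?Y v \<omega>)\<^sup>2) + 2 * expectation (\<lambda>\<omega>. (LBINT v:{c..T}. ?Y v \<omega>)\<^sup>2)"
    by (rule integral_square_add_le[OF p1(1) p2(1)])
  also have "\<dots> \<le> 2 * ((c - t)\<^sup>2 * ((r * A)\<^sup>2 * (?B * Q))) + 2 * ((T - c)\<^sup>2 * 0)"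
    by (intro add_mono mult_left_mono p1 p2) auto
  also have "\<dots> = (C1 * (c - t) * sqrt Q)\<^sup>2"
    unfolding C1_def using Q_nonneg B0 by (simp add: power_mult_distrib)
  finally show "expectation (\<lambda>\<omega>. (Rem \<omega>)\<^sup>2) \<le> (C1 * (c - t) * sqrt Q)\<^sup>2" .
qed

section \<open>Mean, covariance and variance of the terminal deviation\<close>

lemma D_T_eq: "AE \<omega> in M. D T \<omega> = A * m * U T \<omega> + A * Z T \<omega> + Rem \<omega>"
  using K_eq[OF tT(2)] AE_space by eventually_elim (simp add: D_decomp algebra_simps)

lemma sq_int_parts: "sq_int M (\<lambda>\<omega>. A * m * U T \<omega>)" "sq_int M (\<lambda>\<omega>. A * Z T \<omega>)"
  "sq_int M (\<lambda>\<omega>. A * m * U T \<omega> + A * Z T \<omega> + Rem \<omega>)"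
  by (intro sq_int_add sq_int_cmult sq_int_U sq_int_Z Rem_bound tT)+

lemma sq_int_D: "sq_int M (D T)"
  by (rule sq_int_AE_cong[OF sq_int_parts(3) D_measurable[OF tT(2)] D_T_eq])

lemma D_expectation: "\<bar>expectation (D T) - A * m * mean_eps\<bar> \<le> C1 * (c - t) * sqrt Q"
proof -
  have "expectation (D T) = expectation (\<lambda>\<omega>. A * m * U T \<omega> + A * Z T \<omega> + Rem \<omega>)"
    using D_T_eq sq_int_measurable[OF sq_int_parts(3)] D_measurable[OF tT(2)] by (intro integral_cong_AE)
  also have "\<dots> = A * m * expectation (U T) + A * expectation (Z T) + expectation Rem"
    using sq_int_parts Rem_bound(1) sq_int_U[OF tT(2)] sq_int_Z[OF tT(2)]
    by (simp add: integrable_sq_int sq_int_add)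
  also have "\<dots> = A * m * mean_eps + expectation Rem"
    using expectation_U ito_pair_expectation[OF Z[OF tT(2)]] by simp
  finally have "expectation (D T) - A * m * mean_eps = expectation (\<lambda>\<omega>. Rem \<omega> * 1)" by simp
  moreover have "\<bar>expectation (\<lambda>\<omega>. Rem \<omega> * 1)\<bar> \<le> (C1 * (c - t) * sqrt Q) * 1"
    using Rem_bound C1_nonneg times Q_nonneg prob_space by (intro abs_integral_mult_le sq_int_const) auto
  ultimately show ?thesis by simp
qed

text \<open>The noise gives the main term. The drift part is only of order
  \<open>sqrt (c - t) * sqrt Q\<close> in mean square and needs \<open>increment_mult_U\<close>; for
  \<open>Rem\<close> Cauchy-Schwarz suffices.\<close>

lemma D_mult_increment:
  "\<bar>expectation (\<lambda>\<omega>. (W T \<omega> - W t \<omega>) * D T \<omega>) - A * \<sigma> * mean_eps\<bar>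
     \<le> (A * \<bar>m\<bar> + sqrt (T - t) * C1) * (c - t) * sqrt Q"
proof -
  let ?w = "\<lambda>\<omega>. W T \<omega> - W t \<omega>"
  have sw: "sq_int M ?w" by (rule sq_int_increment[OF times(1) tT(4)])
  have i: "integrable M (\<lambda>\<omega>. ?w \<omega> * U T \<omega>)" "integrable M (\<lambda>\<omega>. ?w \<omega> * Z T \<omega>)" "integrable M (\<lambda>\<omega>. ?w \<omega> * Rem \<omega>)"
    by (intro integrable_mult_sq_int sw sq_int_U sq_int_Z Rem_bound tT)+
  have "expectation (\<lambda>\<omega>. ?w \<omega> * D T \<omega>) =
     expectation (\<lambda>\<omega>. A * m * (?w \<omega> * U T \<omega>) + A * (?w \<omega> * Z T \<omega>) + ?w \<omega> * Rem \<omega>)"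
  proof (rule integral_cong_AE)
    show "AE \<omega> in M. ?w \<omega> * D T \<omega> = A * m * (?w \<omega> * U T \<omega>) + A * (?w \<omega> * Z T \<omega>) + ?w \<omega> * Rem \<omega>"
      using D_T_eq by eventually_elim (simp add: algebra_simps)
    show "(\<lambda>\<omega>. ?w \<omega> * D T \<omega>) \<in> borel_measurable M"
      by (intro borel_measurable_times sq_int_measurable[OF sw] sq_int_measurable[OF sq_int_D])
    show "(\<lambda>\<omega>. A * m * (?w \<omega> * U T \<omega>) + A * (?w \<omega> * Z T \<omega>) + ?w \<omega> * Rem \<omega>) \<in> borel_measurable M"
      by (intro borel_measurable_add borel_measurable_times borel_measurable_const sq_int_measurable[OF sw]
          sq_int_measurable[OF sq_int_U[OF tT(2)]] sq_int_measurable[OF sq_int_Z[OF tT(2)]]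
          sq_int_measurable[OF Rem_bound(1)])
  qed
  also have "\<dots> = A * m * expectation (\<lambda>\<omega>. ?w \<omega> * U T \<omega>) + A * expectation (\<lambda>\<omega>. ?w \<omega> * Z T \<omega>) + expectation (\<lambda>\<omega>. ?w \<omega> * Rem \<omega>)"
    using i by simp
  finally have eq: "expectation (\<lambda>\<omega>. ?w \<omega> * D T \<omega>) - A * \<sigma> * mean_eps =
     A * m * expectation (\<lambda>\<omega>. ?w \<omega> * U T \<omega>) + expectation (\<lambda>\<omega>. ?w \<omega> * Rem \<omega>)"
    using Z_mult_increment by simp
  have "\<bar>expectation (\<lambda>\<omega>. ?w \<omega> * Rem \<omega>)\<bar> \<le> sqrt (T - t) * (C1 * (c - t) * sqrt Q)"
    using Rem_bound C1_nonneg times Q_nonneg expectation_increment_square[OF times(1) tT(4)] tT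
    by (intro abs_integral_mult_le sw) auto
  moreover have "\<bar>A * m * expectation (\<lambda>\<omega>. ?w \<omega> * U T \<omega>)\<bar> \<le> (A * \<bar>m\<bar>) * ((c - t) * sqrt Q)"
    using increment_mult_U A_ge1 by (auto simp: abs_mult intro!: mult_left_mono)
  ultimately show ?thesis unfolding eq by (simp add: algebra_simps)
qed

text \<open>The inequality \<open>x\<^sup>2 / 2 - y\<^sup>2 \<le> (x + y)\<^sup>2\<close> separates
  the noise from the centred rest \<open>y'\<close>, which avoids their covariance at the price of a
  factor 1/2. The noise has variance \<open>A\<^sup>2 * \<sigma>\<^sup>2 * Q\<close>, and
  \<open>A \<ge> 1\<close>.\<close>

lemma D_variance:
  "variance (D T) \<ge> \<sigma>\<^sup>2 * Q / 2 - 2 * (A\<^sup>2 * m\<^sup>2 * (c - t) + C1\<^sup>2 * (c - t)\<^sup>2) * Q"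
proof -
  define y where "y \<omega> = A * m * U T \<omega> + Rem \<omega>" for \<omega>
  define y' where "y' \<omega> = y \<omega> - expectation y" for \<omega>
  have sy: "sq_int M y" unfolding y_def[abs_def] by (intro sq_int_add sq_int_parts Rem_bound)
  have sy': "sq_int M y'" unfolding y'_def[abs_def] by (intro sq_int_diff sy sq_int_const)
  have iy: "integrable M y" and iZ: "integrable M (\<lambda>\<omega>. A * Z T \<omega>)"
    by (intro integrable_sq_int sy sq_int_parts)+
  have "AE \<omega> in M. D T \<omega> = A * Z T \<omega> + y \<omega>" using D_T_eq by eventually_elim (simp add: y_def)
  then have "expectation (D T) = expectation (\<lambda>\<omega>. A * Z T \<omega> + y \<omega>)"
    using sq_int_measurable[OF sq_int_D] sq_int_measurable[OF sq_int_add[OF sq_int_parts(2) sy]]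
    by (intro integral_cong_AE)
  also have "\<dots> = expectation y"
    using iy iZ ito_pair_expectation[OF Z[OF tT(2)]] by simp
  finally have ED: "expectation (D T) = expectation y" .
  have ae: "AE \<omega> in M. D T \<omega> - expectation (D T) = A * Z T \<omega> + y' \<omega>"
    using D_T_eq by eventually_elim (simp add: y_def y'_def ED)
  have "variance y \<le> expectation (\<lambda>\<omega>. (y \<omega>)\<^sup>2)"
    using variance_eq[OF iy sq_int_integrable[OF sy]] by simp
  also have "\<dots> \<le> 2 * expectation (\<lambda>\<omega>. (A * m * U T \<omega>)\<^sup>2) + 2 * expectation (\<lambda>\<omega>. (Rem \<omega>)\<^sup>2)"
    unfolding y_def by (rule integral_square_add_le[OF sq_int_parts(1) Rem_bound(1)])
  also have "expectation (\<lambda>\<omega>. (A * m * U T \<omega>)\<^sup>2) = (A * m)\<^sup>2 * expectation (\<lambda>\<omega>. (U T \<omega>)\<^sup>2)"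
    by (simp add: power_mult_distrib[of "A * m"])
  also have "expectation (\<lambda>\<omega>. (U T \<omega>)\<^sup>2) = expectation (\<lambda>\<omega>. (U c \<omega>)\<^sup>2)"
    using U_T_eq_U_c sq_int_measurable[OF sq_int_U[OF tT(2)]] sq_int_measurable[OF sq_int_U[OF tT(3)]]
    by (intro integral_cong_AE) auto
  also have "2 * ((A * m)\<^sup>2 * expectation (\<lambda>\<omega>. (U c \<omega>)\<^sup>2)) + 2 * expectation (\<lambda>\<omega>. (Rem \<omega>)\<^sup>2) \<le>
      2 * ((A * m)\<^sup>2 * ((c - t) * Q)) + 2 * (C1 * (c - t) * sqrt Q)\<^sup>2"
    by (intro add_mono mult_left_mono U_square Rem_bound) auto
  also have "\<dots> = 2 * (A\<^sup>2 * m\<^sup>2 * (c - t) + C1\<^sup>2 * (c - t)\<^sup>2) * Q"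
    using Q_nonneg by (simp only: power_mult_distrib real_sqrt_pow2) (simp add: algebra_simps)
  finally have vy: "expectation (\<lambda>\<omega>. (y' \<omega>)\<^sup>2) \<le> 2 * (A\<^sup>2 * m\<^sup>2 * (c - t) + C1\<^sup>2 * (c - t)\<^sup>2) * Q"
    by (simp add: y'_def)
  have sD: "sq_int M (\<lambda>\<omega>. D T \<omega> - expectation (D T))" by (intro sq_int_diff sq_int_D sq_int_const)
  have sp: "x\<^sup>2 / 2 - y\<^sup>2 \<le> (x + y)\<^sup>2" for x y :: real
    using square_add_le[of "x + y" "- y"] by simp
  have "expectation (\<lambda>\<omega>. (A * Z T \<omega>)\<^sup>2 / 2 - (y' \<omega>)\<^sup>2) \<le> variance (D T)"
  proof (rule integral_mono_AE)
    show "integrable M (\<lambda>\<omega>. (A * Z T \<omega>)\<^sup>2 / 2 - (y' \<omega>)\<^sup>2)"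
      using sq_int_integrable[OF sq_int_parts(2)] sq_int_integrable[OF sy'] by simp
    show "integrable M (\<lambda>\<omega>. (D T \<omega> - expectation (D T))\<^sup>2)" by (rule sq_int_integrable[OF sD])
    show "AE \<omega> in M. (A * Z T \<omega>)\<^sup>2 / 2 - (y' \<omega>)\<^sup>2 \<le> (D T \<omega> - expectation (D T))\<^sup>2"
      using ae by eventually_elim (simp only: sp)
  qed
  moreover have "expectation (\<lambda>\<omega>. (A * Z T \<omega>)\<^sup>2 / 2 - (y' \<omega>)\<^sup>2) = A\<^sup>2 * (\<sigma>\<^sup>2 * Q) / 2 - expectation (\<lambda>\<omega>. (y' \<omega>)\<^sup>2)"
    using sq_int_integrable[OF sq_int_parts(2)] sq_int_integrable[OF sy'] Z_square sq_int_integrable[OF sq_int_Z[OF tT(2)]]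
    by (simp add: power_mult_distrib)
  moreover have "\<sigma>\<^sup>2 * Q \<le> A\<^sup>2 * (\<sigma>\<^sup>2 * Q)"
    using A_ge1 Q_nonneg by (intro mult_right_mono[of 1 "A\<^sup>2" "\<sigma>\<^sup>2 * Q", simplified]) auto
  ultimately show ?thesis using vy by linarith
qed

text \<open>Uniqueness of wealth processes: for a deviation that ends at once, \<open>Q = 0\<close>
  annihilates the drift, the noise and the remainder.\<close>

lemma D_zero:
  assumes "c = t"
  shows "AE \<omega> in M. D T \<omega> = 0"
proof -
  note Q0 = Q_eq_zero[OF assms]
  have zero: "AE \<omega> in M. f \<omega> = 0" if "sq_int M f" "expectation (\<lambda>\<omega>. (f \<omega>)\<^sup>2) \<le> 0" for f :: "'a \<Rightarrow> real"
  proof -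
    have "AE \<omega> in M. (f \<omega>)\<^sup>2 = 0"
      using that by (subst integral_nonneg_eq_0_iff_AE[symmetric])
        (auto simp: sq_int_def intro!: antisym integral_nonneg_AE)
    then show ?thesis by simp
  qed
  have "AE \<omega> in M. U c \<omega> = 0" by (rule zero[OF sq_int_U[OF tT(3)]]) (use U_square Q0 in simp)
  moreover have "AE \<omega> in M. Z T \<omega> = 0" by (rule zero[OF sq_int_Z[OF tT(2)]]) (use Z_square Q0 in simp)
  moreover have "AE \<omega> in M. Rem \<omega> = 0" by (rule zero[OF Rem_bound(1)]) (use Rem_bound(2) Q0 in simp)
  ultimately show ?thesis using D_T_eq U_T_eq_U_c by eventually_elim simp
qed

end

subsection \<open>The mean-variance game\<close>

lemma borel_measurable_vec_nth:
  fixes X :: "'a \<Rightarrow> real ^ 'n::finite"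
  assumes "X \<in> borel_measurable N"
  shows "(\<lambda>\<omega>. X \<omega> $ i) \<in> borel_measurable N"
  by (rule measurable_compose[OF assms borel_measurable_continuous_onI]) (intro continuous_intros)

lemma borel_measurable_vec_lambda:
  fixes f :: "'n::finite \<Rightarrow> 'a \<Rightarrow> real"
  assumes "\<And>i. f i \<in> borel_measurable N"
  shows "(\<lambda>\<omega>. \<chi> i. f i \<omega>) \<in> borel_measurable N"
proof (subst borel_measurable_euclidean_space, intro ballI)
  fix b :: "real ^ 'n" assume "b \<in> Basis"
  then obtain i where "b = axis i 1" by (auto simp: Basis_vec_def)
  then show "(\<lambda>\<omega>. (\<chi> i. f i \<omega>) \<bullet> b) \<in> borel_measurable N"
    using assms[of i] by (simp add: inner_axis)
qed

locale mean_variance_market = brownian_basis M F W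
  for M :: "'a measure" and F W +
  fixes T r \<sigma> \<mu> :: real and \<gamma> lM lV :: "'n::finite \<Rightarrow> real"
  assumes T_pos: "T > 0" and r_nonneg: "r \<ge> 0" and \<sigma>_pos: "\<sigma> > 0"
    and \<gamma>_pos: "\<And>i. \<gamma> i > 0" and lM: "\<And>i. lM i \<in> {0..<1}" and lV: "\<And>i. lV i \<in> {0..<1}"
begin

section \<open>Equilibrium amounts and the wealth they generate\<close>

abbreviation "amount \<equiv> equilibrium_amount r \<mu> \<sigma> T \<gamma> lM lV"

text \<open>The amount held at time \<open>T\<close>; the earlier amounts are its discounted
  values.\<close>

definition coef :: "'n \<Rightarrow> real" where
  "coef i = (\<mu> - r) / \<sigma>\<^sup>2 * (kappa \<gamma> lM lV i + lV i / (1 - avg lV) * avg (kappa \<gamma> lM lV))"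

lemma amount_eq: "amount i v = exp (- r * (T - v)) * coef i"
  by (simp add: equilibrium_amount_def coef_def)

lemma amount_deriv: "((\<lambda>v. amount i v) has_real_derivative r * amount i v) (at v)"
  unfolding amount_eq by (auto intro!: derivative_eq_intros)

lemma amount_continuous: "continuous_on S (amount i)"
  unfolding amount_eq[abs_def] by (intro continuous_intros)

lemma amount_measurable [measurable]: "amount i \<in> borel_measurable borel"
  by (rule borel_measurable_continuous_onI[OF amount_continuous])

lemma amount_admissible:
  assumes "t \<in> {0..T}"
  shows "(\<lambda>u \<omega>. amount i u) \<in> admissible M G t T"
proof -
  have "progressively_measurable G t T (\<lambda>u \<omega>. amount i u)"
    unfolding progressively_measurable_def
  proof
    fix u assume "u \<in> {t..T}"
    have "amount i \<in> borel_measurable (restrict_space borel {t..u})" by (rule measurable_restrict_space1) measurable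
    from measurable_compose[OF measurable_fst this]
    show "(\<lambda>(v, \<omega>). amount i v) \<in> borel_measurable (restrict_space borel {t..u} \<Otimes>\<^sub>M G u)"
      by (simp add: case_prod_beta')
  qed
  moreover have "(\<integral>\<^sup>+\<omega>. (\<integral>\<^sup>+u\<in>{t..T}. ennreal ((amount i u)\<^sup>2) \<partial>lborel) \<partial>M) < \<infinity>"
  proof -
    have "(\<integral>\<^sup>+u\<in>{t..T}. ennreal ((amount i u)\<^sup>2) \<partial>lborel) \<le> (\<integral>\<^sup>+u. ennreal ((coef i)\<^sup>2) * indicator {t..T} u \<partial>lborel)"
    proof (rule nn_integral_mono)
      fix u
      have "(amount i u)\<^sup>2 \<le> (coef i)\<^sup>2" if "u \<le> T"
        using that r_nonneg by (auto simp: amount_eq power_mult_distrib intro!: mult_left_le_one_le power_le_one)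
      then show "ennreal ((amount i u)\<^sup>2) * indicator {t..T} u \<le> ennreal ((coef i)\<^sup>2) * indicator {t..T} u"
        by (auto simp: indicator_def intro!: ennreal_leI)
    qed
    also have "\<dots> < \<infinity>"
      using assms by (simp add: nn_integral_cmult ennreal_mult_less_top)
    finally show ?thesis by (simp add: emeasure_space_1)
  qed
  ultimately show ?thesis by (simp add: admissible_def)
qed

text \<open>Since \<open>amount i\<close> itself solves \<open>y' = r * y\<close>, variation of
  constants collapses to a product, and at time \<open>T\<close> the wealth is affine in
  \<open>W T - W t\<close> with slope \<open>\<sigma> * coef i\<close>.\<close>

definition explicit_wealth :: "real \<Rightarrow> real^'n \<Rightarrow> real \<Rightarrow> 'a \<Rightarrow> real^'n" where
  "explicit_wealth t x u \<omega> =
     (\<chi> i. exp (r * (u - t)) * x $ i + amount i u * ((\<mu> - r) * (u - t) + \<sigma> * (W u \<omega> - W t \<omega>)))"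

lemma explicit_wealth_process:
  assumes t: "t \<in> {0..T}"
  shows "wealth_process M F W r \<mu> \<sigma> T t x (\<lambda>i v \<omega>. amount i v) (explicit_wealth t x)"
  unfolding wealth_process_def
proof (intro conjI ballI allI AE_I2)
  fix u assume "u \<in> {t..T}"
  then show "explicit_wealth t x u \<in> borel_measurable (F u)"
    unfolding explicit_wealth_def[abs_def] using t W_measurable_F[of u u] W_measurable_F[of t u]
    by (intro borel_measurable_vec_lambda) auto
next
  fix \<omega> assume "\<omega> \<in> space M"
  then show "continuous_on {t..T} (\<lambda>u. explicit_wealth t x u \<omega>)"
    unfolding explicit_wealth_def using t
    by (intro continuous_intros amount_continuous W_continuous_increment) auto
next
  fix \<omega> show "explicit_wealth t x t \<omega> = x" by (simp add: explicit_wealth_def vec_eq_iff)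
next
  fix i u assume u: "u \<in> {t..T}"
  let ?g = "\<lambda>v. amount i v * \<sigma>" and ?g' = "\<lambda>v. r * amount i v * \<sigma>"
  \<comment> \<open>The integrated-by-parts form of the stochastic integral: its time integral
    cancels the interest earned on the Brownian part of the wealth, and the equation holds on every
    path.\<close>
  define Z where "Z \<omega> = ?g u * (W u \<omega> - W t \<omega>) - (LBINT v:{t..u}. ?g' v * (W v \<omega> - W t \<omega>))" for \<omega>
  have "has_ito_integral M F W t u (\<lambda>v \<omega>. ?g v) Z"
    unfolding Z_def[abs_def] using t u
    by (intro has_ito_integral_deterministic DERIV_cmult_right amount_deriv continuous_intros amount_continuous) auto
  moreover have "AE \<omega> in M. explicit_wealth t x u \<omega> $ i =
      x $ i + (LBINT v:{t..u}. r * explicit_wealth t x v \<omega> $ i + amount i v * (\<mu> - r)) + Z \<omega>"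
  proof (intro AE_I2)
    fix \<omega> assume \<omega>: "\<omega> \<in> space M"
    have cW: "continuous_on {t..u} (\<lambda>v. W v \<omega>)" using t by (intro W_continuous_increment \<omega>) auto
    let ?p = "\<lambda>v. exp (r * (v - t)) * x $ i + amount i v * ((\<mu> - r) * (v - t))"
    let ?q = "\<lambda>v. r * ?p v + amount i v * (\<mu> - r)"
    have "(?p has_real_derivative ?q v) (at v)" for v
      by (rule derivative_eq_intros amount_deriv refl)+ (simp add: algebra_simps)
    then have "(?q has_integral ?p u - ?p t) {t..u}"
      using u by (intro fundamental_theorem_of_calculus)
        (auto intro: DERIV_subset simp: has_real_derivative_iff_has_vector_derivative[symmetric])
    then have q: "integral {t..u} ?q = ?p u - x $ i" by (intro integral_unique) simp
    have "(LBINT v:{t..u}. r * explicit_wealth t x v \<omega> $ i + amount i v * (\<mu> - r)) =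
        integral {t..u} (\<lambda>v. r * explicit_wealth t x v \<omega> $ i + amount i v * (\<mu> - r))"
      unfolding explicit_wealth_def vec_lambda_beta
      by (intro LBINT_Icc_eq_integral continuous_intros amount_continuous cW)
    also have "\<dots> = integral {t..u} (\<lambda>v. ?q v + ?g' v * (W v \<omega> - W t \<omega>))"
      by (intro integral_cong) (simp add: explicit_wealth_def algebra_simps)
    also have "\<dots> = integral {t..u} ?q + integral {t..u} (\<lambda>v. ?g' v * (W v \<omega> - W t \<omega>))"
      by (intro Henstock_Kurzweil_Integration.integral_add integrable_continuous_interval continuous_intros
          amount_continuous cW)
    also have "integral {t..u} (\<lambda>v. ?g' v * (W v \<omega> - W t \<omega>)) = (LBINT v:{t..u}. ?g' v * (W v \<omega> - W t \<omega>))"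
      by (intro LBINT_Icc_eq_integral[symmetric] continuous_intros amount_continuous cW)
    finally show "explicit_wealth t x u \<omega> $ i =
      x $ i + (LBINT v:{t..u}. r * explicit_wealth t x v \<omega> $ i + amount i v * (\<mu> - r)) + Z \<omega>"
      unfolding q Z_def by (simp add: explicit_wealth_def algebra_simps)
  qed
  ultimately show "\<exists>Z. has_ito_integral M F W t u (\<lambda>v \<omega>. amount i v * \<sigma>) Z \<and>
      (AE \<omega> in M. explicit_wealth t x u \<omega> $ i =
        x $ i + (LBINT v:{t..u}. r * explicit_wealth t x v \<omega> $ i + amount i v * (\<mu> - r)) + Z \<omega>)"
    by blast
qed

lemma amount_markov_strategy: "markov_strategy M F W G r \<mu> \<sigma> T (\<lambda>i u x. amount i u)"
  unfolding markov_strategy_def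
proof (intro conjI allI ballI)
  fix i
  have "amount i \<in> borel_measurable (restrict_space borel {0..T})" by (rule measurable_restrict_space1) measurable
  from measurable_compose[OF measurable_fst this]
  show "(\<lambda>(u, x :: real^'n). amount i u) \<in> borel_measurable (restrict_space borel {0..T} \<Otimes>\<^sub>M borel)"
    by (simp add: case_prod_beta')
next
  fix t and x :: "real^'n" assume t: "t \<in> {0..T}"
  show "\<exists>X. closed_loop_wealth M F W G r \<mu> \<sigma> T (\<lambda>i u x. amount i u) t x X"
    unfolding closed_loop_wealth_def
    using amount_admissible[OF t] explicit_wealth_process[OF t]
    by (intro exI[of _ "explicit_wealth t x"] exI[of _ "\<lambda>i v \<omega>. amount i v"]) auto
qed

section \<open>Comparison of an arbitrary wealth process with the explicit one\<close>

lemma wealth_process_measurable: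
  assumes "wealth_process M F W r \<mu> \<sigma> T t x \<rho> Y" "u \<in> {t..T}"
  shows "Y u \<in> borel_measurable M"
proof -
  have "Y u \<in> borel_measurable (F u)" using assms unfolding wealth_process_def by blast
  then show ?thesis by (rule measurable_F_M)
qed

lemma wealth_process_continuous:
  assumes "wealth_process M F W r \<mu> \<sigma> T t x \<rho> Y" "\<omega> \<in> space M"
  shows "continuous_on {t..T} (\<lambda>u. Y u \<omega>)"
  using assms unfolding wealth_process_def by blast

text \<open>Subtracting the two wealth equations removes the initial value and leaves a linear
  equation driven by the difference of the amounts.\<close>

lemma linear_deviation_wealth:
  assumes t: "0 \<le> t" "t \<le> c" "c \<le> T"
    and Y: "wealth_process M F W r \<mu> \<sigma> T t x \<rho> Y"
    and agree: "AE \<omega> in M. AE u in lborel. u \<in> {t..T} \<longrightarrow> c < u \<longrightarrow> \<rho> i u \<omega> = amount i u"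
  shows "\<exists>\<epsilon> Z. linear_deviation M F W t c T r (\<mu> - r) \<sigma>
    (\<lambda>u \<omega>. Y u \<omega> $ i - explicit_wealth t x u \<omega> $ i) Z \<epsilon>"
proof -
  have tT: "t \<in> {0..T}" "t \<le> T" using t by auto
  let ?X = "explicit_wealth t x"
  note X = explicit_wealth_process[OF tT(1), of x]
  have "\<forall>u\<in>{t..T}. \<exists>Z. has_ito_integral M F W t u (\<lambda>v \<omega>. \<rho> i v \<omega> * \<sigma>) Z \<and>
      (AE \<omega> in M. Y u \<omega> $ i = x $ i + (LBINT v:{t..u}. r * Y v \<omega> $ i + \<rho> i v \<omega> * (\<mu> - r)) + Z \<omega>)"
    using Y unfolding wealth_process_def by blast
  from bchoice[OF this] obtain Z\<rho> where Z\<rho>: "\<And>u. u \<in> {t..T} \<Longrightarrow> has_ito_integral M F W t u (\<lambda>v \<omega>. \<rho> i v \<omega> * \<sigma>) (Z\<rho> u)"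
    and Yeq: "\<And>u. u \<in> {t..T} \<Longrightarrow>
      AE \<omega> in M. Y u \<omega> $ i = x $ i + (LBINT v:{t..u}. r * Y v \<omega> $ i + \<rho> i v \<omega> * (\<mu> - r)) + Z\<rho> u \<omega>"
    by blast
  have "\<forall>u\<in>{t..T}. \<exists>Z. has_ito_integral M F W t u (\<lambda>v \<omega>. amount i v * \<sigma>) Z \<and>
      (AE \<omega> in M. ?X u \<omega> $ i = x $ i + (LBINT v:{t..u}. r * ?X v \<omega> $ i + amount i v * (\<mu> - r)) + Z \<omega>)"
    using X unfolding wealth_process_def by blast
  from bchoice[OF this] obtain Z\<pi> where Z\<pi>: "\<And>u. u \<in> {t..T} \<Longrightarrow> has_ito_integral M F W t u (\<lambda>v \<omega>. amount i v * \<sigma>) (Z\<pi> u)"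
    and Xeq: "\<And>u. u \<in> {t..T} \<Longrightarrow>
      AE \<omega> in M. ?X u \<omega> $ i = x $ i + (LBINT v:{t..u}. r * ?X v \<omega> $ i + amount i v * (\<mu> - r)) + Z\<pi> u \<omega>"
    by blast
  have ito_\<rho>: "ito_pair (\<lambda>z. indicator {t..u} (snd z) * (\<rho> i (snd z) (fst z) * \<sigma>)) (Z\<rho> u)"
    if "u \<in> {t..T}" for u
    using has_ito_integral_imp_ito_pair[OF Z\<rho>[OF that] t(1)] that by simp
  have ito_\<pi>: "ito_pair (\<lambda>z. indicator {t..u} (snd z) * (amount i (snd z) * \<sigma>)) (Z\<pi> u)"
    if "u \<in> {t..T}" for u
    using has_ito_integral_imp_ito_pair[OF Z\<pi>[OF that] t(1)] that by simp
  define \<epsilon> :: "'a \<times> real \<Rightarrow> real" where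
    "\<epsilon> z = indicator {t..T} (snd z) * (\<rho> i (snd z) (fst z) - amount i (snd z))" for z
  define Z where "Z u \<omega> = Z\<rho> u \<omega> - Z\<pi> u \<omega>" for u \<omega>
  have ito: "ito_pair (\<lambda>z. indicator {t..u} (snd z) * (\<sigma> * \<epsilon> z)) (Z u)" if u: "u \<in> {t..T}" for u
  proof -
    have eq: "(\<lambda>z. indicator {t..u} (snd z) * (\<rho> i (snd z) (fst z) * \<sigma>) -
        indicator {t..u} (snd z) * (amount i (snd z) * \<sigma>)) = (\<lambda>z. indicator {t..u} (snd z) * (\<sigma> * \<epsilon> z))"
      using u by (auto simp: fun_eq_iff \<epsilon>_def indicator_def algebra_simps)
    show ?thesis using ito_pair_diff[OF ito_\<rho>[OF u] ito_\<pi>[OF u]] unfolding eq Z_def[abs_def] .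
  qed
  have TT: "T \<in> {t..T}" and cT: "c \<in> {t..T}" using t by auto
  \<comment> \<open>The stochastic integral controls \<open>\<sigma> * \<epsilon>\<close>, and
    \<open>\<sigma> > 0\<close> allows dividing.\<close>
  have eps: "sq_int P \<epsilon>"
  proof -
    have "(\<lambda>z. 1 / \<sigma> * (indicator {t..T} (snd z) * (\<sigma> * \<epsilon> z))) = \<epsilon>"
      using \<sigma>_pos by (auto simp: fun_eq_iff \<epsilon>_def indicator_def)
    then show ?thesis using sq_int_cmult[OF ito_pair_sq_int(1)[OF ito[OF TT]], of "1 / \<sigma>"] by simp
  qed
  note [measurable] = sq_int_measurable[OF eps]
  have "linear_deviation M F W t c T r (\<mu> - r) \<sigma> (\<lambda>u \<omega>. Y u \<omega> $ i - ?X u \<omega> $ i) Z \<epsilon>"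
  proof
    show "0 \<le> t" "t \<le> c" "c \<le> T" "0 \<le> r" using t r_nonneg by auto
    show "sq_int P \<epsilon>" by fact
    show "ito_pair (\<lambda>z. indicator {t..u} (snd z) * (\<sigma> * \<epsilon> z)) (Z u)" if "u \<in> {t..T}" for u
      using ito[OF that] .
    show "\<epsilon> (\<omega>, u) = 0" if "u \<notin> {t..T}" for \<omega> u using that by (simp add: \<epsilon>_def)
  next
    fix u assume u: "u \<in> {t..T}"
    show "(\<lambda>\<omega>. Y u \<omega> $ i - ?X u \<omega> $ i) \<in> borel_measurable M"
      by (intro borel_measurable_diff borel_measurable_vec_nth wealth_process_measurable[OF Y u]
          wealth_process_measurable[OF X u])
  next
    fix \<omega> assume "\<omega> \<in> space M"
    then show "continuous_on {t..T} (\<lambda>u. Y u \<omega> $ i - ?X u \<omega> $ i)"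
      by (intro continuous_intros wealth_process_continuous[OF X] wealth_process_continuous[OF Y])
  next
    show "AE z in P. c < snd z \<longrightarrow> \<epsilon> z = 0"
    proof (rule prod.AE_pair_measure)
      show "AE \<omega> in M. AE u in lborel. c < snd (\<omega>, u) \<longrightarrow> \<epsilon> (\<omega>, u) = 0"
        using agree
      proof eventually_elim
        case (elim \<omega>)
        then show ?case by eventually_elim (auto simp: \<epsilon>_def indicator_def)
      qed
    qed measurable
  next
    \<comment> \<open>Adaptedness up to \<open>c\<close> is read off from the integral over
      \<open>{t..c}\<close>, whose definition contains progressive measurability up to that
      time.\<close>
    have "progressively_measurable F t c (\<lambda>v \<omega>. \<rho> i v \<omega> * \<sigma>)"
      using Z\<rho>[OF cT] by (simp add: has_ito_integral_def)
    from progressively_measurable_joint[OF this t(2) measurable_ident[unfolded id_def]]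
    have 1: "(\<lambda>z. indicator {t..c} (snd z) * (\<rho> i (snd z) (fst z) * \<sigma>)) \<in> borel_measurable (F c \<Otimes>\<^sub>M lborel)" .
    have 2: "(\<lambda>z. indicat_real {t..c} (snd z) * amount i (snd z)) \<in> borel_measurable (F c \<Otimes>\<^sub>M lborel)"
      by measurable
    have "(\<lambda>z. indicator {t..c} (snd z) * \<epsilon> z) =
      (\<lambda>z. 1 / \<sigma> * (indicator {t..c} (snd z) * (\<rho> i (snd z) (fst z) * \<sigma>)) - indicat_real {t..c} (snd z) * amount i (snd z))"
      using \<sigma>_pos t by (auto simp: fun_eq_iff \<epsilon>_def indicator_def)
    then show "(\<lambda>z. indicator {t..c} (snd z) * \<epsilon> z) \<in> borel_measurable (F c \<Otimes>\<^sub>M lborel)"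
      using borel_measurable_diff[OF borel_measurable_times[OF borel_measurable_const[of "1 / \<sigma>"] 1] 2] by simp
  next
    fix u assume u: "u \<in> {t..T}"
    have supp: "\<epsilon> (\<omega>, v) = 0" if "v \<notin> {t..T}" for \<omega> v using that by (simp add: \<epsilon>_def)
    have "AE \<omega> in M. integrable lborel (\<lambda>v. \<epsilon> (\<omega>, v))"
      by (rule sq_int_time_integral(2)[OF eps supp tT(2)])
    then show "AE \<omega> in M. Y u \<omega> $ i - ?X u \<omega> $ i =
        (LBINT v:{t..u}. r * (Y v \<omega> $ i - ?X v \<omega> $ i) + (\<mu> - r) * \<epsilon> (\<omega>, v)) + Z u \<omega>"
      using Yeq[OF u] Xeq[OF u] AE_space
    proof eventually_elim
      case (elim \<omega>)
      have cY: "continuous_on {t..u} (\<lambda>v. Y v \<omega>)" and cX: "continuous_on {t..u} (\<lambda>v. ?X v \<omega>)"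
        using u by (auto intro: continuous_on_subset[OF wealth_process_continuous[OF Y elim(4)]]
            continuous_on_subset[OF wealth_process_continuous[OF X elim(4)]])
      have iX: "set_integrable lborel {t..u} (\<lambda>v. r * ?X v \<omega> $ i + amount i v * (\<mu> - r))"
        by (intro borel_integrable_atLeastAtMost' continuous_intros cX amount_continuous)
      have i1: "set_integrable lborel {t..u} (\<lambda>v. r * (Y v \<omega> $ i - ?X v \<omega> $ i))"
        by (intro borel_integrable_atLeastAtMost' continuous_intros cX cY)
      have "set_integrable lborel UNIV (\<lambda>v. \<epsilon> (\<omega>, v))" using elim(1) by (simp add: set_integrable_def)
      then have "set_integrable lborel {t..u} (\<lambda>v. \<epsilon> (\<omega>, v))" by (rule set_integrable_subset) auto
      then have i2: "set_integrable lborel {t..u} (\<lambda>v. (\<mu> - r) * \<epsilon> (\<omega>, v))"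
        by (rule set_integrable_mult_right)
      have i3: "set_integrable lborel {t..u} (\<lambda>v. r * (Y v \<omega> $ i - ?X v \<omega> $ i) + (\<mu> - r) * \<epsilon> (\<omega>, v))"
        by (rule set_integral_add(1)[OF i1 i2])
      have "(LBINT v:{t..u}. r * Y v \<omega> $ i + \<rho> i v \<omega> * (\<mu> - r)) =
        (LBINT v:{t..u}. (r * ?X v \<omega> $ i + amount i v * (\<mu> - r)) +
           (r * (Y v \<omega> $ i - ?X v \<omega> $ i) + (\<mu> - r) * \<epsilon> (\<omega>, v)))"
        using u by (intro set_lebesgue_integral_cong) (auto simp: \<epsilon>_def algebra_simps)
      also have "\<dots> = (LBINT v:{t..u}. r * ?X v \<omega> $ i + amount i v * (\<mu> - r)) +
          (LBINT v:{t..u}. r * (Y v \<omega> $ i - ?X v \<omega> $ i) + (\<mu> - r) * \<epsilon> (\<omega>, v))"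
        by (rule set_integral_add(2)[OF iX i3])
      finally show ?case using elim(2,3) by (simp add: Z_def)
    qed
  qed
  then show ?thesis by blast
qed

text \<open>\<open>growth\<close> and \<open>rem_const\<close> are the constants \<open>A\<close>
  and \<open>C1\<close> of \<open>linear_deviation\<close>, restated outside that locale to show
  that no deviation enters them.\<close>

definition growth :: "real \<Rightarrow> real" where
  "growth t = exp (r * (T - t))"

definition rem_const :: "real \<Rightarrow> real" where
  "rem_const t = sqrt (4 * (r * growth t)\<^sup>2 * ((\<mu> - r)\<^sup>2 * (T - t) + \<sigma>\<^sup>2))"

text \<open>Here \<open>q\<close> is the norm \<open>sqrt Q\<close> of the deviation and
  \<open>e\<close> the mean of its time integral. That the same unknown \<open>e\<close> occurs in
  both linear bounds is what later allows it to cancel.\<close>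

lemma wealth_deviation_bounds:
  fixes x :: "real^'n"
  assumes t: "0 \<le> t" "t \<le> c" "c \<le> T"
    and Y: "wealth_process M F W r \<mu> \<sigma> T t x \<rho> Y"
    and agree: "AE \<omega> in M. AE u in lborel. u \<in> {t..T} \<longrightarrow> c < u \<longrightarrow> \<rho> i u \<omega> = amount i u"
  defines "D \<equiv> (\<lambda>\<omega>. Y T \<omega> $ i - explicit_wealth t x T \<omega> $ i)"
  obtains q e where "0 \<le> q" "sq_int M D"
    "\<bar>expectation D - growth t * (\<mu> - r) * e\<bar> \<le> rem_const t * (c - t) * q"
    "\<bar>expectation (\<lambda>\<omega>. (W T \<omega> - W t \<omega>) * D \<omega>) - growth t * \<sigma> * e\<bar> \<le>
       (growth t * \<bar>\<mu> - r\<bar> + sqrt (T - t) * rem_const t) * (c - t) * q"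
    "\<sigma>\<^sup>2 * q\<^sup>2 / 2 - 2 * ((growth t)\<^sup>2 * (\<mu> - r)\<^sup>2 * (c - t) + (rem_const t)\<^sup>2 * (c - t)\<^sup>2) * q\<^sup>2 \<le> variance D"
proof -
  obtain \<epsilon> Z where "linear_deviation M F W t c T r (\<mu> - r) \<sigma> (\<lambda>u \<omega>. Y u \<omega> $ i - explicit_wealth t x u \<omega> $ i) Z \<epsilon>"
    using linear_deviation_wealth[OF t Y agree] by blast
  then interpret dev: linear_deviation M F W t c T r "\<mu> - r" \<sigma>
    "\<lambda>u \<omega>. Y u \<omega> $ i - explicit_wealth t x u \<omega> $ i" Z \<epsilon> .
  have A: "dev.A = growth t" by (simp add: dev.A_def growth_def)
  have C: "dev.C1 = rem_const t" by (simp add: dev.C1_def rem_const_def A)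
  have q2: "(sqrt dev.Q)\<^sup>2 = dev.Q" using dev.Q_nonneg by simp
  show thesis
    by (rule that[of "sqrt dev.Q" dev.mean_eps, unfolded q2 D_def, OF _ dev.sq_int_D
          dev.D_expectation[unfolded A C] dev.D_mult_increment[unfolded A C] dev.D_variance[unfolded A C]])
      (simp add: dev.Q_nonneg)
qed

text \<open>The case \<open>c = t\<close> of a deviation; it serves the equilibrium wealth itself
  and the investors who do not deviate.\<close>

lemma wealth_eq_explicit:
  assumes t: "t \<in> {0..T}"
    and Y: "wealth_process M F W r \<mu> \<sigma> T t x \<rho> Y"
    and agree: "AE \<omega> in M. AE u in lborel. u \<in> {t..T} \<longrightarrow> \<rho> i u \<omega> = amount i u"
  shows "AE \<omega> in M. Y T \<omega> $ i = explicit_wealth t x T \<omega> $ i"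
proof -
  have agree': "AE \<omega> in M. AE u in lborel. u \<in> {t..T} \<longrightarrow> t < u \<longrightarrow> \<rho> i u \<omega> = amount i u"
    using agree by eventually_elim auto
  obtain \<epsilon> Z where "linear_deviation M F W t t T r (\<mu> - r) \<sigma> (\<lambda>u \<omega>. Y u \<omega> $ i - explicit_wealth t x u \<omega> $ i) Z \<epsilon>"
    using linear_deviation_wealth[OF _ _ _ Y agree'] t by auto
  then interpret dev: linear_deviation M F W t t T r "\<mu> - r" \<sigma>
    "\<lambda>u \<omega>. Y u \<omega> $ i - explicit_wealth t x u \<omega> $ i" Z \<epsilon> .
  show ?thesis using dev.D_zero by simp
qed

end

section \<open>Averages, the first order condition and the objective\<close>

lemma avg_add: "avg (\<lambda>j. f j + g j) = avg f + avg g"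
  by (simp add: avg_def sum.distrib add_divide_distrib)

lemma avg_cmult: "avg (\<lambda>j. a * f j) = a * avg f"
  by (simp add: avg_def sum_distrib_left)

lemma avg_delta: "avg (\<lambda>j :: 'n::finite. if j = i then d else 0) = d / real CARD('n)"
  by (simp add: avg_def)

context mean_variance_market
begin

lemma avg_lV_less_1: "avg lV < 1"
proof -
  have "(\<Sum>j\<in>UNIV. lV j) < (\<Sum>j\<in>(UNIV :: 'n set). 1)"
    using lV by (intro sum_strict_mono) auto
  then show ?thesis by (simp add: avg_def)
qed

text \<open>Averaging the definition of \<open>coef\<close> multiplies the average of
  \<open>kappa\<close> by \<open>1 + avg lV / (1 - avg lV) = 1 / (1 - avg lV)\<close>.\<close>

lemma coef_diff_avg:
  "coef i - l * avg coef = (\<mu> - r) / \<sigma>\<^sup>2 *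
    (kappa \<gamma> lM lV i + (lV i - l) / (1 - avg lV) * avg (kappa \<gamma> lM lV))"
proof -
  let ?k = "kappa \<gamma> lM lV" and ?c = "(\<mu> - r) / \<sigma>\<^sup>2"
  define d where "d = 1 - avg lV"
  have d: "d \<noteq> 0" using avg_lV_less_1 by (simp add: d_def)
  have "coef = (\<lambda>j. ?c * (?k j + (avg ?k / d) * lV j))" by (simp add: coef_def d_def fun_eq_iff)
  then have "avg coef = ?c * (avg ?k + avg ?k / d * avg lV)" by (simp only: avg_cmult avg_add)
  also have "avg ?k + avg ?k / d * avg lV = avg ?k / d" using d by (simp add: field_simps d_def)
  finally have avg_coef: "avg coef = ?c * (avg ?k / d)" .
  have "c * (k + v / d * a) - l * (c * (a / d)) = c * (k + (v - l) / d * a)" for c k v a :: real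
    by (simp add: algebra_simps diff_divide_distrib)
  then show ?thesis unfolding avg_coef coef_def d_def[symmetric] .
qed

text \<open>This is the linear system behind the formula for the strategies: the first order
  condition prescribes the right-hand side, and solving for the average of \<open>coef\<close>
  produces the denominator \<open>1 - avg lV\<close>.\<close>

lemma coef_diff_avg_lV: "coef i - lV i * avg coef = (\<mu> - r) / \<sigma>\<^sup>2 * kappa \<gamma> lM lV i"
  by (simp add: coef_diff_avg)

lemma own_weight_pos: "0 < 1 - lV i / real CARD('n)"
proof -
  have "lV i < 1" using lV[of i] by simp
  also have "1 \<le> real CARD('n)" by simp
  finally show ?thesis by (simp add: field_simps)
qed

text \<open>Marginal mean against marginal variance when one investor changes the own amount. The
  weights \<open>1 - lM i / real CARD('n)\<close> and \<open>1 - lV i / real CARD('n)\<close> arise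
  because the change also moves the average, by its share of one investor.\<close>

lemma first_order_condition:
  "(1 - lM i / real CARD('n)) * (\<mu> - r) =
    \<gamma> i * (1 - lV i / real CARD('n)) * (coef i - lV i * avg coef) * \<sigma>\<^sup>2"
  unfolding coef_diff_avg_lV kappa_def
  using own_weight_pos[of i] \<gamma>_pos[of i] \<sigma>_pos by simp

lemma relative_wealth_eq:
  fixes x y :: "real^'n"
  assumes "\<And>j. y $ j = explicit_wealth t x T \<omega> $ j + (if j = i then d else 0)"
  shows "y $ i - l * avg (($) y) = exp (r * (T - t)) * (x $ i - l * avg (($) x))
    + (coef i - l * avg coef) * ((\<mu> - r) * (T - t) + \<sigma> * (W T \<omega> - W t \<omega>))
    + (1 - l / real CARD('n)) * d"
proof -
  let ?a = "(\<mu> - r) * (T - t) + \<sigma> * (W T \<omega> - W t \<omega>)"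
  have y: "y $ j = exp (r * (T - t)) * x $ j + ?a * coef j + (if j = i then d else 0)" for j
    unfolding assms by (simp add: explicit_wealth_def amount_eq)
  have avg_y: "avg (($) y) = exp (r * (T - t)) * avg (($) x) + ?a * avg coef + d / real CARD('n)"
    unfolding y[abs_def] by (simp only: avg_add avg_cmult avg_delta)
  show ?thesis unfolding avg_y y[of i] by (simp add: algebra_simps)
qed

text \<open>Relative wealth is a constant plus \<open>b * \<sigma> * w + p * D\<close> with
  \<open>w = W T - W t\<close>. As \<open>w\<close> has mean 0, centring \<open>D\<close> leaves the
  mixed term unchanged, and the variance expands into three terms of which the middle one is linear
  in \<open>D\<close>.\<close>

lemma objective_eq:
  fixes x :: "real^'n"
  assumes t: "t \<in> {0..T}" and Ym: "Y T \<in> borel_measurable M" and D: "sq_int M D"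
    and Y: "AE \<omega> in M. \<forall>j. Y T \<omega> $ j = explicit_wealth t x T \<omega> $ j + (if j = i then D \<omega> else 0)"
  defines "b \<equiv> coef i - lV i * avg coef" and "p \<equiv> 1 - lV i / real CARD('n)"
  shows "objective M T \<gamma> lM lV i Y =
    exp (r * (T - t)) * (x $ i - lM i * avg (($) x)) + (coef i - lM i * avg coef) * ((\<mu> - r) * (T - t))
    + (1 - lM i / real CARD('n)) * expectation D
    - \<gamma> i / 2 * (b\<^sup>2 * \<sigma>\<^sup>2 * (T - t) + 2 * b * \<sigma> * p * expectation (\<lambda>\<omega>. (W T \<omega> - W t \<omega>) * D \<omega>)
        + p\<^sup>2 * variance D)"
proof -
  let ?w = "\<lambda>\<omega>. W T \<omega> - W t \<omega>"
  define R where "R l \<omega> = Y T \<omega> $ i - l * avg (($) (Y T \<omega>))" for l \<omega>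
  define k where "k l = exp (r * (T - t)) * (x $ i - l * avg (($) x)) + (coef i - l * avg coef) * ((\<mu> - r) * (T - t))" for l
  have tT: "0 \<le> t" "t \<le> T" using t by auto
  have sw: "sq_int M ?w" by (rule sq_int_increment[OF tT])
  have iD: "integrable M D" and iw: "integrable M ?w" using D sw by (auto intro: integrable_sq_int)
  have mD: "D \<in> borel_measurable M" and mw: "?w \<in> borel_measurable M" using D sw by (auto intro: sq_int_measurable)
  have mY: "(\<lambda>\<omega>. Y T \<omega> $ j) \<in> borel_measurable M" for j by (rule borel_measurable_vec_nth[OF Ym])
  have Rm: "R l \<in> borel_measurable M" for l
    unfolding R_def[abs_def] avg_def using mY
    by (intro borel_measurable_diff borel_measurable_times borel_measurable_divide borel_measurable_sum borel_measurable_const)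
  have R: "AE \<omega> in M. R l \<omega> = k l + (coef i - l * avg coef) * \<sigma> * ?w \<omega> + (1 - l / real CARD('n)) * D \<omega>" for l
    using Y
  proof eventually_elim
    case (elim \<omega>)
    then show ?case
      using relative_wealth_eq[of "Y T \<omega>" t x \<omega> i "D \<omega>" l] by (simp add: R_def k_def algebra_simps)
  qed
  have ER: "expectation (R l) = k l + (1 - l / real CARD('n)) * expectation D" for l
  proof -
    have "expectation (R l) = expectation (\<lambda>\<omega>. k l + (coef i - l * avg coef) * \<sigma> * ?w \<omega> + (1 - l / real CARD('n)) * D \<omega>)"
      using mD mw by (intro integral_cong_AE R Rm) auto
    also have "\<dots> = k l + (coef i - l * avg coef) * \<sigma> * expectation ?w + (1 - l / real CARD('n)) * expectation D"
      using iD iw prob_space by (simp del: Bochner_Integration.integral_diff)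
    finally show ?thesis using expectation_increment[OF tT] by simp
  qed
  define d where "d \<omega> = D \<omega> - expectation D" for \<omega>
  have sd: "sq_int M d" unfolding d_def[abs_def] by (intro sq_int_diff D sq_int_const)
  have i1: "integrable M (\<lambda>\<omega>. (?w \<omega>)\<^sup>2)" and i2: "integrable M (\<lambda>\<omega>. (d \<omega>)\<^sup>2)"
    and i3: "integrable M (\<lambda>\<omega>. ?w \<omega> * d \<omega>)" and i4: "integrable M (\<lambda>\<omega>. ?w \<omega> * D \<omega>)"
    using sw sd D by (auto intro: sq_int_integrable integrable_mult_sq_int)
  have wd: "expectation (\<lambda>\<omega>. ?w \<omega> * d \<omega>) = expectation (\<lambda>\<omega>. ?w \<omega> * D \<omega>)"
  proof -
    have "expectation (\<lambda>\<omega>. ?w \<omega> * d \<omega>) = expectation (\<lambda>\<omega>. ?w \<omega> * D \<omega> - ?w \<omega> * expectation D)"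
      by (intro Bochner_Integration.integral_cong) (auto simp: d_def algebra_simps)
    also have "\<dots> = expectation (\<lambda>\<omega>. ?w \<omega> * D \<omega>) - expectation (\<lambda>\<omega>. ?w \<omega> * expectation D)"
      by (intro Bochner_Integration.integral_diff i4 integrable_mult_left iw)
    also have "expectation (\<lambda>\<omega>. ?w \<omega> * expectation D) = expectation ?w * expectation D"
      by (rule integral_mult_left_zero)
    finally show ?thesis using expectation_increment[OF tT] by simp
  qed
  have "variance (R (lV i)) = expectation (\<lambda>\<omega>. (b * \<sigma>)\<^sup>2 * (?w \<omega>)\<^sup>2 + (2 * b * \<sigma> * p) * (?w \<omega> * d \<omega>) + p\<^sup>2 * (d \<omega>)\<^sup>2)"
  proof (rule integral_cong_AE)
    show "(\<lambda>\<omega>. (R (lV i) \<omega> - expectation (R (lV i)))\<^sup>2) \<in> borel_measurable M" using Rm by simp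
    show "(\<lambda>\<omega>. (b * \<sigma>)\<^sup>2 * (?w \<omega>)\<^sup>2 + (2 * b * \<sigma> * p) * (?w \<omega> * d \<omega>) + p\<^sup>2 * (d \<omega>)\<^sup>2) \<in> borel_measurable M"
      using mw sq_int_measurable[OF sd] by simp
    show "AE \<omega> in M. (R (lV i) \<omega> - expectation (R (lV i)))\<^sup>2 =
        (b * \<sigma>)\<^sup>2 * (?w \<omega>)\<^sup>2 + (2 * b * \<sigma> * p) * (?w \<omega> * d \<omega>) + p\<^sup>2 * (d \<omega>)\<^sup>2"
      using R[of "lV i"]
    proof eventually_elim
      case (elim \<omega>)
      have eq: "R (lV i) \<omega> - expectation (R (lV i)) = b * \<sigma> * ?w \<omega> + p * d \<omega>"
        unfolding elim ER b_def p_def d_def by (simp add: algebra_simps diff_divide_distrib)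
      show ?case unfolding eq by (simp add: power2_eq_square algebra_simps)
    qed
  qed
  also have "\<dots> = (b * \<sigma>)\<^sup>2 * expectation (\<lambda>\<omega>. (?w \<omega>)\<^sup>2) + (2 * b * \<sigma> * p) * expectation (\<lambda>\<omega>. ?w \<omega> * d \<omega>)
      + p\<^sup>2 * expectation (\<lambda>\<omega>. (d \<omega>)\<^sup>2)"
    using i1 i2 i3 by simp
  also have "\<dots> = b\<^sup>2 * \<sigma>\<^sup>2 * (T - t) + 2 * b * \<sigma> * p * expectation (\<lambda>\<omega>. ?w \<omega> * D \<omega>) + p\<^sup>2 * variance D"
    unfolding wd expectation_increment_square[OF tT] by (simp add: d_def power_mult_distrib)
  finally have VR: "variance (R (lV i)) = \<dots>" .
  have "objective M T \<gamma> lM lV i Y = expectation (R (lM i)) - \<gamma> i / 2 * variance (R (lV i))"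
    by (simp add: objective_def R_def[abs_def])
  then show ?thesis unfolding VR unfolding ER k_def by simp
qed

lemma objective_equilibrium:
  fixes x :: "real^'n"
  assumes t: "t \<in> {0..T}"
    and X: "closed_loop_wealth M F W G r \<mu> \<sigma> T (\<lambda>i u x. amount i u) t x X"
  shows "objective M T \<gamma> lM lV i X =
    exp (r * (T - t)) * (x $ i - lM i * avg (($) x)) + (coef i - lM i * avg coef) * ((\<mu> - r) * (T - t))
    - \<gamma> i / 2 * ((coef i - lV i * avg coef)\<^sup>2 * \<sigma>\<^sup>2 * (T - t))"
proof -
  obtain \<rho> where X': "wealth_process M F W r \<mu> \<sigma> T t x \<rho> X"
    and \<rho>: "\<And>j. AE \<omega> in M. AE u in lborel. u \<in> {t..T} \<longrightarrow> \<rho> j u \<omega> = amount j u"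
    using X unfolding closed_loop_wealth_def by blast
  have "AE \<omega> in M. \<forall>j. X T \<omega> $ j = explicit_wealth t x T \<omega> $ j + (if j = i then 0 else 0)"
    using wealth_eq_explicit[OF t X' \<rho>] by (simp add: AE_all_countable)
  moreover have "X T \<in> borel_measurable M" using t by (intro wealth_process_measurable[OF X']) auto
  ultimately show ?thesis
    using objective_eq[OF t, of X "\<lambda>_. 0" x i] by (simp add: sq_int_zero)
qed

text \<open>The loss is at least \<open>k * s\<^sup>2 - B * h * s\<close>, where \<open>s\<close> is
  the norm of the deviation; completing the square bounds this from below whatever \<open>s\<close>
  is. The constants serve all deviations of the investor at once, which is essential because the
  wealth process, and with it \<open>s\<close>, may change arbitrarily with
  \<open>h\<close>.\<close>

lemma deviation_loss:
  assumes t: "t \<in> {0..<T}"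
  obtains C h0 where "0 < h0"
    "\<And>h \<theta> x X Y. 0 < h \<Longrightarrow> h < h0 \<Longrightarrow>
       closed_loop_wealth M F W G r \<mu> \<sigma> T (\<lambda>i u x. amount i u) t x X \<Longrightarrow>
       closed_loop_wealth M F W G r \<mu> \<sigma> T
         ((\<lambda>i u x. amount i u)(i := concat_strategy (t + h) \<theta> (\<lambda>u x. amount i u))) t x Y \<Longrightarrow>
       - (C * h\<^sup>2) \<le> objective M T \<gamma> lM lV i X - objective M T \<gamma> lM lV i Y"
proof -
  define m where "m = \<mu> - r"
  define q where "q = 1 - lM i / real CARD('n)"
  define p where "p = 1 - lV i / real CARD('n)"
  define b where "b = coef i - lV i * avg coef"
  define \<beta> where "\<beta> = \<gamma> i * p * b * \<sigma>"
  define C2 where "C2 = growth t * \<bar>m\<bar> + sqrt (T - t) * rem_const t"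
  \<comment> \<open>\<open>B\<close> gathers the errors of the two linear terms, \<open>B3\<close>
    the correction in the variance bound, and \<open>k\<close> is
    \<open>\<gamma> i * p\<^sup>2 / 2\<close> times the \<open>\<sigma>\<^sup>2 / 4\<close> that
    remains of the variance.\<close>
  define B where "B = \<bar>q\<bar> * rem_const t + \<bar>\<beta>\<bar> * C2"
  define B3 where "B3 = 2 * ((growth t)\<^sup>2 * m\<^sup>2 + (rem_const t)\<^sup>2)"
  define k where "k = \<gamma> i * p\<^sup>2 * \<sigma>\<^sup>2 / 8"
  \<comment> \<open>\<open>h < T - t\<close> keeps the deviation within the horizon,
    \<open>h \<le> 1\<close> gives \<open>h\<^sup>2 \<le> h\<close>, and the third bound lets the
    correction consume at most half of \<open>\<sigma>\<^sup>2 / 2\<close>. The \<open>+ 1\<close>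
    covers \<open>B3 = 0\<close>.\<close>
  define h0 where "h0 = min (T - t) (min 1 (\<sigma>\<^sup>2 / (4 * (B3 + 1))))"
  have foc: "q * m = \<beta> * \<sigma>"
    using first_order_condition[of i] by (simp add: q_def m_def \<beta>_def p_def b_def power2_eq_square)
  have B3: "0 \<le> B3" by (simp add: B3_def)
  have k: "0 < k" using \<gamma>_pos[of i] own_weight_pos[of i] \<sigma>_pos by (simp add: k_def p_def)
  have tT: "t \<in> {0..T}" using t by auto
  show thesis
  proof (rule that[of h0 "B\<^sup>2 / (4 * k)"])
    show "0 < h0" using t B3 \<sigma>_pos by (simp add: h0_def)
    fix h \<theta> x X Y
    assume h: "0 < h" "h < h0"
      and X: "closed_loop_wealth M F W G r \<mu> \<sigma> T (\<lambda>i u x. amount i u) t x X"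
      and Y: "closed_loop_wealth M F W G r \<mu> \<sigma> T
         ((\<lambda>i u x. amount i u)(i := concat_strategy (t + h) \<theta> (\<lambda>u x. amount i u))) t x Y"
    have hT: "h < T - t" and h1: "h \<le> 1" and h3: "h \<le> \<sigma>\<^sup>2 / (4 * (B3 + 1))" using h by (auto simp: h0_def)
    obtain \<rho> where Y': "wealth_process M F W r \<mu> \<sigma> T t x \<rho> Y"
      and \<rho>: "\<And>j. AE \<omega> in M. AE u in lborel. u \<in> {t..T} \<longrightarrow>
        \<rho> j u \<omega> = ((\<lambda>i u x. amount i u)(i := concat_strategy (t + h) \<theta> (\<lambda>u x. amount i u))) j u (Y u \<omega>)"
      using Y unfolding closed_loop_wealth_def by blast
    have agree: "AE \<omega> in M. AE u in lborel. u \<in> {t..T} \<longrightarrow> t + h < u \<longrightarrow> \<rho> i u \<omega> = amount i u"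
      using \<rho>[of i]
    proof eventually_elim
      case (elim \<omega>)
      then show ?case by eventually_elim (auto simp: concat_strategy_def)
    qed
    define D where "D = (\<lambda>\<omega>. Y T \<omega> $ i - explicit_wealth t x T \<omega> $ i)"
    define w where "w = (\<lambda>\<omega>. W T \<omega> - W t \<omega>)"
    have c: "0 \<le> t" "t \<le> t + h" "t + h \<le> T" using t h hT by auto
    obtain s e where s: "0 \<le> s" and D: "sq_int M D"
      and ED: "\<bar>expectation D - growth t * m * e\<bar> \<le> rem_const t * h * s"
      and EwD: "\<bar>expectation (\<lambda>\<omega>. w \<omega> * D \<omega>) - growth t * \<sigma> * e\<bar> \<le> C2 * h * s"
      and VD: "\<sigma>\<^sup>2 * s\<^sup>2 / 2 - 2 * ((growth t)\<^sup>2 * m\<^sup>2 * h + (rem_const t)\<^sup>2 * h\<^sup>2) * s\<^sup>2 \<le> variance D"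
      by (rule wealth_deviation_bounds[OF c Y' agree]) (simp add: D_def m_def C2_def w_def)
    have other: "AE \<omega> in M. Y T \<omega> $ j = explicit_wealth t x T \<omega> $ j" if "j \<noteq> i" for j
    proof (rule wealth_eq_explicit[OF tT Y'])
      show "AE \<omega> in M. AE u in lborel. u \<in> {t..T} \<longrightarrow> \<rho> j u \<omega> = amount j u" using \<rho>[of j] that by simp
    qed
    have "AE \<omega> in M. Y T \<omega> $ j = explicit_wealth t x T \<omega> $ j + (if j = i then D \<omega> else 0)" for j
      using other[of j] by (cases "j = i") (auto simp: D_def)
    then have ae: "AE \<omega> in M. \<forall>j. Y T \<omega> $ j = explicit_wealth t x T \<omega> $ j + (if j = i then D \<omega> else 0)"
      by (simp add: AE_all_countable)
    have Ym: "Y T \<in> borel_measurable M" using t by (intro wealth_process_measurable[OF Y']) auto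
    have J: "objective M T \<gamma> lM lV i X - objective M T \<gamma> lM lV i Y =
       - q * expectation D + \<beta> * expectation (\<lambda>\<omega>. w \<omega> * D \<omega>) + \<gamma> i * p\<^sup>2 / 2 * variance D"
      unfolding objective_equilibrium[OF tT X] objective_eq[where Y = Y and D = D and i = i and x = x, OF tT Ym D ae]
      by (simp add: q_def p_def b_def \<beta>_def w_def algebra_simps)
    have "\<bar>q * (expectation D - growth t * m * e)\<bar> \<le> \<bar>q\<bar> * (rem_const t * h * s)"
      unfolding abs_mult by (intro mult_left_mono ED) simp
    moreover have "\<bar>\<beta> * (expectation (\<lambda>\<omega>. w \<omega> * D \<omega>) - growth t * \<sigma> * e)\<bar> \<le> \<bar>\<beta>\<bar> * (C2 * h * s)"
      unfolding abs_mult by (intro mult_left_mono EwD) simp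
    \<comment> \<open>All dependence on the uncontrolled mean \<open>e\<close> is moved into the
      last summand, which the first order condition makes zero.\<close>
    moreover have "- q * expectation D + \<beta> * expectation (\<lambda>\<omega>. w \<omega> * D \<omega>) =
      - (q * (expectation D - growth t * m * e)) + \<beta> * (expectation (\<lambda>\<omega>. w \<omega> * D \<omega>) - growth t * \<sigma> * e)
        + growth t * e * (\<beta> * \<sigma> - q * m)"
      by (simp add: algebra_simps)
    moreover have "growth t * e * (\<beta> * \<sigma> - q * m) = 0" by (simp add: foc)
    moreover have "B * h * s = \<bar>q\<bar> * (rem_const t * h * s) + \<bar>\<beta>\<bar> * (C2 * h * s)"
      by (simp add: B_def algebra_simps)
    ultimately have 1: "- (B * h * s) \<le> - q * expectation D + \<beta> * expectation (\<lambda>\<omega>. w \<omega> * D \<omega>)"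
      by linarith
    have "2 * ((growth t)\<^sup>2 * m\<^sup>2 * h + (rem_const t)\<^sup>2 * h\<^sup>2) \<le> 2 * ((growth t)\<^sup>2 * m\<^sup>2 * h + (rem_const t)\<^sup>2 * h)"
      using h h1 by (intro mult_left_mono add_left_mono) (auto simp: power2_eq_square mult_left_le_one_le)
    also have "\<dots> = B3 * h" by (simp add: B3_def algebra_simps)
    also have "\<dots> \<le> (B3 + 1) * h" using h by simp
    also have "\<dots> \<le> (B3 + 1) * (\<sigma>\<^sup>2 / (4 * (B3 + 1)))" using B3 h3 by (intro mult_left_mono) auto
    also have "\<dots> = \<sigma>\<^sup>2 / 4"
    proof -
      have "z * (\<sigma>\<^sup>2 / (4 * z)) = \<sigma>\<^sup>2 / 4" if "z \<noteq> 0" for z using that by simp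
      then show ?thesis using B3 by (metis add_nonneg_pos less_irrefl zero_less_one)
    qed
    finally have "2 * ((growth t)\<^sup>2 * m\<^sup>2 * h + (rem_const t)\<^sup>2 * h\<^sup>2) * s\<^sup>2 \<le> \<sigma>\<^sup>2 / 4 * s\<^sup>2"
      by (rule mult_right_mono) simp
    then have "\<sigma>\<^sup>2 / 4 * s\<^sup>2 \<le> variance D" using VD by linarith
    then have "\<gamma> i * p\<^sup>2 / 2 * (\<sigma>\<^sup>2 / 4 * s\<^sup>2) \<le> \<gamma> i * p\<^sup>2 / 2 * variance D"
      using \<gamma>_pos[of i] by (intro mult_left_mono) auto
    then have 2: "k * s\<^sup>2 \<le> \<gamma> i * p\<^sup>2 / 2 * variance D" by (simp add: k_def)
    have "0 \<le> (2 * k * s - B * h)\<^sup>2 / (4 * k)" using k by simp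
    also have "\<dots> = k * s\<^sup>2 - B * h * s + B\<^sup>2 / (4 * k) * h\<^sup>2"
      using k by (simp add: field_simps power2_eq_square)
    finally show "- (B\<^sup>2 / (4 * k) * h\<^sup>2) \<le> objective M T \<gamma> lM lV i X - objective M T \<gamma> lM lV i Y"
      unfolding J using 1 2 by linarith
  qed
qed

text \<open>Dividing the loss bound by \<open>h\<close> leaves \<open>- (C * h)\<close> with one
  \<open>C\<close> for all members of the family \<open>Y\<close>, so the lower limit is at least
  0.\<close>

theorem amount_nash_equilibrium: "nash_equilibrium M F W G r \<mu> \<sigma> T \<gamma> lM lV (\<lambda>i u x. amount i u)"
  unfolding nash_equilibrium_def
proof (intro conjI amount_markov_strategy ballI allI impI)
  fix t x \<theta> i X Y
  assume t: "t \<in> {0..<T}"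
    and X: "closed_loop_wealth M F W G r \<mu> \<sigma> T (\<lambda>i u x. amount i u) t x X"
    and Y: "\<forall>\<^sub>F h in at_right 0. closed_loop_wealth M F W G r \<mu> \<sigma> T
      ((\<lambda>i u x. amount i u)(i := concat_strategy (t + h) (\<theta> i) (\<lambda>x. \<lambda>_. amount i x))) t x (Y h)"
  let ?J = "\<lambda>h. (objective M T \<gamma> lM lV i X - objective M T \<gamma> lM lV i (Y h)) / h"
  obtain C h0 where h0: "0 < h0" and C: "\<And>h \<theta> x X Y. 0 < h \<Longrightarrow> h < h0 \<Longrightarrow>
       closed_loop_wealth M F W G r \<mu> \<sigma> T (\<lambda>i u x. amount i u) t x X \<Longrightarrow>
       closed_loop_wealth M F W G r \<mu> \<sigma> T
         ((\<lambda>i u x. amount i u)(i := concat_strategy (t + h) \<theta> (\<lambda>u x. amount i u))) t x Y \<Longrightarrow>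
       - (C * h\<^sup>2) \<le> objective M T \<gamma> lM lV i X - objective M T \<gamma> lM lV i Y"
    using deviation_loss[OF t, where G = G and i = i] by metis
  have lim: "((\<lambda>h. ereal (- (C * h))) \<longlongrightarrow> ereal (- (C * 0))) (at_right 0)"
    by (intro tendsto_intros)
  have "Liminf (at_right 0) (\<lambda>h. ereal (- (C * h))) = 0"
    using lim_imp_Liminf[OF _ lim] by (simp add: trivial_limit_at_right_real)
  moreover have "Liminf (at_right 0) (\<lambda>h. ereal (- (C * h))) \<le> Liminf (at_right 0) (\<lambda>h. ereal (?J h))"
  proof (rule Liminf_mono)
    have "\<forall>\<^sub>F h in at_right 0. h \<in> {0<..<h0}" using h0 by (rule eventually_at_right_real)
    then show "\<forall>\<^sub>F h in at_right 0. ereal (- (C * h)) \<le> ereal (?J h)"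
      using Y
    proof eventually_elim
      case (elim h)
      then have "- (C * h\<^sup>2) \<le> objective M T \<gamma> lM lV i X - objective M T \<gamma> lM lV i (Y h)"
        using X by (intro C) auto
      then have "- (C * h) \<le> ?J h" using elim(1) by (simp add: field_simps power2_eq_square)
      then show ?case by simp
    qed
  qed
  ultimately show "0 \<le> Liminf (at_right 0) (\<lambda>h. ereal (?J h))" by simp
qed

text \<open>What remains is scalar: \<open>m / \<sigma>\<^sup>2 * m\<close> and
  \<open>(m / \<sigma>\<^sup>2)\<^sup>2 * \<sigma>\<^sup>2\<close> are both the squared Sharpe ratio
  \<open>(m / \<sigma>)\<^sup>2\<close>.\<close>

lemma equilibrium_value:
  fixes x :: "real^'n"
  assumes "t \<in> {0..T}"
    and "closed_loop_wealth M F W G r \<mu> \<sigma> T (\<lambda>i u x. amount i u) t x X"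
  shows "objective M T \<gamma> lM lV i X =
    exp (r * (T - t)) * (x $ i - lM i * avg (($) x)) + (T - t) * value_rate r \<mu> \<sigma> \<gamma> lM lV i"
proof -
  have "e + m / \<sigma>\<^sup>2 * a * (m * d) - g / 2 * ((m / \<sigma>\<^sup>2 * k)\<^sup>2 * \<sigma>\<^sup>2 * d) = e + d * ((m / \<sigma>)\<^sup>2 * (a - g * k\<^sup>2 / 2))"
    for e m a g k d :: real
    using \<sigma>_pos by (simp add: power_divide power_mult_distrib) (simp add: field_simps power2_eq_square power4_eq_xxxx)
  then show ?thesis
    unfolding objective_equilibrium[OF assms] coef_diff_avg_lV unfolding coef_diff_avg value_rate_def .
qed

end

theorem theorem3p1:
  fixes M :: "'a measure" and F :: "real \<Rightarrow> 'a measure"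
    and W S :: "real \<Rightarrow> 'a \<Rightarrow> real"
    and T r \<sigma> \<mu> s :: real
    and \<gamma> lM lV :: "'n::finite \<Rightarrow> real"
  assumes "prob_space M" and "filtration (space M) F" and "\<And>u. sets (F u) \<subseteq> sets M"
    and "brownian_motion M F W"
    and "T > 0" and "r \<ge> 0" and "\<sigma> > 0" and "s > 0"
    and "\<And>i. \<gamma> i > 0" and "\<And>i. lM i \<in> {0..<1}" and "\<And>i. lV i \<in> {0..<1}"
    and "stock_price M F W \<mu> \<sigma> T s S"
  defines "G \<equiv> information M (\<lambda>_. \<mu>) S"
    and "\<pi> \<equiv> equilibrium_amount r \<mu> \<sigma> T \<gamma> lM lV"
  shows "(\<forall>i. \<forall>t\<in>{0..T}. (\<lambda>u \<omega>. \<pi> i u) \<in> admissible M G t T) \<and>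
    nash_equilibrium M F W G r \<mu> \<sigma> T \<gamma> lM lV (\<lambda>i u x. \<pi> i u) \<and>
    (\<forall>t\<in>{0..T}. \<forall>x X i. closed_loop_wealth M F W G r \<mu> \<sigma> T (\<lambda>i u x. \<pi> i u) t x X \<longrightarrow>
       objective M T \<gamma> lM lV i X =
         exp (r * (T - t)) * (x $ i - lM i * avg (($) x)) + (T - t) * value_rate r \<mu> \<sigma> \<gamma> lM lV i)"
proof -
  interpret mean_variance_market M F W T r \<sigma> \<mu> \<gamma> lM lV
    by (intro mean_variance_market.intro brownian_basis.intro brownian_basis_axioms.intro
        mean_variance_market_axioms.intro assms)
  show ?thesis
    unfolding \<pi>_def by (intro conjI allI ballI impI amount_admissible amount_nash_equilibrium equilibrium_value)
qed

end
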